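(* There exist an algebraic surface $X$ over $\mathbb{Q}$ and a pencil of smooth curves of genus $>1$ on $X$, defined over $\mathbb{Q}$ and without base point, such that infinitely many members of the pencil defined over $\mathbb{Q}$ have exactly one rational point. Moreover, $X$ can be constructed so that its set of rational points $X(\mathbb{Q})$ is Zariski-dense in $X$.
   Context: A pencil without base point, defined over $\mathbb{Q}$, on a surface $X$ is the family of (nonempty) fibres of a nonconstant morphism $X\to\mathbb{P}_1$ defined over $\mathbb{Q}$; the members defined over $\mathbb{Q}$ are the fibres over points of $\mathbb{P}_1(\mathbb{Q})$. "Rational point" means $\mathbb{Q}$-rational point. *)

theory Defs
  imports
    "HOL-Analysis.Analysis"
    "HOL-Library.Poly_Mapping"
    "HOL-Library.Function_Algebras"
    "HOL-Library.Extended_Nat"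
begin

text \<open>
  Varieties over \<open>\<rat>\<close> are treated classically: a variety is identified with its set of complex
  points in projective space, and "over \<open>k\<close>" (with \<open>k\<close> a subset of the complex numbers, in practice
  \<open>\<rat>\<close> or \<open>UNIV\<close>) means that the defining data can be chosen with coefficients in \<open>k\<close>.
\<close>

section \<open>Forms in the variables \<open>x\<^sub>0, \<dots>, x\<^sub>n\<close>\<close>

type_synonym mpoly = "(nat \<Rightarrow>\<^sub>0 nat) \<Rightarrow>\<^sub>0 complex"
type_synonym vec = "nat \<Rightarrow> complex"

definition mpoly_eval :: "mpoly \<Rightarrow> vec \<Rightarrow> complex" where
  "mpoly_eval F x =
     (\<Sum>m\<in>Poly_Mapping.keys F. Poly_Mapping.lookup F m *
        (\<Prod>i\<in>Poly_Mapping.keys m. x i ^ Poly_Mapping.lookup m i))"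

definition forms :: "complex set \<Rightarrow> nat \<Rightarrow> nat \<Rightarrow> mpoly set" where
  "forms k n d =
     {F. \<forall>m\<in>Poly_Mapping.keys F.
           Poly_Mapping.keys m \<subseteq> {..n} \<and>
           (\<Sum>i\<in>Poly_Mapping.keys m. Poly_Mapping.lookup m i) = d \<and>
           Poly_Mapping.lookup F m \<in> k}"

definition dir_deriv :: "(vec \<Rightarrow> complex) \<Rightarrow> vec \<Rightarrow> vec \<Rightarrow> complex" where
  "dir_deriv h x v = deriv (\<lambda>s. h (\<lambda>i. x i + s * v i)) 0"

section \<open>Projective space and its Zariski topology\<close>

text \<open>
  A point of projective \<open>n\<close>-space is the set of all its homogeneous coordinate vectors; these are
  sequences vanishing beyond index \<open>n\<close>.
\<close>

type_synonym point = "vec set"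

definition coords :: "nat \<Rightarrow> vec set" where
  "coords n = {x. \<forall>i>n. x i = 0}"

definition proj_point :: "vec \<Rightarrow> point" where
  "proj_point x = {(\<lambda>i. c * x i) | c. c \<noteq> 0}"

definition proj_space :: "nat \<Rightarrow> point set" where
  "proj_space n = {proj_point x | x. x \<in> coords n \<and> (\<exists>i. x i \<noteq> 0)}"

definition rational_points :: "point set \<Rightarrow> point set" where
  "rational_points X = {P \<in> X. \<exists>x\<in>P. \<forall>i. x i \<in> \<rat>}"

definition vanishes_on :: "mpoly \<Rightarrow> point set \<Rightarrow> bool" where
  "vanishes_on F X \<longleftrightarrow> (\<forall>P\<in>X. \<forall>x\<in>P. mpoly_eval F x = 0)"

definition zariski_closed :: "complex set \<Rightarrow> nat \<Rightarrow> point set \<Rightarrow> bool" where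
  "zariski_closed k n Z \<longleftrightarrow>
     (\<exists>S \<subseteq> (\<Union>d. forms k n d). Z = {P \<in> proj_space n. \<forall>F\<in>S. vanishes_on F {P}})"

definition zariski_closure :: "nat \<Rightarrow> point set \<Rightarrow> point set" where
  "zariski_closure n X = \<Inter>{Z. zariski_closed UNIV n Z \<and> X \<subseteq> Z}"

definition quasi_projective :: "complex set \<Rightarrow> nat \<Rightarrow> point set \<Rightarrow> bool" where
  "quasi_projective k n X \<longleftrightarrow>
     (\<exists>Z W. zariski_closed k n Z \<and> zariski_closed k n W \<and> X = Z - W)"

definition zariski_irreducible :: "nat \<Rightarrow> point set \<Rightarrow> bool" where
  "zariski_irreducible n X \<longleftrightarrow>
     X \<noteq> {} \<and>
     (\<forall>Z W. zariski_closed UNIV n Z \<longrightarrow> zariski_closed UNIV n W \<longrightarrow> X \<subseteq> Z \<union> W \<longrightarrow>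
        X \<subseteq> Z \<or> X \<subseteq> W)"

text \<open>Krull dimension, by strict chains of irreducible relatively closed subsets.\<close>

definition has_chain :: "nat \<Rightarrow> point set \<Rightarrow> nat \<Rightarrow> bool" where
  "has_chain n X d \<longleftrightarrow>
     (\<exists>Y. (\<forall>i\<le>d. zariski_irreducible n (Y i) \<and>
                   (\<exists>Z. zariski_closed UNIV n Z \<and> Y i = X \<inter> Z)) \<and>
          (\<forall>i<d. Y i \<subset> Y (Suc i)))"

definition has_dim :: "nat \<Rightarrow> point set \<Rightarrow> nat \<Rightarrow> bool" where
  "has_dim n X d \<longleftrightarrow> has_chain n X d \<and> \<not> has_chain n X (Suc d)"

definition surface_over :: "complex set \<Rightarrow> nat \<Rightarrow> point set \<Rightarrow> bool" where
  "surface_over k n X \<longleftrightarrow>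
     quasi_projective k n X \<and> zariski_irreducible n X \<and> has_dim n X 2"

definition projective_curve :: "nat \<Rightarrow> point set \<Rightarrow> bool" where
  "projective_curve n C \<longleftrightarrow>
     zariski_closed UNIV n C \<and> zariski_irreducible n C \<and> has_dim n C 1"

section \<open>Dimension of function spaces\<close>

global_interpretation fun_space: vector_space "\<lambda>(c::complex) (w::'b \<Rightarrow> complex) y. c * w y"
  by unfold_locales (auto simp: fun_eq_iff algebra_simps)

text \<open>
  The library's \<open>dim\<close> is \<open>0\<close> on infinite-dimensional spaces, so the dimension is taken in the
  extended naturals.
\<close>

definition edim :: "('b \<Rightarrow> complex) set \<Rightarrow> enat" where
  "edim V = (SUP B\<in>{B. finite B \<and> B \<subseteq> V \<and> fun_space.independent B}. enat (card B))"

section \<open>Tangent spaces, smoothness and genus\<close>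

text \<open>
  The tangent space at \<open>x\<close> of the affine cone over \<open>X\<close>; the tangent space of \<open>X\<close> at the point
  \<open>[x]\<close> is its quotient by the line spanned by \<open>x\<close>, whence the \<open>Suc\<close> in the smoothness condition.
\<close>

definition cone_tangent :: "nat \<Rightarrow> point set \<Rightarrow> vec \<Rightarrow> vec set" where
  "cone_tangent n X x =
     {v \<in> coords n. \<forall>d. \<forall>F\<in>forms UNIV n d.
        vanishes_on F X \<longrightarrow> dir_deriv (mpoly_eval F) x v = 0}"

definition smooth_of_dim :: "nat \<Rightarrow> point set \<Rightarrow> nat \<Rightarrow> bool" where
  "smooth_of_dim n X d \<longleftrightarrow>
     has_dim n X d \<and> (\<forall>P\<in>X. \<forall>x\<in>P. edim (cone_tangent n X x) = enat (Suc d))"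

text \<open>
  A regular differential form on \<open>C\<close> assigns a number to every tangent vector \<open>v\<close> at every point
  \<open>[x]\<close> of \<open>C\<close> (and, by convention, \<open>0\<close> to all other pairs) and is, in a neighbourhood of each point,
  of the form \<open>\<Sum>\<^sub>j g\<^sub>j dh\<^sub>j\<close> with regular functions \<open>g\<^sub>j = A\<^sub>j / B\<^sub>j\<close> and \<open>h\<^sub>j = D\<^sub>j / E\<^sub>j\<close>, quotients of
  forms of equal degree. The neighbourhood is the locus where no denominator vanishes.
\<close>

definition regular_differentials :: "nat \<Rightarrow> point set \<Rightarrow> (vec \<times> vec \<Rightarrow> complex) set" where
  "regular_differentials n C =
     {\<omega>. (\<forall>x v. \<not> (x \<in> \<Union>C \<and> v \<in> cone_tangent n C x) \<longrightarrow> \<omega> (x, v) = 0) \<and>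
         (\<forall>P\<in>C. \<exists>(r::nat) a b A B D E.
            (\<forall>j<r. A j \<in> forms UNIV n (a j) \<and> B j \<in> forms UNIV n (a j) \<and>
                   D j \<in> forms UNIV n (b j) \<and> E j \<in> forms UNIV n (b j)) \<and>
            (\<forall>j<r. \<forall>x\<in>P. mpoly_eval (B j) x \<noteq> 0 \<and> mpoly_eval (E j) x \<noteq> 0) \<and>
            (\<forall>x\<in>\<Union>C. (\<forall>j<r. mpoly_eval (B j) x \<noteq> 0 \<and> mpoly_eval (E j) x \<noteq> 0) \<longrightarrow>
               (\<forall>v\<in>cone_tangent n C x.
                  \<omega> (x, v) =
                    (\<Sum>j<r. mpoly_eval (A j) x / mpoly_eval (B j) x *
                       dir_deriv (\<lambda>y. mpoly_eval (D j) y / mpoly_eval (E j) y) x v))))}"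

text \<open>For a smooth projective curve \<open>C\<close>, this is its geometric genus \<open>dim H\<^sup>0(C, \<Omega>\<^sup>1)\<close>.\<close>

definition genus :: "nat \<Rightarrow> point set \<Rightarrow> enat" where
  "genus n C = edim (regular_differentials n C)"

section \<open>Morphisms to projective space and pencils\<close>

definition image_coords :: "nat \<Rightarrow> (nat \<Rightarrow> mpoly) \<Rightarrow> vec \<Rightarrow> vec" where
  "image_coords m A x = (\<lambda>j. if j \<le> m then mpoly_eval (A j) x else 0)"

text \<open>
  \<open>A\<^sub>0, \<dots>, A\<^sub>m\<close> are forms of the same degree over \<open>k\<close>, without common zero at \<open>x\<close>, that describe \<open>f\<close>
  wherever on \<open>X\<close> they have no common zero.
\<close>

definition local_rep ::
  "complex set \<Rightarrow> nat \<Rightarrow> point set \<Rightarrow> nat \<Rightarrow> (point \<Rightarrow> point) \<Rightarrow> vec \<Rightarrow> (nat \<Rightarrow> mpoly) \<Rightarrow> bool" where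
  "local_rep k n X m f x A \<longleftrightarrow>
     (\<exists>d. \<forall>j\<le>m. A j \<in> forms k n d) \<and>
     (\<exists>j\<le>m. mpoly_eval (A j) x \<noteq> 0) \<and>
     (\<forall>Q\<in>X. \<forall>y\<in>Q. (\<exists>j\<le>m. mpoly_eval (A j) y \<noteq> 0) \<longrightarrow> f Q = proj_point (image_coords m A y))"

definition morphism_over ::
  "complex set \<Rightarrow> nat \<Rightarrow> point set \<Rightarrow> nat \<Rightarrow> (point \<Rightarrow> point) \<Rightarrow> bool" where
  "morphism_over k n X m f \<longleftrightarrow> (\<forall>P\<in>X. \<forall>x\<in>P. \<exists>A. local_rep k n X m f x A)"

definition pencil_over :: "complex set \<Rightarrow> nat \<Rightarrow> point set \<Rightarrow> (point \<Rightarrow> point) \<Rightarrow> bool" where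
  "pencil_over k n X f \<longleftrightarrow> morphism_over k n X 1 f \<and> (\<exists>P\<in>X. \<exists>Q\<in>X. f P \<noteq> f Q)"

definition fibre :: "point set \<Rightarrow> (point \<Rightarrow> point) \<Rightarrow> point \<Rightarrow> point set" where
  "fibre X f t = {P \<in> X. f P = t}"

text \<open>
  Tangent space at \<open>x\<close> of (the cone over) the scheme-theoretic fibre through \<open>[x]\<close>, which is cut out
  near \<open>[x]\<close> by the equations of \<open>X\<close> and the form \<open>A\<^sub>1(x) A\<^sub>0 - A\<^sub>0(x) A\<^sub>1\<close>.
\<close>

definition fibre_cone_tangent :: "nat \<Rightarrow> point set \<Rightarrow> (point \<Rightarrow> point) \<Rightarrow> vec \<Rightarrow> vec set" where
  "fibre_cone_tangent n X f x =
     {v \<in> cone_tangent n X x. \<forall>A. local_rep UNIV n X 1 f x A \<longrightarrow>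
        mpoly_eval (A 1) x * dir_deriv (mpoly_eval (A 0)) x v =
        mpoly_eval (A 0) x * dir_deriv (mpoly_eval (A 1)) x v}"

text \<open>
  A fibre that is a smooth projective (irreducible) curve as a scheme. The last clause excludes
  multiple fibres: the underlying variety of such a fibre may be smooth although the fibre is not.
\<close>

definition smooth_curve_fibre :: "nat \<Rightarrow> point set \<Rightarrow> (point \<Rightarrow> point) \<Rightarrow> point \<Rightarrow> bool" where
  "smooth_curve_fibre n X f t \<longleftrightarrow>
     projective_curve n (fibre X f t) \<and>
     smooth_of_dim n (fibre X f t) 1 \<and>
     (\<forall>P\<in>fibre X f t. \<forall>x\<in>P. fibre_cone_tangent n X f x = cone_tangent n (fibre X f t) x)"

end

(*
  Let f(x,z) = (x^2 + z^2)(x^3 + x z^2 - z^3). The plane quintics C_t: t y^4 z = f(x,z), t /= 0, are smooth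
  of genus 6 and meet z = 0 only in (0:1:0). All C_t with t = c^4 are isomorphic to C_1 over Q, and C_1
  has no other rational point: writing x/z = p/q in lowest terms, y^4 = f forces q = c^4 and
  p^2 + q^2 = m^4, because the two factors of f are coprime; by Fermat's descent for X^4 - Y^4 = Z^2
  this gives p = 0, where f is negative. On the other hand t is determined by (x,y,z), so the surface
  swept out by the C_t is rational and its rational points are dense. It is realised in P^3, with
  C_t in the plane w = t(y + z).

  The dimension of an irreducible variety is bounded by the growth of its Hilbert function: a chain
  of length D yields D + 1 algebraically independent forms. A form vanishing on C_t is a multiple of
  the equation, by division in y; this determines the tangent spaces. C_t is irreducible because
  the fourfold cover given by x is totally ramified over x = i: a form vanishing on one branch there vanishes
  on all four. Only two of the six regular differentials are needed.
*)

theory Submission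
  imports Defs "HOL-Complex_Analysis.Conformal_Mappings" "HOL-Computational_Algebra.Nth_Powers"
begin

section \<open>Forms\<close>

text \<open>Degree 5 is prime to the exponent 4: with x = p/q and y = r/s in lowest terms, clearing
  denominators gives s^4 = q^5, which is why q is a fourth power c^4 and q^2 = (c^2)^4 fits the
  descent. The cubic factor is x (x^2 + z^2) - z^3, so it is coprime to the quadratic one; neither
  factor has a rational root, so y = 0 yields no rational point either. All roots of f being simple,
  each C_t is smooth. The plane quintics share (0:1:0) and the five points with y = 0, f = 0. The
  fourth coordinate w takes them apart, at the price that t is w/(y + z) in one place and f/(y^4 z)
  in another, so the morphism and the tangent spaces of its fibres need both expressions. Dimension
  is a maximal length of chains, so lower bounds are exhibited and only upper bounds need an
  argument. One is enough: the surface, parametrized by two variables, has no chain of length 3. A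
  chain in a curve is extended by the surface, hence the bound for the curves.\<close>

lemma mpoly_eval_superset:
  assumes "finite M" "Poly_Mapping.keys F \<subseteq> M"
  shows "mpoly_eval F x =
    (\<Sum>m\<in>M. Poly_Mapping.lookup F m * (\<Prod>i\<in>Poly_Mapping.keys m. x i ^ Poly_Mapping.lookup m i))"
  unfolding mpoly_eval_def
  by (rule sum.mono_neutral_left) (use assms in \<open>auto simp: in_keys_iff\<close>)

lemma monomial_superset:
  assumes "finite N" "Poly_Mapping.keys m \<subseteq> N"
  shows "(\<Prod>i\<in>Poly_Mapping.keys m. x i ^ Poly_Mapping.lookup m i) =
    (\<Prod>i\<in>N. (x i :: complex) ^ Poly_Mapping.lookup m i)"
  by (rule prod.mono_neutral_left) (use assms in \<open>auto simp: in_keys_iff\<close>)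

lemma degree_superset:
  assumes "finite N" "Poly_Mapping.keys m \<subseteq> N"
  shows "(\<Sum>i\<in>Poly_Mapping.keys m. Poly_Mapping.lookup m i) = (\<Sum>i\<in>N. Poly_Mapping.lookup m i)"
  by (rule sum.mono_neutral_left) (use assms in \<open>auto simp: in_keys_iff\<close>)

lemma mpoly_eval_0 [simp]: "mpoly_eval 0 x = 0"
  by (simp add: mpoly_eval_def)

lemma mpoly_eval_single:
  "mpoly_eval (Poly_Mapping.single m a) x =
    a * (\<Prod>i\<in>Poly_Mapping.keys m. x i ^ Poly_Mapping.lookup m i)"
  by (subst mpoly_eval_superset[of "{m}"]) auto

lemma mpoly_eval_add [simp]: "mpoly_eval (F + G) x = mpoly_eval F x + mpoly_eval G x"
proof -
  let ?M = "Poly_Mapping.keys F \<union> Poly_Mapping.keys G"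
  have "Poly_Mapping.keys (F + G) \<subseteq> ?M" by (rule keys_add)
  then show ?thesis
    by (subst (1 2 3) mpoly_eval_superset[of ?M])
      (auto simp: lookup_add algebra_simps sum.distrib)
qed

lemma mpoly_eval_sum [simp]: "mpoly_eval (\<Sum>i\<in>I. F i) x = (\<Sum>i\<in>I. mpoly_eval (F i) x)"
  by (induction I rule: infinite_finite_induct) auto

lemma poly_mapping_eq_sum_single:
  "F = (\<Sum>m\<in>Poly_Mapping.keys F. Poly_Mapping.single m (Poly_Mapping.lookup F m))"
proof (rule poly_mapping_eqI)
  fix k
  have "Poly_Mapping.lookup (\<Sum>m\<in>Poly_Mapping.keys F. Poly_Mapping.single m (Poly_Mapping.lookup F m)) k
     = (\<Sum>m\<in>Poly_Mapping.keys F. if m = k then Poly_Mapping.lookup F m else 0)"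
    by (simp add: lookup_sum lookup_single when_def)
  also have "\<dots> = Poly_Mapping.lookup F k"
    by (simp add: in_keys_iff)
  finally show "Poly_Mapping.lookup F k = Poly_Mapping.lookup (\<Sum>m\<in>Poly_Mapping.keys F. Poly_Mapping.single m (Poly_Mapping.lookup F m)) k"
    by simp
qed

lemma monomial_add:
  "(\<Prod>i\<in>Poly_Mapping.keys (m + m'). (x i :: complex) ^ Poly_Mapping.lookup (m + m') i) =
    (\<Prod>i\<in>Poly_Mapping.keys m. x i ^ Poly_Mapping.lookup m i) *
    (\<Prod>i\<in>Poly_Mapping.keys m'. x i ^ Poly_Mapping.lookup m' i)"
proof -
  let ?N = "Poly_Mapping.keys m \<union> Poly_Mapping.keys m'"
  have "Poly_Mapping.keys (m + m') \<subseteq> ?N" by (rule keys_add)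
  then show ?thesis
    by (subst (1 2 3) monomial_superset[of ?N])
      (auto simp: lookup_add power_add prod.distrib)
qed

lemma mpoly_eval_mult [simp]: "mpoly_eval (F * G) x = mpoly_eval F x * mpoly_eval G x"
proof -
  have single: "mpoly_eval (Poly_Mapping.single m a * Poly_Mapping.single m' b) x =
      mpoly_eval (Poly_Mapping.single m a) x * mpoly_eval (Poly_Mapping.single m' b) x" for m a m' b
    by (simp add: mult_single mpoly_eval_single monomial_add)
  have left: "mpoly_eval (Poly_Mapping.single m a * G) x =
      mpoly_eval (Poly_Mapping.single m a) x * mpoly_eval G x" for m a
  proof -
    let ?S = "\<Sum>m'\<in>Poly_Mapping.keys G. Poly_Mapping.single m' (Poly_Mapping.lookup G m')"
    have "mpoly_eval (Poly_Mapping.single m a * ?S) x = mpoly_eval (Poly_Mapping.single m a) x * mpoly_eval ?S x"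
      by (simp only: sum_distrib_left mpoly_eval_sum single)
    then show ?thesis by (simp only: poly_mapping_eq_sum_single[symmetric])
  qed
  let ?S = "\<Sum>m\<in>Poly_Mapping.keys F. Poly_Mapping.single m (Poly_Mapping.lookup F m)"
  have "mpoly_eval (?S * G) x = mpoly_eval ?S x * mpoly_eval G x"
    by (simp only: sum_distrib_right mpoly_eval_sum left)
  then show ?thesis by (simp only: poly_mapping_eq_sum_single[symmetric])
qed

definition mvar :: "nat \<Rightarrow> mpoly" where
  "mvar i = Poly_Mapping.single (Poly_Mapping.single i 1) 1"

definition mconst :: "complex \<Rightarrow> mpoly" where
  "mconst c = Poly_Mapping.single 0 c"

lemma mpoly_eval_mvar [simp]: "mpoly_eval (mvar i) x = x i"
  by (simp add: mvar_def mpoly_eval_single)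

lemma mpoly_eval_mconst [simp]: "mpoly_eval (mconst c) x = c"
  by (simp add: mconst_def mpoly_eval_single)

lemma mpoly_eval_1 [simp]: "mpoly_eval 1 x = 1"
  using mpoly_eval_mconst[of 1 x] by (simp add: mconst_def flip: single_one)

lemma mpoly_eval_power [simp]: "mpoly_eval (F ^ k) x = mpoly_eval F x ^ k"
  by (induction k) auto

lemma mconst_forms [intro]: "c \<in> k \<Longrightarrow> mconst c \<in> forms k n 0"
  by (auto simp: forms_def mconst_def split: if_splits)

lemma mvar_forms [intro]: "1 \<in> k \<Longrightarrow> i \<le> n \<Longrightarrow> mvar i \<in> forms k n 1"
  by (auto simp: forms_def mvar_def)

lemma one_forms [intro]: "1 \<in> k \<Longrightarrow> 1 \<in> forms k n 0"
  using mconst_forms[of 1 k n] by (simp add: mconst_def)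

lemma zero_forms [intro]: "0 \<in> forms k n d"
  by (simp add: forms_def)

text \<open>Two coefficient sets occur: the rationals, over which surface and pencil must be
  defined, and all complex numbers, which give the Zariski topology. Closure under the ring
  operations lets each form be constructed once for both.\<close>

definition subring_set :: "complex set \<Rightarrow> bool" where
  "subring_set k \<longleftrightarrow> 0 \<in> k \<and> 1 \<in> k \<and> (\<forall>a\<in>k. -a \<in> k) \<and> (\<forall>a\<in>k. \<forall>b\<in>k. a + b \<in> k \<and> a * b \<in> k)"

lemma subring_set_UNIV [simp, intro]: "subring_set UNIV"
  and subring_set_Rats [simp, intro]: "subring_set \<rat>"
  by (auto simp: subring_set_def)

lemma add_forms:
  assumes "F \<in> forms k n d" "G \<in> forms k n d" "subring_set k"
  shows "F + G \<in> forms k n d"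
  unfolding forms_def
proof (intro CollectI ballI)
  fix m assume m: "m \<in> Poly_Mapping.keys (F + G)"
  then have "m \<in> Poly_Mapping.keys F \<union> Poly_Mapping.keys G"
    using keys_add[of F G] by blast
  moreover have "Poly_Mapping.lookup F m \<in> k" "Poly_Mapping.lookup G m \<in> k"
    using assms by (cases "m \<in> Poly_Mapping.keys F"; cases "m \<in> Poly_Mapping.keys G";
      force simp: forms_def subring_set_def in_keys_iff)+
  ultimately show "Poly_Mapping.keys m \<subseteq> {..n} \<and>
      (\<Sum>i\<in>Poly_Mapping.keys m. Poly_Mapping.lookup m i) = d \<and> Poly_Mapping.lookup (F + G) m \<in> k"
    using assms by (auto simp: forms_def subring_set_def lookup_add)
qed

lemma sum_forms:
  assumes "\<And>i. i \<in> I \<Longrightarrow> F i \<in> forms k n d" "subring_set k"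
  shows "(\<Sum>i\<in>I. F i) \<in> forms k n d"
  using assms by (induction I rule: infinite_finite_induct) (auto intro: add_forms)

lemma single_forms_mult:
  assumes "Poly_Mapping.keys m \<subseteq> {..n}" "(\<Sum>i\<in>Poly_Mapping.keys m. Poly_Mapping.lookup m i) = d" "a \<in> k"
    and "Poly_Mapping.keys m' \<subseteq> {..n}" "(\<Sum>i\<in>Poly_Mapping.keys m'. Poly_Mapping.lookup m' i) = e" "b \<in> k"
    and "subring_set k"
  shows "Poly_Mapping.single m a * Poly_Mapping.single m' b \<in> forms k n (d + e)"
proof -
  have sub: "Poly_Mapping.keys (m + m') \<subseteq> {..n}"
    using keys_add[of m m'] assms by blast
  have "(\<Sum>i\<in>Poly_Mapping.keys (m + m'). Poly_Mapping.lookup (m + m') i) = d + e"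
    using assms(2,5) unfolding degree_superset[OF finite_atMost sub]
      degree_superset[OF finite_atMost assms(1)] degree_superset[OF finite_atMost assms(4)]
    by (simp add: lookup_add sum.distrib)
  then show ?thesis
    using sub assms by (auto simp: mult_single forms_def subring_set_def)
qed

lemma mult_forms:
  assumes F: "F \<in> forms k n d" and G: "G \<in> forms k n e" and k: "subring_set k"
  shows "F * G \<in> forms k n (d + e)"
proof -
  have "F * G = (\<Sum>m\<in>Poly_Mapping.keys F. \<Sum>m'\<in>Poly_Mapping.keys G.
      Poly_Mapping.single m (Poly_Mapping.lookup F m) * Poly_Mapping.single m' (Poly_Mapping.lookup G m'))"
    by (simp only: sum_product[symmetric] poly_mapping_eq_sum_single[symmetric])
  also have "\<dots> \<in> forms k n (d + e)"
    by (intro sum_forms single_forms_mult k) (use F G in \<open>auto simp: forms_def\<close>)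
  finally show ?thesis .
qed

lemma power_forms:
  assumes "F \<in> forms k n d" "subring_set k"
  shows "F ^ j \<in> forms k n (d * j)"
proof (induction j)
  case 0
  then show ?case using assms by (auto simp: subring_set_def)
next
  case (Suc j)
  then show ?case using mult_forms[OF assms(1) Suc assms(2)] by simp
qed

lemma forms_homogeneous:
  assumes "F \<in> forms k n d"
  shows "mpoly_eval F (\<lambda>i. c * x i) = c ^ d * mpoly_eval F x"
proof -
  have "(\<Prod>i\<in>Poly_Mapping.keys m. (c * x i) ^ Poly_Mapping.lookup m i) =
      c ^ d * (\<Prod>i\<in>Poly_Mapping.keys m. x i ^ Poly_Mapping.lookup m i)"
    if "m \<in> Poly_Mapping.keys F" for m
    using that assms
    by (auto simp: forms_def power_mult_distrib prod.distrib simp flip: power_sum)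
  then show ?thesis
    by (auto simp: mpoly_eval_def sum_distrib_left intro!: sum.cong)
qed

section \<open>Projective points\<close>

lemma proj_point_self [simp]: "x \<in> proj_point x"
  by (auto simp: proj_point_def intro!: exI[of _ 1])

lemma proj_point_scale: "c \<noteq> 0 \<Longrightarrow> proj_point (\<lambda>i. c * x i) = proj_point x"
proof -
  assume c: "c \<noteq> 0"
  have "\<exists>d. (\<lambda>i. e * (c * x i)) = (\<lambda>i. d * x i) \<and> d \<noteq> 0" if "e \<noteq> 0" for e
    using that c by (intro exI[of _ "e * c"]) auto
  moreover have "\<exists>d. (\<lambda>i. e * x i) = (\<lambda>i. d * (c * x i)) \<and> d \<noteq> 0" if "e \<noteq> 0" for e
    using that c by (intro exI[of _ "e / c"]) auto
  ultimately show ?thesis by (auto simp: proj_point_def)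
qed

lemma proj_pointE:
  assumes "y \<in> proj_point x"
  obtains c where "c \<noteq> 0" "y = (\<lambda>i. c * x i)"
  using assms by (auto simp: proj_point_def)

lemma proj_spaceE:
  assumes "P \<in> proj_space n"
  obtains x where "x \<in> coords n" "\<exists>i. x i \<noteq> 0" "P = proj_point x"
  using assms by (auto simp: proj_space_def)

lemma proj_space_rep:
  assumes "P \<in> proj_space n" "x \<in> P"
  shows "P = proj_point x" "x \<in> coords n" "\<exists>i. x i \<noteq> 0"
proof -
  obtain y where y: "y \<in> coords n" "\<exists>i. y i \<noteq> 0" "P = proj_point y"
    using assms(1) by (elim proj_spaceE)
  then obtain c where c: "c \<noteq> 0" "x = (\<lambda>i. c * y i)"
    using assms(2) by (auto elim: proj_pointE)
  show "P = proj_point x" using y c by (simp add: proj_point_scale)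
  show "x \<in> coords n" "\<exists>i. x i \<noteq> 0" using y c by (auto simp: coords_def)
qed

lemma vanishes_on_proj_point:
  assumes "F \<in> forms k n d"
  shows "vanishes_on F {proj_point x} \<longleftrightarrow> mpoly_eval F x = 0"
proof
  assume "vanishes_on F {proj_point x}"
  then show "mpoly_eval F x = 0" by (auto simp: vanishes_on_def)
next
  assume "mpoly_eval F x = 0"
  then show "vanishes_on F {proj_point x}"
    by (auto simp: vanishes_on_def forms_homogeneous[OF assms] elim!: proj_pointE)
qed

lemma vanishes_on_pointwise: "vanishes_on F X \<longleftrightarrow> (\<forall>P\<in>X. vanishes_on F {P})"
  by (auto simp: vanishes_on_def)

lemma vanishes_on_rep:
  assumes "F \<in> forms k n d" "P \<in> proj_space m" "x \<in> P"
  shows "vanishes_on F {P} \<longleftrightarrow> mpoly_eval F x = 0"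
  using assms vanishes_on_proj_point[OF assms(1), of x] proj_space_rep(1)[OF assms(2,3)] by simp

lemma zariski_closed_Int:
  assumes "zariski_closed k n Z" "zariski_closed k n W"
  shows "zariski_closed k n (Z \<inter> W)"
proof -
  obtain S T where "S \<subseteq> (\<Union>d. forms k n d)" "Z = {P \<in> proj_space n. \<forall>F\<in>S. vanishes_on F {P}}"
    "T \<subseteq> (\<Union>d. forms k n d)" "W = {P \<in> proj_space n. \<forall>F\<in>T. vanishes_on F {P}}"
    using assms by (auto simp: zariski_closed_def)
  then show ?thesis
    unfolding zariski_closed_def by (intro exI[of _ "S \<union> T"]) auto
qed

lemma zariski_closed_forms:
  assumes "S \<subseteq> (\<Union>d. forms k n d)"
  shows "zariski_closed k n {P \<in> proj_space n. \<forall>F\<in>S. vanishes_on F {P}}"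
  using assms by (auto simp: zariski_closed_def)

lemma zariski_closed_vanishing:
  assumes "F \<in> forms k n d"
  shows "zariski_closed k n {P \<in> proj_space n. vanishes_on F {P}}"
  using zariski_closed_forms[of "{F}"] assms by auto

lemma zariski_irreducible_mult:
  assumes irr: "zariski_irreducible n X" and X: "X \<subseteq> proj_space n"
    and F: "F \<in> forms UNIV n d" and G: "G \<in> forms UNIV n e"
    and FG: "vanishes_on (F * G) X"
  shows "vanishes_on F X \<or> vanishes_on G X"
proof -
  let ?Z = "\<lambda>F. {P \<in> proj_space n. vanishes_on F {P}}"
  have "X \<subseteq> ?Z F \<union> ?Z G"
  proof
    fix P assume P: "P \<in> X"
    then obtain x where "x \<in> P" using X by (metis proj_spaceE proj_point_self subsetD)
    moreover have "mpoly_eval F x * mpoly_eval G x = 0"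
      using FG P \<open>x \<in> P\<close> by (auto simp: vanishes_on_def)
    ultimately show "P \<in> ?Z F \<union> ?Z G"
      using P X vanishes_on_rep[OF F, of P n x] vanishes_on_rep[OF G, of P n x] by auto
  qed
  then have "X \<subseteq> ?Z F \<or> X \<subseteq> ?Z G"
    using irr zariski_closed_vanishing[OF F] zariski_closed_vanishing[OF G]
    by (auto simp: zariski_irreducible_def)
  then show ?thesis by (auto simp: vanishes_on_def)
qed

text \<open>Primality of the homogeneous vanishing ideal is enough: if \<open>P\<close> escapes
  \<open>Z\<close> and \<open>Q\<close> escapes \<open>W\<close>, a single defining form of each
  detects this, and the product of the two vanishes on \<open>Z \<union> W\<close>.\<close>

lemma zariski_irreducibleI:
  assumes "X \<noteq> {}" "X \<subseteq> proj_space n"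
    and mult: "\<And>F G d e. F \<in> forms UNIV n d \<Longrightarrow> G \<in> forms UNIV n e \<Longrightarrow> vanishes_on (F * G) X \<Longrightarrow>
      vanishes_on F X \<or> vanishes_on G X"
  shows "zariski_irreducible n X"
  unfolding zariski_irreducible_def
proof (intro conjI allI impI assms(1), rule ccontr)
  fix Z W assume Z: "zariski_closed UNIV n Z" and W: "zariski_closed UNIV n W"
    and XZW: "X \<subseteq> Z \<union> W" and "\<not> (X \<subseteq> Z \<or> X \<subseteq> W)"
  then obtain P Q where P: "P \<in> X" "P \<notin> Z" and Q: "Q \<in> X" "Q \<notin> W" by auto
  obtain S where S: "S \<subseteq> (\<Union>d. forms UNIV n d)" "Z = {P \<in> proj_space n. \<forall>F\<in>S. vanishes_on F {P}}"
    using Z by (auto simp: zariski_closed_def)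
  obtain T where T: "T \<subseteq> (\<Union>d. forms UNIV n d)" "W = {P \<in> proj_space n. \<forall>F\<in>T. vanishes_on F {P}}"
    using W by (auto simp: zariski_closed_def)
  obtain F d where F: "F \<in> S" "F \<in> forms UNIV n d" "\<not> vanishes_on F {P}"
    using S P assms(2) by blast
  obtain G e where G: "G \<in> T" "G \<in> forms UNIV n e" "\<not> vanishes_on G {Q}"
    using T Q assms(2) by blast
  have "vanishes_on (F * G) X"
    using XZW S(2) T(2) F(1) G(1) by (fastforce simp: vanishes_on_def)
  then show False
    using mult[OF F(2) G(2)] F(3) G(3) P(1) Q(1) by (auto simp: vanishes_on_def)
qed

lemma zariski_irreducible_singleton:
  assumes "P \<in> proj_space n"
  shows "zariski_irreducible n {P}"
proof (rule zariski_irreducibleI)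
  fix F G d e
  assume F: "F \<in> forms UNIV n d" and G: "G \<in> forms UNIV n e" and FG: "vanishes_on (F * G) {P}"
  obtain x where x: "x \<in> P" using assms by (metis proj_spaceE proj_point_self)
  then have "mpoly_eval F x * mpoly_eval G x = 0" using FG by (auto simp: vanishes_on_def)
  then show "vanishes_on F {P} \<or> vanishes_on G {P}"
    using vanishes_on_rep[OF F assms x] vanishes_on_rep[OF G assms x] by auto
qed (use assms in auto)

section \<open>The arithmetic of the exceptional fibres\<close>

lemma coprimeI_prime:
  fixes a b :: "'a :: factorial_semiring"
  assumes "\<And>p. prime p \<Longrightarrow> p dvd a \<Longrightarrow> p dvd b \<Longrightarrow> False" "a \<noteq> 0 \<or> b \<noteq> 0"
  shows "coprime a b"
proof (rule coprimeI)
  fix c assume c: "c dvd a" "c dvd b"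
  show "is_unit c"
  proof (rule ccontr)
    assume "\<not> is_unit c"
    moreover have "c \<noteq> 0" using c assms(2) by auto
    ultimately obtain p where "p dvd c" "prime p" using prime_divisor_exists by blast
    then show False using assms(1) c dvd_trans by blast
  qed
qed

lemma nat_coprime_mult_square:
  fixes a b c :: nat
  assumes "coprime a b" "a * b = c ^ 2" "a > 0" "b > 0"
  obtains r s where "a = r ^ 2" "b = s ^ 2"
proof -
  have "is_nth_power 2 (a * b)" using assms by (auto simp: is_nth_power_def)
  then have "is_nth_power 2 a" "is_nth_power 2 b"
    using is_nth_power_mult_coprime_natD[of a b 2] assms by auto
  then show ?thesis using that by (auto simp: is_nth_power_def)
qed

text \<open>In \<open>((c + b) div 2) * ((c - b) div 2) = (a div 2)^2\<close> the two factors on the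
  left are coprime, hence squares \<open>u^2\<close> and \<open>v^2\<close>. The subtraction in the
  conclusion is not truncated, because \<open>v < u\<close>.\<close>

lemma pythagorean_triple:
  fixes a b c :: nat
  assumes "a ^ 2 + b ^ 2 = c ^ 2" "coprime a b" "even a" "a > 0" "b > 0"
  obtains u v where "a = 2 * u * v" "b = u ^ 2 - v ^ 2" "c = u ^ 2 + v ^ 2" "v < u" "coprime u v" "u > 0" "v > 0"
proof -
  have "odd b" using assms(2,3) by (meson coprime_common_divisor even_plus_one_iff odd_one dvd_refl)
  then have "odd (c ^ 2)" using assms(1,3) by (metis even_add even_power zero_less_numeral)
  then have "odd c" by simp
  have "b ^ 2 < c ^ 2" using assms(1,4) by (metis less_add_same_cancel2 zero_less_power)
  then have "b < c" by (simp add: power_less_imp_less_base)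
  define m where "m = (c + b) div 2"
  define n where "n = (c - b) div 2"
  have mc: "c + b = 2 * m" "c - b = 2 * n"
    using \<open>odd b\<close> \<open>odd c\<close> by (auto simp: m_def n_def)
  have cb: "c = m + n" "b = m - n" "n < m" using mc \<open>b < c\<close> assms(5) by auto
  have npos: "n > 0" using mc \<open>b < c\<close> by auto
  obtain k where k: "a = 2 * k" using assms(3) by auto
  have "4 * k ^ 2 + (m - n) ^ 2 = (m + n) ^ 2" using assms(1) k cb by (simp add: power_mult_distrib)
  moreover have "(m + n) ^ 2 = 4 * (m * n) + (m - n) ^ 2"
  proof -
    obtain j where "m = n + j" using cb(3) less_imp_add_positive by blast
    then show ?thesis by (simp add: power2_eq_square algebra_simps)
  qed
  ultimately have mn: "m * n = k ^ 2" by simp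
  have cop: "coprime m n"
  proof (rule coprimeI_prime)
    fix p :: nat assume p: "prime p" "p dvd m" "p dvd n"
    then have "p dvd b" by (simp add: cb(2) dvd_diff_nat)
    moreover have "p dvd k ^ 2" using p mn by (metis dvd_mult2)
    then have "p dvd a" using p(1) k by (metis dvd_mult prime_dvd_power)
    ultimately show False using assms(2) p(1) by (metis coprime_common_divisor not_prime_unit)
  qed (use cb in auto)
  obtain u v where uv: "m = u ^ 2" "n = v ^ 2"
    using nat_coprime_mult_square[OF cop mn] npos cb(3) by auto
  have "k ^ 2 = (u * v) ^ 2" using mn uv by (simp add: power_mult_distrib)
  then have "k = u * v" by (simp add: power2_eq_iff_nonneg)
  moreover have "v < u" using cb(3) uv by (simp add: power_less_imp_less_base)
  moreover have "coprime u v" using cop uv by simp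
  moreover have "v > 0" using npos uv(2) by (auto intro!: Nat.gr0I)
  ultimately show ?thesis using that[of u v] k cb uv by auto
qed

text \<open>Infinite descent on \<open>x\<close>. The triple \<open>(y^2, z, x^2)\<close> is
  primitive. If \<open>y\<close> is odd, its parametrization gives
  \<open>a^4 - b^4 = (x y)^2\<close> with \<open>a < x\<close> at once; if \<open>y\<close> is even,
  the parameters themselves form a triple \<open>(a, b, x)\<close>, and a second parametrization
  produces the smaller solution \<open>r^4 - s^4 = v^2\<close>.\<close>

lemma diff_fourth_powers_not_square_coprime:
  fixes x y z :: nat
  assumes "x ^ 4 = y ^ 4 + z ^ 2" "coprime x y" "y > 0" "z > 0"
  shows False
  using assms
proof (induction x arbitrary: y z rule: less_induct)
  case (less x)
  have eq: "(y ^ 2) ^ 2 + z ^ 2 = (x ^ 2) ^ 2" using less.prems(1) by (simp flip: power_mult)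
  have xpos: "x > 0" using less.prems(1,3) by (intro Nat.gr0I) simp
  have cop: "coprime (y ^ 2) z"
  proof (rule coprimeI_prime)
    fix p :: nat assume p: "prime p" "p dvd y ^ 2" "p dvd z"
    then have "p dvd (y ^ 2) * y ^ 2 + z * z" by (intro dvd_add dvd_mult)
    then have "p dvd (x ^ 2) ^ 2" using eq by (simp add: power2_eq_square)
    then have "p dvd x" using p(1) by (meson prime_dvd_power)
    moreover have "p dvd y" using p by (meson prime_dvd_power)
    ultimately show False using less.prems(2) p(1) by (metis coprime_common_divisor not_prime_unit)
  qed (use less.prems(4) in simp)
  show False
  proof (cases "even y")
    case True
    obtain a b where ab: "y ^ 2 = 2 * a * b" "z = a ^ 2 - b ^ 2" "x ^ 2 = a ^ 2 + b ^ 2" "b < a"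
      "coprime a b" "a > 0" "b > 0"
    proof (rule pythagorean_triple[OF eq cop])
      show "even (y ^ 2)" "y ^ 2 > 0" "z > 0" using True less.prems(3,4) by simp_all
    qed
    text \<open>Only one of \<open>a\<close>, \<open>b\<close> is even; the argument is symmetric in them.\<close>
    have descent: False
      if H: "y ^ 2 = 2 * a * b" "x ^ 2 = a ^ 2 + b ^ 2" "coprime a b" "a > 0" "b > 0" "even a" for a b :: nat
    proof -
      obtain a' where a': "a = 2 * a'" using H(6) by auto
      obtain y' where y': "y = 2 * y'" using True by auto
      have "a' * b = y' ^ 2" using H(1) a' y' by (simp add: power2_eq_square)
      moreover have "coprime a' b" using H(3) a' by simp
      ultimately obtain u v where uv: "a' = u ^ 2" "b = v ^ 2"
        using nat_coprime_mult_square[of a' b y'] H a' by auto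
      obtain c d where cd: "a = 2 * c * d" "b = c ^ 2 - d ^ 2" "x = c ^ 2 + d ^ 2" "d < c" "coprime c d"
        "c > 0" "d > 0"
      proof (rule pythagorean_triple[of a b x])
        show "a ^ 2 + b ^ 2 = x ^ 2" using H(2) by simp
      qed (use H in auto)
      \<comment> \<open>Both \<open>a = 2 * c * d\<close> and \<open>a = 2 * u^2\<close> hold, so
        the new parameters are squares as well.\<close>
      have "c * d = u ^ 2" using cd(1) a' uv by simp
      then obtain r s where rs: "c = r ^ 2" "d = s ^ 2"
        using nat_coprime_mult_square[of c d u] cd by auto
      have "r ^ 4 = s ^ 4 + v ^ 2"
      proof -
        have "v ^ 2 = c ^ 2 - d ^ 2" using cd uv by simp
        moreover have "d ^ 2 \<le> c ^ 2" using cd(4) by (intro power_mono) auto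
        ultimately show ?thesis using rs by (simp flip: power_mult)
      qed
      moreover have "coprime r s" using cd(5) rs by simp
      moreover have "s > 0" "v > 0" using rs(2) cd(7) uv(2) H(5) by (auto intro!: Nat.gr0I)
      moreover have "r < x"
      proof -
        have "r \<le> c" using rs by (simp add: power2_eq_square)
        also have "c \<le> c ^ 2" using cd by (simp add: power2_eq_square)
        also have "\<dots> < x" using cd by simp
        finally show ?thesis .
      qed
      ultimately show False using less.IH by blast
    qed
    have "even (y ^ 2)" "2 * 2 dvd y ^ 2" using True mult_dvd_mono[of 2 y 2 y] by (simp_all add: power2_eq_square)
    then have "2 * 2 dvd 2 * (a * b)" using ab(1) by (simp add: mult.assoc)
    then have "even (a * b)" by (metis dvd_times_left_cancel_iff zero_neq_numeral)
    then have "even a \<or> even b" by simp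
    then show False
    proof
      assume "even a"
      then show False using descent[OF ab(1,3,5,6,7)] by simp
    next
      assume "even b"
      moreover have "y ^ 2 = 2 * b * a" "x ^ 2 = b ^ 2 + a ^ 2" "coprime b a"
        using ab by (simp_all add: ac_simps)
      ultimately show False using descent[of b a] ab(6,7) by simp
    qed
  next
    case False
    \<comment> \<open>Otherwise a sum of two odd squares, which is 2 modulo 4, would be a
      square.\<close>
    have "even z"
    proof (rule ccontr)
      assume "odd z"
      have odd_sq: "n ^ 2 mod 4 = 1" if n: "odd n" for n :: nat
      proof -
        obtain j where "n = 2 * j + 1" using n by (elim oddE)
        then have "n ^ 2 = 4 * (j ^ 2 + j) + 1" by (simp add: power2_eq_square algebra_simps)
        then show ?thesis by simp
      qed
      have "((y ^ 2) ^ 2 + z ^ 2) mod 4 = ((y ^ 2) ^ 2 mod 4 + z ^ 2 mod 4) mod 4"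
        by (simp add: mod_simps)
      also have "\<dots> = 2"
        using odd_sq[of "y ^ 2"] odd_sq[of z] False \<open>odd z\<close> by simp
      finally have two: "(x ^ 2) ^ 2 mod 4 = 2" using eq by simp
      have "(x ^ 2) ^ 2 mod 4 \<noteq> 2"
      proof (cases "even x")
        case True
        then obtain j where "x = 2 * j" by (elim evenE)
        then have "(x ^ 2) ^ 2 = 4 * (4 * j ^ 4)" by (simp add: power_mult_distrib flip: power_mult)
        then show ?thesis by (metis mod_mult_self1_is_0 zero_neq_numeral)
      next
        case False
        then show ?thesis using odd_sq[of "x ^ 2"] by simp
      qed
      then show False using two by simp
    qed
    obtain a b where ab: "z = 2 * a * b" "y ^ 2 = a ^ 2 - b ^ 2" "x ^ 2 = a ^ 2 + b ^ 2" "b < a"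
      "coprime a b" "a > 0" "b > 0"
    proof (rule pythagorean_triple[of z "y ^ 2" "x ^ 2"])
      show "z ^ 2 + (y ^ 2) ^ 2 = (x ^ 2) ^ 2" using eq by simp
      show "coprime z (y ^ 2)" using cop by (simp add: coprime_commute)
      show "y ^ 2 > 0" using less.prems by simp
    qed (use \<open>even z\<close> less.prems(4) in blast)+
    have "b ^ 2 \<le> a ^ 2" using ab(4) by (intro power_mono) auto
    then have "a ^ 2 = y ^ 2 + b ^ 2" using ab(2) by simp
    \<comment> \<open>The product of \<open>x^2 = a^2 + b^2\<close> and
      \<open>y^2 = a^2 - b^2\<close>.\<close>
    then have "(x * y) ^ 2 + b ^ 2 * b ^ 2 = a ^ 2 * a ^ 2"
      using ab(3) by (simp add: power_mult_distrib) (simp add: algebra_simps)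
    then have "a ^ 4 = b ^ 4 + (x * y) ^ 2" by (simp add: numeral_eq_Suc)
    moreover have "a ^ 2 < x ^ 2" using ab by simp
    then have "a < x" by (simp add: power_less_imp_less_base)
    ultimately show False
      using less.IH[of a b "x * y"] ab xpos less.prems by auto
  qed
qed

text \<open>Polymorphic, because the integers serve for the factorization, the rationals for the
  equation and the complex numbers for the curves.\<close>

definition quintic :: "'a::comm_ring_1 \<Rightarrow> 'a \<Rightarrow> 'a" where
  "quintic x z = (x ^ 2 + z ^ 2) * (x ^ 3 + x * z ^ 2 - z ^ 3)"

lemma int_fourth_power_factor:
  fixes a b c :: int
  assumes "coprime a b" "a * b = c ^ 4" "a > 0" "b > 0"
  shows "\<exists>m. a = m ^ 4"
proof -
  have "nat a * nat b = nat \<bar>c\<bar> ^ 4"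
    using assms by (simp add: nat_power_eq flip: nat_mult_distrib) (simp add: nat_power_eq[symmetric] power_even_abs_numeral)
  then have "is_nth_power 4 (nat a * nat b)" by (auto simp: is_nth_power_def)
  moreover have "coprime (nat a) (nat b)" using assms by (simp flip: coprime_int_iff)
  ultimately have "is_nth_power 4 (nat a)"
    using is_nth_power_mult_coprime_natD[of "nat a" "nat b" 4] assms by auto
  then obtain m where "nat a = m ^ 4" by (auto simp: is_nth_power_def)
  then have "a = int m ^ 4" using assms by (metis int_nat_eq of_nat_power order_less_imp_le)
  then show ?thesis by blast
qed

text \<open>Modulo \<open>q\<close> the quintic is \<open>p^5\<close>, and modulo the quadratic
  factor the cubic one is \<open>- q^3\<close>; a common prime divisor would therefore divide both
  \<open>p\<close> and \<open>q\<close>.\<close>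

lemma coprime_quintic_int:
  fixes p q :: int
  assumes "coprime p q"
  shows "coprime (quintic p q) q" "coprime (p ^ 2 + q ^ 2) (p ^ 3 + p * q ^ 2 - q ^ 3)"
proof -
  have *: False if r: "prime r" "r dvd p" "r dvd q" for r :: int
    using assms r by (meson coprime_common_divisor not_prime_unit)
  show "coprime (quintic p q) q"
  proof (rule coprimeI_prime)
    fix r :: int assume r: "prime r" "r dvd quintic p q" "r dvd q"
    have "p ^ 5 = quintic p q - q * (2 * p ^ 3 * q - p ^ 2 * q ^ 2 + p * q ^ 3 - q ^ 4)"
      by (simp add: quintic_def algebra_simps eval_nat_numeral)
    then have "r dvd p ^ 5" using r by simp
    then show False using r * prime_dvd_power by blast
  qed (use assms in \<open>auto simp: quintic_def\<close>)
  show "coprime (p ^ 2 + q ^ 2) (p ^ 3 + p * q ^ 2 - q ^ 3)"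
  proof (rule coprimeI_prime)
    fix r :: int assume r: "prime r" "r dvd p ^ 2 + q ^ 2" "r dvd p ^ 3 + p * q ^ 2 - q ^ 3"
    have "q ^ 3 = p * (p ^ 2 + q ^ 2) - (p ^ 3 + p * q ^ 2 - q ^ 3)"
      by (simp add: algebra_simps eval_nat_numeral)
    then have "r dvd q ^ 3" using r by (metis dvd_diff dvd_mult)
    then have rq: "r dvd q" using r prime_dvd_power by blast
    then have "r dvd p ^ 2" using r(2) by (simp add: dvd_add_left_iff power2_eq_square)
    then show False using r rq * prime_dvd_power by blast
  qed (use assms in \<open>auto simp: add_nonneg_eq_0_iff\<close>)
qed

lemma no_rational_solution:
  fixes x y :: rat
  assumes "y ^ 4 = quintic x 1"
  shows False
proof -
  obtain p q where pq: "quotient_of x = (p, q)" by fastforce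
  have q: "q > 0" "coprime p q" "x = of_int p / of_int q"
    using quotient_of_denom_pos[OF pq] quotient_of_coprime[OF pq] quotient_of_div[OF pq] by auto
  obtain r s where rs: "quotient_of y = (r, s)" by fastforce
  have s: "s > 0" "coprime r s" "y = of_int r / of_int s"
    using quotient_of_denom_pos[OF rs] quotient_of_coprime[OF rs] quotient_of_div[OF rs] by auto
  have "quintic x 1 * of_int q ^ 5 = (of_int (quintic p q) :: rat)"
    using q(1) unfolding q(3) by (simp add: quintic_def field_simps) (simp add: eval_nat_numeral algebra_simps)
  then have "y ^ 4 * of_int q ^ 5 = (of_int (quintic p q) :: rat)" using assms by simp
  then have "(of_int (r ^ 4 * q ^ 5) :: rat) = of_int (quintic p q * s ^ 4)"
    using s q by (simp add: field_simps)
  then have eq: "r ^ 4 * q ^ 5 = quintic p q * s ^ 4" by (simp only: of_int_eq_iff)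
  \<comment> \<open>In \<open>eq\<close>, \<open>s\<close> is prime to \<open>r\<close> and
    \<open>q\<close> to the quintic, so the powers of the two denominators divide each
    other.\<close>
  have "s ^ 4 dvd q ^ 5"
    using eq s(2) by (metis coprime_commute coprime_dvd_mult_right_iff coprime_power_left_iff coprime_power_right_iff dvd_triv_right)
  moreover have "q ^ 5 dvd s ^ 4"
    using eq coprime_quintic_int(1)[OF q(2)]
    by (metis coprime_commute coprime_dvd_mult_right_iff coprime_power_left_iff dvd_triv_right)
  ultimately have qs: "q ^ 5 = s ^ 4"
    using q(1) s(1) by (simp add: zdvd_antisym_nonneg)
  then have N: "quintic p q = r ^ 4" using eq q(1) by auto
  \<comment> \<open>From \<open>q^5 = s^4\<close>: since \<open>q^4\<close> divides
    \<open>s^4\<close>, the quotient \<open>c = s / q\<close> is an integer, and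
    \<open>q = c^4\<close> remains after cancelling.\<close>
  have "q dvd s"
  proof -
    have "q ^ 4 dvd s ^ 4" using qs by (metis dvd_triv_left power_Suc2 eval_nat_numeral(3))
    then show ?thesis by (simp add: pow_divides_pow_iff)
  qed
  then obtain c where c: "s = q * c" by auto
  have qc: "q = c ^ 4"
  proof -
    have "q * q ^ 4 = c ^ 4 * q ^ 4" using qs c by (simp add: power_mult_distrib eval_nat_numeral)
    then show ?thesis using q(1) by simp
  qed
  have "c \<noteq> 0" using qc q by auto
  let ?A = "p ^ 2 + q ^ 2" and ?B = "p ^ 3 + p * q ^ 2 - q ^ 3"
  have A: "?A > 0" using q by (simp add: add_nonneg_pos)
  \<comment> \<open>Rational root test: a root would have \<open>p = 1\<close> or
    \<open>p = -1\<close> with \<open>q = 1\<close>, where the cubic takes the values 1 and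
    -3.\<close>
  have "?B \<noteq> 0"
  proof
    assume B0: "?B = 0"
    have "p dvd q ^ 3" using B0 by (intro dvdI[of _ _ "p ^ 2 + q ^ 2"]) (simp add: algebra_simps eval_nat_numeral)
    then have "p dvd 1" using q(2) by (metis coprime_common_divisor coprime_power_right_iff dvd_refl)
    moreover have "q dvd p ^ 3" using B0 by (intro dvdI[of _ _ "q ^ 2 - p * q"]) (simp add: algebra_simps eval_nat_numeral)
    then have "q dvd 1" using q(2) by (metis coprime_common_divisor coprime_power_left_iff dvd_refl)
    ultimately have "(p = 1 \<or> p = -1) \<and> q = 1" using q(1) by auto
    then show False using B0 by auto
  qed
  moreover have "?A * ?B = r ^ 4" using N by (simp add: quintic_def)
  moreover have "r ^ 4 \<ge> 0" by simp
  \<comment> \<open>Positivity of \<open>?B\<close> is used twice: to extract the fourth power from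
    \<open>?A * ?B\<close>, and to exclude \<open>p = 0\<close>.\<close>
  ultimately have "?B > 0" using A by (metis mult_pos_neg not_less less_le linorder_neqE)
  then obtain m where m: "?A = m ^ 4"
    using int_fourth_power_factor[OF coprime_quintic_int(2)[OF q(2)] _ A] \<open>?A * ?B = r ^ 4\<close> by blast
  have "p \<noteq> 0"
  proof
    assume "p = 0"
    then have "?B = - (q ^ 3)" by simp
    then show False using \<open>?B > 0\<close> q(1) by simp
  qed
  \<comment> \<open>\<open>?A = m^4\<close> reads \<open>p^2 = m^4 - q^2\<close>, and
    \<open>q^2 = c^8\<close> is the fourth power of \<open>c^2\<close>.\<close>
  define X Y Z where "X = nat \<bar>m\<bar>" and "Y = nat \<bar>c\<bar> ^ 2" and "Z = nat \<bar>p\<bar>"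
  have "int (X ^ 4) = int (Y ^ 4 + Z ^ 2)"
    using m qc by (simp add: X_def Y_def Z_def power_even_abs_numeral flip: power_mult)
  then have "X ^ 4 = Y ^ 4 + Z ^ 2" by (simp only: of_nat_eq_iff)
  moreover have "coprime X Y"
  proof -
    have "coprime (m ^ 4) (q ^ 1)" 
      unfolding m[symmetric] using q(2)
      by (metis coprime_commute coprime_power_left_iff power_one_right power2_eq_square
          gcd_add_mult coprime_iff_gcd_eq_1 add.commute)
    then have "coprime m c" by (simp add: qc)
    then show ?thesis by (simp add: X_def Y_def coprime_int_iff[symmetric])
  qed
  moreover have "Y > 0" "Z > 0" using \<open>c \<noteq> 0\<close> \<open>p \<noteq> 0\<close> by (auto simp: Y_def Z_def)
  ultimately show False by (rule diff_fourth_powers_not_square_coprime)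
qed

section \<open>Bounding the dimension by the growth of the Hilbert function\<close>

text \<open>The Hilbert function of \<open>Y\<close> in degree \<open>d\<close> is at least
  \<open>N\<close>. An explicit family replaces the dimension of the forms modulo those that vanish
  on \<open>Y\<close>.\<close>

definition independent_forms :: "nat \<Rightarrow> point set \<Rightarrow> nat \<Rightarrow> nat \<Rightarrow> bool" where
  "independent_forms n Y d N \<longleftrightarrow>
     (\<exists>F. (\<forall>i<N. F i \<in> forms UNIV n d) \<and>
       (\<forall>c. vanishes_on (\<Sum>i<N. mconst (c i) * F i) Y \<longrightarrow> (\<forall>i<N. c i = 0)))"

lemma mconst_mult_forms: "F \<in> forms UNIV n d \<Longrightarrow> mconst c * F \<in> forms UNIV n d"
  using mult_forms[OF mconst_forms, of c UNIV F n d] by simp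

lemma linear_combination_forms:
  "(\<And>i. i \<in> I \<Longrightarrow> F i \<in> forms UNIV n d) \<Longrightarrow> (\<Sum>i\<in>I. mconst (c i) * F i) \<in> forms UNIV n d"
  by (intro sum_forms mconst_mult_forms) auto

lemma independent_forms_mono:
  "independent_forms n Y d N \<Longrightarrow> Y \<subseteq> Y' \<Longrightarrow> independent_forms n Y' d N"
proof -
  assume *: "independent_forms n Y d N" and "Y \<subseteq> Y'"
  then have "vanishes_on F Y' \<Longrightarrow> vanishes_on F Y" for F by (auto simp: vanishes_on_def)
  then show ?thesis using * unfolding independent_forms_def by blast
qed

text \<open>In terms of Hilbert functions: multiplication by \<open>G\<close> is injective on \<open>Y'\<close>, with image in the
  kernel of the restriction to \<open>Y\<close>.\<close>

lemma independent_forms_add: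
  assumes irr: "zariski_irreducible n Y'" "Y' \<subseteq> proj_space n" and "Y \<subseteq> Y'"
    and G: "G \<in> forms UNIV n e" "vanishes_on G Y" "\<not> vanishes_on G Y'"
    and M: "independent_forms n Y (d + e) M" and N: "independent_forms n Y' d N"
  shows "independent_forms n Y' (d + e) (M + N)"
proof -
  obtain F1 where F1: "\<And>i. i < M \<Longrightarrow> F1 i \<in> forms UNIV n (d + e)"
    "\<And>c. vanishes_on (\<Sum>i<M. mconst (c i) * F1 i) Y \<Longrightarrow> \<forall>i<M. c i = 0"
    using M by (auto simp: independent_forms_def)
  obtain F2 where F2: "\<And>i. i < N \<Longrightarrow> F2 i \<in> forms UNIV n d"
    "\<And>c. vanishes_on (\<Sum>i<N. mconst (c i) * F2 i) Y' \<Longrightarrow> \<forall>i<N. c i = 0"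
    using N by (auto simp: independent_forms_def)
  define F where "F i = (if i < M then F1 i else G * F2 (i - M))" for i
  have "F i \<in> forms UNIV n (d + e)" if "i < M + N" for i
    using that F1(1)[of i] mult_forms[OF G(1) F2(1)[of "i - M"]] by (auto simp: F_def add.commute)
  moreover have "\<forall>i<M + N. c i = 0" if van: "vanishes_on (\<Sum>i<M + N. mconst (c i) * F i) Y'" for c
  proof -
    have split: "(\<Sum>i<M + N. mconst (c i) * F i) =
        (\<Sum>i<M. mconst (c i) * F1 i) + G * (\<Sum>i<N. mconst (c (M + i)) * F2 i)"
    proof -
      have "(\<Sum>i<M + N. h i) = (\<Sum>i<M. h i) + (\<Sum>i<N. h (M + i))" for h :: "nat \<Rightarrow> mpoly"
        by (induction N) (simp_all add: add.assoc)
      then show ?thesis by (simp add: F_def sum_distrib_left mult.left_commute)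
    qed
    have zero: "mpoly_eval (\<Sum>i<M. mconst (c i) * F1 i) x +
        mpoly_eval G x * mpoly_eval (\<Sum>i<N. mconst (c (M + i)) * F2 i) x = 0" if "P \<in> Y'" "x \<in> P" for P x
      using van that unfolding split vanishes_on_def by (simp only: mpoly_eval_add mpoly_eval_mult)
    have "vanishes_on (\<Sum>i<M. mconst (c i) * F1 i) Y"
      unfolding vanishes_on_def
    proof (intro ballI)
      fix P x assume P: "P \<in> Y" "x \<in> P"
      then have "mpoly_eval G x = 0" using G(2) unfolding vanishes_on_def by blast
      then show "mpoly_eval (\<Sum>i<M. mconst (c i) * F1 i) x = 0" using zero[of P x] P \<open>Y \<subseteq> Y'\<close> by auto
    qed
    then have c1: "\<forall>i<M. c i = 0" by (rule F1(2))
    then have "mpoly_eval (\<Sum>i<M. mconst (c i) * F1 i) x = 0" for x by simp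
    then have "vanishes_on (G * (\<Sum>i<N. mconst (c (M + i)) * F2 i)) Y'"
      unfolding vanishes_on_def using zero by simp
    then have "vanishes_on (\<Sum>i<N. mconst (c (M + i)) * F2 i) Y'"
      using zariski_irreducible_mult[OF irr G(1) linear_combination_forms[of "{..<N}" F2 n d]] F2(1) G(3)
      by auto
    then have c2: "\<forall>i<N. c (M + i) = 0" by (rule F2(2))
    show ?thesis
    proof (intro allI impI)
      fix i assume "i < M + N"
      then show "c i = 0" using c1 c2[rule_format, of "i - M"] by (cases "i < M") auto
    qed
  qed
  ultimately show ?thesis by (auto simp: independent_forms_def)
qed

text \<open>Pascal's rule, with one use of \<open>independent_forms_add\<close> for each pair
  (\<open>j\<close>, \<open>m\<close>). The binomial coefficient counts the monomials of degree
  \<open>m\<close> in the \<open>j + 1\<close> forms \<open>L\<close>, \<open>G 0\<close>, ...,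
  \<open>G (j - 1)\<close>; as these forms share the degree \<open>e\<close>, the monomials share
  the degree \<open>e * m\<close>.\<close>

lemma independent_forms_chain:
  assumes irr: "\<And>i. i \<le> D \<Longrightarrow> zariski_irreducible n (Y i)" "\<And>i. i \<le> D \<Longrightarrow> Y i \<subseteq> proj_space n"
    and sub: "\<And>i. i < D \<Longrightarrow> Y i \<subseteq> Y (Suc i)"
    and G: "\<And>i. i < D \<Longrightarrow> G i \<in> forms UNIV n e" "\<And>i. i < D \<Longrightarrow> vanishes_on (G i) (Y i)"
      "\<And>i. i < D \<Longrightarrow> \<not> vanishes_on (G i) (Y (Suc i))"
    and L: "L \<in> forms UNIV n e" "\<not> vanishes_on L (Y 0)"
    and "j \<le> D"
  shows "independent_forms n (Y j) (e * m) ((m + j) choose j)"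
  using \<open>j \<le> D\<close>
proof (induction j arbitrary: m)
  case 0
  obtain P x where "P \<in> Y 0" "x \<in> P" "mpoly_eval L x \<noteq> 0"
    using L(2) by (auto simp: vanishes_on_def)
  then have "c 0 = 0" if "vanishes_on (mconst (c 0) * L ^ m) (Y 0)" for c :: "nat \<Rightarrow> complex"
    using that by (auto simp: vanishes_on_def)
  then show ?case
    using power_forms[OF L(1), of m]
    by (auto simp: independent_forms_def intro!: exI[of _ "\<lambda>_. L ^ m"])
next
  case (Suc j)
  then have IH: "independent_forms n (Y j) (e * m) ((m + j) choose j)" for m by simp
  show ?case
  proof (induction m)
    case 0
    have "Y (Suc j) \<noteq> {}" "Y (Suc j) \<subseteq> proj_space n"
      using irr Suc.prems by (auto simp: zariski_irreducible_def)
    then obtain P x where "P \<in> Y (Suc j)" "x \<in> P" by (metis all_not_in_conv proj_spaceE proj_point_self subsetD)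
    then show ?case
      by (auto simp: independent_forms_def vanishes_on_def intro!: exI[of _ "\<lambda>_. 1"])
  next
    case (Suc m')
    have "independent_forms n (Y (Suc j)) (e * m' + e) ((Suc m' + j choose j) + (m' + Suc j choose Suc j))"
    proof (rule independent_forms_add[of n "Y (Suc j)" "Y j" "G j" e])
      show "independent_forms n (Y j) (e * m' + e) (Suc m' + j choose j)"
        using IH[of "Suc m'"] by (simp add: add.commute)
    qed (use Suc Suc.prems irr sub G \<open>Suc j \<le> D\<close> in auto)
    then show ?case by (simp add: add.commute)
  qed
qed

lemma nonvanishing_coordinate:
  assumes "P \<in> proj_space n"
  obtains i where "i \<le> n" "\<not> vanishes_on (mvar i) {P}"
proof -
  obtain x where x: "x \<in> coords n" "\<exists>i. x i \<noteq> 0" "P = proj_point x"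
    using assms by (elim proj_spaceE)
  then obtain i where i: "x i \<noteq> 0" by auto
  then have "\<not> n < i" using x(1) by (auto simp: coords_def)
  then have "i \<le> n" by simp
  moreover have "\<not> vanishes_on (mvar i) {P}"
    using i vanishes_on_proj_point[OF mvar_forms[OF UNIV_I \<open>i \<le> n\<close>], of x] x(3) by simp
  ultimately show ?thesis by (rule that)
qed

lemma has_chain_independent_forms:
  assumes chain: "has_chain n X D" and X: "X \<subseteq> proj_space n"
  shows "\<exists>e>0. \<forall>m. independent_forms n X (e * m) ((m + D) choose D)"
proof -
  obtain Y where Y: "\<And>i. i \<le> D \<Longrightarrow> zariski_irreducible n (Y i)"
    "\<And>i. i \<le> D \<Longrightarrow> \<exists>Z. zariski_closed UNIV n Z \<and> Y i = X \<inter> Z"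
    "\<And>i. i < D \<Longrightarrow> Y i \<subset> Y (Suc i)"
    using chain by (auto simp: has_chain_def)
  have YX: "Y i \<subseteq> X" if "i \<le> D" for i using Y(2)[OF that] by auto
  then have YP: "Y i \<subseteq> proj_space n" if "i \<le> D" for i using X that by blast
  have "\<exists>G d. d > 0 \<and> G \<in> forms UNIV n d \<and> vanishes_on G (Y i) \<and> \<not> vanishes_on G (Y (Suc i))"
    if i: "i < D" for i
  proof -
    obtain P where P: "P \<in> Y (Suc i)" "P \<notin> Y i" using Y(3)[OF i] by auto
    obtain Z where Z: "zariski_closed UNIV n Z" "Y i = X \<inter> Z" using Y(2)[of i] i by auto
    obtain S where S: "S \<subseteq> (\<Union>d. forms UNIV n d)" "Z = {P \<in> proj_space n. \<forall>F\<in>S. vanishes_on F {P}}"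
      using Z(1) by (auto simp: zariski_closed_def)
    have PX: "P \<in> X" "P \<in> proj_space n" using P YX[of "Suc i"] X i by auto
    then obtain F d where F: "F \<in> S" "F \<in> forms UNIV n d" "\<not> vanishes_on F {P}"
      using P(2) Z(2) S by blast
    \<comment> \<open>A coordinate that is nonzero at \<open>P\<close> makes the degree of the
      separating form positive, as the common degree \<open>e\<close> below requires.\<close>
    obtain k where k: "k \<le> n" "\<not> vanishes_on (mvar k) {P}" using nonvanishing_coordinate[OF PX(2)] .
    have kf: "mvar k \<in> forms UNIV n 1" using mvar_forms[OF UNIV_I k(1)] .
    have "vanishes_on F (Y i)" using F(1) Z(2) S(2) by (auto simp: vanishes_on_def)
    then have "vanishes_on (mvar k * F) (Y i)" by (auto simp: vanishes_on_def)
    moreover have "\<not> vanishes_on (mvar k * F) (Y (Suc i))"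
    proof
      assume "vanishes_on (mvar k * F) (Y (Suc i))"
      then have "vanishes_on (mvar k) (Y (Suc i)) \<or> vanishes_on F (Y (Suc i))"
        using zariski_irreducible_mult[OF Y(1) YP kf F(2)] i by (simp add: Suc_le_eq)
      then show False
        using k(2) F(3) P(1) vanishes_on_pointwise by blast
    qed
    ultimately have "1 + d > 0 \<and> mvar k * F \<in> forms UNIV n (1 + d) \<and>
        vanishes_on (mvar k * F) (Y i) \<and> \<not> vanishes_on (mvar k * F) (Y (Suc i))"
      using mult_forms[OF kf F(2)] by simp
    then show ?thesis by blast
  qed
  then have "\<forall>i\<in>{..<D}. \<exists>q. snd q > 0 \<and> fst q \<in> forms UNIV n (snd q) \<and>
      vanishes_on (fst q) (Y i) \<and> \<not> vanishes_on (fst q) (Y (Suc i))"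
    by (metis fst_conv snd_conv lessThan_iff)
  from bchoice[OF this] obtain q where q: "\<forall>i\<in>{..<D}. snd (q i) > 0 \<and> fst (q i) \<in> forms UNIV n (snd (q i)) \<and>
      vanishes_on (fst (q i)) (Y i) \<and> \<not> vanishes_on (fst (q i)) (Y (Suc i))" ..
  obtain G d where G: "\<And>i. i < D \<Longrightarrow> d i > 0" "\<And>i. i < D \<Longrightarrow> G i \<in> forms UNIV n (d i)"
    "\<And>i. i < D \<Longrightarrow> vanishes_on (G i) (Y i)" "\<And>i. i < D \<Longrightarrow> \<not> vanishes_on (G i) (Y (Suc i))"
  proof (rule that[of "\<lambda>i. snd (q i)" "\<lambda>i. fst (q i)"])
  qed (use q in simp_all)
  text \<open>Powers of the \<open>G\<^sub>i\<close> have a common degree.\<close>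
  define e where "e = (\<Prod>i<D. d i)"
  define r where "r i = (\<Prod>j\<in>{..<D} - {i}. d j)" for i
  have e: "e > 0" using G(1) by (auto simp: e_def intro!: prod_pos)
  have de: "d i * r i = e" and r: "r i > 0" if "i < D" for i
    using that G(1) by (auto simp: e_def r_def prod.remove[of _ i] intro!: prod_pos)
  obtain P where P: "P \<in> Y 0" using Y(1)[of 0] by (auto simp: zariski_irreducible_def)
  obtain k where k: "k \<le> n" "\<not> vanishes_on (mvar k) {P}"
    using nonvanishing_coordinate[of P n] P YP[of 0] by auto
  have "independent_forms n (Y D) (e * m) ((m + D) choose D)" for m
  proof (rule independent_forms_chain[of D n Y "\<lambda>i. G i ^ r i" e "mvar k ^ e"])
    show "zariski_irreducible n (Y i)" "Y i \<subseteq> proj_space n" if "i \<le> D" for i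
      using Y(1) YP that by auto
    show "Y i \<subseteq> Y (Suc i)" if "i < D" for i using Y(3)[OF that] by auto
    show "G i ^ r i \<in> forms UNIV n e" if "i < D" for i
      using power_forms[OF G(2)[OF that], of "r i"] de[OF that] by simp
    show "vanishes_on (G i ^ r i) (Y i)" "\<not> vanishes_on (G i ^ r i) (Y (Suc i))" if "i < D" for i
      using G(3,4)[OF that] r[OF that] by (auto simp: vanishes_on_def)
    show "mvar k ^ e \<in> forms UNIV n e" using power_forms[OF mvar_forms[of UNIV k n], of e] k by auto
    show "\<not> vanishes_on (mvar k ^ e) (Y 0)" using k(2) P by (auto simp: vanishes_on_def)
  qed simp
  then show ?thesis using e YX[of D] independent_forms_mono by blast
qed

text \<open>Serves in both directions: a chain in one curve yields a chain of length 2 in the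
  surface, and the absence of longer chains in the surface bounds the chains in the curves.\<close>

lemma has_chain_closed_subset:
  assumes chain: "has_chain n C D" and C: "C = X \<inter> Z" "zariski_closed UNIV n Z" "C \<noteq> X"
    and X: "zariski_irreducible n X" "X \<subseteq> proj_space n"
  shows "has_chain n X (Suc D)"
proof -
  obtain Y where Y: "\<And>i. i \<le> D \<Longrightarrow> zariski_irreducible n (Y i)"
    "\<And>i. i \<le> D \<Longrightarrow> \<exists>Z. zariski_closed UNIV n Z \<and> Y i = C \<inter> Z"
    "\<And>i. i < D \<Longrightarrow> Y i \<subset> Y (Suc i)"
    using chain by (auto simp: has_chain_def)
  have all: "zariski_closed UNIV n (proj_space n)"
    using zariski_closed_forms[of "{}" UNIV n] by simp
  define Y' where "Y' i = (if i \<le> D then Y i else X)" for i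
  have "zariski_irreducible n (Y' i)" if "i \<le> Suc D" for i
    using Y(1) X(1) by (auto simp: Y'_def)
  moreover have "\<exists>Z. zariski_closed UNIV n Z \<and> Y' i = X \<inter> Z" if "i \<le> Suc D" for i
  proof (cases "i \<le> D")
    case True
    then obtain Z' where "zariski_closed UNIV n Z'" "Y i = C \<inter> Z'" using Y(2) by blast
    then show ?thesis
      using True C zariski_closed_Int[OF C(2), of Z'] by (intro exI[of _ "Z \<inter> Z'"]) (auto simp: Y'_def)
  next
    case False
    then show ?thesis using all X(2) by (intro exI[of _ "proj_space n"]) (auto simp: Y'_def)
  qed
  moreover have "Y' i \<subset> Y' (Suc i)" if "i < Suc D" for i
    using that Y(2)[of D] Y(3)[of i] C by (auto simp: Y'_def less_Suc_eq_le Suc_le_eq)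
  ultimately show ?thesis unfolding has_chain_def by blast
qed

section \<open>Polynomials in two variables\<close>

text \<open>Exponents are bounded separately, not by total degree: the bounds add under
  multiplication, and the count \<open>(A + 1)^2\<close> is still quadratic in
  \<open>A\<close>.\<close>

definition monomials2 :: "nat \<Rightarrow> (complex \<times> complex \<Rightarrow> complex) set" where
  "monomials2 A = (\<lambda>(a, b). \<lambda>p. fst p ^ a * snd p ^ b) ` ({..A} \<times> {..A})"

abbreviation polys2 :: "nat \<Rightarrow> (complex \<times> complex \<Rightarrow> complex) set" where
  "polys2 A \<equiv> fun_space.span (monomials2 A)"

lemma finite_monomials2: "finite (monomials2 A)"
  and card_monomials2: "card (monomials2 A) \<le> (A + 1) ^ 2"
proof -
  show "finite (monomials2 A)" by (simp add: monomials2_def)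
  have "card (monomials2 A) \<le> card ({..A} \<times> {..A})" unfolding monomials2_def by (intro card_image_le) auto
  then show "card (monomials2 A) \<le> (A + 1) ^ 2" by (simp add: power2_eq_square)
qed

lemma monomial_polys2: "a \<le> A \<Longrightarrow> b \<le> A \<Longrightarrow> (\<lambda>p. fst p ^ a * snd p ^ b) \<in> polys2 A"
  by (intro fun_space.span_base) (auto simp: monomials2_def)

lemma scale_polys2: "g \<in> polys2 A \<Longrightarrow> (\<lambda>p. c * g p) \<in> polys2 A"
  using fun_space.span_scale[of g _ c] by simp

lemma add_polys2: "g \<in> polys2 A \<Longrightarrow> h \<in> polys2 A \<Longrightarrow> (\<lambda>p. g p + h p) \<in> polys2 A"
  using fun_space.span_add[of g _ h] by (simp add: plus_fun_def)

lemma zero_polys2: "(\<lambda>p. 0) \<in> polys2 A"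
  using fun_space.span_zero[of "monomials2 A"] by (simp add: zero_fun_def)

lemma sum_polys2: "(\<And>i. i \<in> I \<Longrightarrow> g i \<in> polys2 A) \<Longrightarrow> (\<lambda>p. \<Sum>i\<in>I. g i p) \<in> polys2 A"
  by (induction I rule: infinite_finite_induct) (auto intro: zero_polys2 add_polys2)

lemma mult_polys2:
  assumes "g \<in> polys2 A" "h \<in> polys2 B"
  shows "(\<lambda>p. g p * h p) \<in> polys2 (A + B)"
  using assms(1)
proof (induction rule: fun_space.span_induct_alt)
  case base
  then show ?case using zero_polys2 by simp
next
  case (step c m g)
  have "(\<lambda>p. m p * h p) \<in> polys2 (A + B)"
    using assms(2)
  proof (induction rule: fun_space.span_induct_alt)
    case base
    then show ?case using zero_polys2 by simp
  next
    case (step c' m' h)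
    obtain a b a' b' where "m = (\<lambda>p. fst p ^ a * snd p ^ b)" "m' = (\<lambda>p. fst p ^ a' * snd p ^ b')"
      "a \<le> A" "b \<le> A" "a' \<le> B" "b' \<le> B"
      using \<open>m \<in> monomials2 A\<close> step(1) by (auto simp: monomials2_def)
    then have "(\<lambda>p. m p * m' p) \<in> polys2 (A + B)"
      using monomial_polys2[of "a + a'" "A + B" "b + b'"] by (simp add: power_add algebra_simps)
    from add_polys2[OF scale_polys2[OF this, of c'] step(2)] show ?case
      by (simp add: algebra_simps)
  qed
  from add_polys2[OF scale_polys2[OF this, of c] step(2)] show ?case
    by (simp add: algebra_simps)
qed

lemma power_polys2: "g \<in> polys2 A \<Longrightarrow> (\<lambda>p. g p ^ k) \<in> polys2 (A * k)"
proof (induction k)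
  case 0
  then show ?case using monomial_polys2[of 0 0 0] by simp
next
  case (Suc k)
  then show ?case using mult_polys2[of g A "\<lambda>p. g p ^ k" "A * k"] by simp
qed

lemma prod_polys2:
  "finite I \<Longrightarrow> (\<And>i. i \<in> I \<Longrightarrow> g i \<in> polys2 (A i)) \<Longrightarrow> (\<lambda>p. \<Prod>i\<in>I. g i p) \<in> polys2 (\<Sum>i\<in>I. A i)"
proof (induction I rule: finite_induct)
  case empty
  then show ?case using monomial_polys2[of 0 0 0] by simp
next
  case (insert i I)
  then show ?case using mult_polys2[of "g i" "A i" "\<lambda>p. \<Prod>i\<in>I. g i p" "\<Sum>i\<in>I. A i"] by simp
qed

lemma form_comp_polys2:
  assumes F: "F \<in> forms k n d" and u: "\<And>i. i \<le> n \<Longrightarrow> (\<lambda>p. u p i) \<in> polys2 A"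
  shows "(\<lambda>p. mpoly_eval F (u p)) \<in> polys2 (A * d)"
  unfolding mpoly_eval_def
proof (intro sum_polys2 scale_polys2)
  fix m assume "m \<in> Poly_Mapping.keys F"
  then have m: "Poly_Mapping.keys m \<subseteq> {..n}" "(\<Sum>i\<in>Poly_Mapping.keys m. Poly_Mapping.lookup m i) = d"
    using F by (auto simp: forms_def)
  have "(\<lambda>p. \<Prod>i\<in>Poly_Mapping.keys m. u p i ^ Poly_Mapping.lookup m i)
      \<in> polys2 (\<Sum>i\<in>Poly_Mapping.keys m. A * Poly_Mapping.lookup m i)"
    by (intro prod_polys2 power_polys2 u) (use m in auto)
  then show "(\<lambda>p. \<Prod>i\<in>Poly_Mapping.keys m. u p i ^ Poly_Mapping.lookup m i) \<in> polys2 (A * d)"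
    using m(2) by (simp flip: sum_distrib_left)
qed

text \<open>The passage from functions to honest polynomials: \<open>complex poly poly\<close> is an
  integral domain, which \<open>polys2_mult_zero\<close> exploits. The outer variable is the second
  coordinate.\<close>

lemma polys2_eval_poly:
  assumes "g \<in> polys2 A"
  shows "\<exists>P :: complex poly poly. \<forall>x y. g (x, y) = poly (poly P [:y:]) x"
  using assms
proof (induction rule: fun_space.span_induct_alt)
  case base
  then show ?case by (intro exI[of _ 0]) auto
next
  case (step c m g)
  then obtain P :: "complex poly poly" where P: "\<And>x y. g (x, y) = poly (poly P [:y:]) x" by blast
  obtain a b where m: "m = (\<lambda>p. fst p ^ a * snd p ^ b)"
    using step(1) by (auto simp: monomials2_def)
  show ?case
    by (intro exI[of _ "monom (monom c a) b + P"]) (simp add: m P poly_monom)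
qed

lemma bivariate_poly_zero:
  fixes P :: "complex poly poly"
  assumes "infinite U" "infinite V" "\<And>x y. x \<in> U \<Longrightarrow> y \<in> V \<Longrightarrow> poly (poly P [:y:]) x = 0"
  shows "P = 0"
proof (rule ccontr)
  assume "P \<noteq> 0"
  have "poly P [:y:] = 0" if "y \<in> V" for y
  proof (rule ccontr)
    assume "poly P [:y:] \<noteq> 0"
    then have "finite {x. poly (poly P [:y:]) x = 0}" by (rule poly_roots_finite)
    moreover have "U \<subseteq> {x. poly (poly P [:y:]) x = 0}" using assms(3) that by auto
    ultimately show False using assms(1) finite_subset by metis
  qed
  then have "(\<lambda>y. [:y:]) ` V \<subseteq> {q. poly P q = 0}" by auto
  then have "finite ((\<lambda>y. [:y:]) ` V)" using poly_roots_finite[OF \<open>P \<noteq> 0\<close>] by (rule finite_subset)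
  moreover have "inj_on (\<lambda>y. [:y:]) V" by (auto simp: inj_on_def)
  ultimately show False using assms(2) finite_imageD by metis
qed

lemma polys2_zero:
  assumes "g \<in> polys2 A" "infinite U" "infinite V" "\<And>x y. x \<in> U \<Longrightarrow> y \<in> V \<Longrightarrow> g (x, y) = 0"
  shows "g (x, y) = 0"
proof -
  obtain P :: "complex poly poly" where P: "\<And>x y. g (x, y) = poly (poly P [:y:]) x"
    using polys2_eval_poly[OF assms(1)] by blast
  then show ?thesis using bivariate_poly_zero[of U V P] assms by auto
qed

lemma polys2_mult_zero:
  assumes "g \<in> polys2 A" "h \<in> polys2 B" "infinite U" "infinite V"
    "\<And>x y. x \<in> U \<Longrightarrow> y \<in> V \<Longrightarrow> g (x, y) * h (x, y) = 0"
  shows "(\<forall>x y. g (x, y) = 0) \<or> (\<forall>x y. h (x, y) = 0)"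
proof -
  obtain P Q :: "complex poly poly" where
    P: "\<And>x y. g (x, y) = poly (poly P [:y:]) x" and Q: "\<And>x y. h (x, y) = poly (poly Q [:y:]) x"
    using polys2_eval_poly[OF assms(1)] polys2_eval_poly[OF assms(2)] by blast
  have "P * Q = 0"
    by (rule bivariate_poly_zero[OF assms(3,4)]) (use assms(5) P Q in simp)
  then show ?thesis using P Q by auto
qed

section \<open>Hilbert functions of varieties parametrized by two variables\<close>

lemma sum_apply: "(\<Sum>i\<in>I. F i) p = (\<Sum>i\<in>I. F i p :: complex)"
  by (induction I rule: infinite_finite_induct) auto

text \<open>Independence is assumed for the indexed family, while the bound for independent subsets
  of a span speaks of sets. Injectivity therefore comes first: a repetition would give the relation
  with coefficients 1 and -1.\<close>

lemma fun_space_family_bound: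
  fixes g :: "nat \<Rightarrow> 'b \<Rightarrow> complex"
  assumes "finite T" "\<And>i. i < N \<Longrightarrow> g i \<in> fun_space.span T"
    and indep: "\<And>c. (\<And>p. (\<Sum>i<N. c i * g i p) = 0) \<Longrightarrow> \<forall>i<N. c i = 0"
  shows "N \<le> card T"
proof -
  have inj: "inj_on g {..<N}"
  proof (rule inj_onI, rule ccontr)
    fix i j assume ij: "i \<in> {..<N}" "j \<in> {..<N}" "g i = g j" "i \<noteq> j"
    define c :: "nat \<Rightarrow> complex" where "c k = (if k = i then 1 else if k = j then -1 else 0)" for k
    have "(\<Sum>k<N. c k * g k p) = (\<Sum>k\<in>{i, j}. c k * g k p)" for p
      by (rule sum.mono_neutral_right) (use ij in \<open>auto simp: c_def\<close>)
    then have "(\<Sum>k<N. c k * g k p) = 0" for p using ij by (simp add: c_def)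
    from indep[OF this] show False using ij by (auto simp: c_def)
  qed
  have "fun_space.independent (g ` {..<N})"
  proof (rule fun_space.independent_if_scalars_zero)
    fix f v assume sum: "(\<Sum>x\<in>g ` {..<N}. (\<lambda>y. f x * x y)) = 0" and v: "v \<in> g ` {..<N}"
    have "(\<Sum>i<N. f (g i) * g i p) = 0" for p
    proof -
      have "(\<Sum>x\<in>g ` {..<N}. f x * x p) = 0"
        using fun_cong[OF sum, of p] unfolding sum_apply by (simp only: zero_fun_apply)
      then show ?thesis unfolding sum.reindex[OF inj] comp_def .
    qed
    from indep[OF this] show "f v = 0" using v by auto
  qed (rule finite_imageI[OF finite_lessThan])
  then have "card (g ` {..<N}) \<le> card T"
    using fun_space.independent_span_bound[OF assms(1)] assms(2) by blast
  then show ?thesis using card_image[OF inj] by simp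
qed

lemma choose_3_quadratic_growth:
  fixes e A :: nat
  shows "\<exists>m. (A * (e * m) + 1) ^ 2 < (m + 3) choose 3"
proof -
  define B where "B = A * e + 1"
  \<comment> \<open>Chosen so that \<open>6 * (B * m)^2 = m^3\<close>, to be compared with
    \<open>6 * ((m + 3) choose 3)\<close>, which exceeds \<open>m^3\<close>.\<close>
  define m where "m = 6 * B ^ 2"
  have "B \<ge> 1" by (simp add: B_def)
  then have m: "m > 0" by (simp add: m_def)
  have "A * (e * m) + 1 \<le> B * m" using m by (simp add: B_def algebra_simps)
  then have "(A * (e * m) + 1) ^ 2 \<le> (B * m) ^ 2" by (rule power_mono) simp
  moreover have "6 * (B * m) ^ 2 = m ^ 3"
  proof -
    have "6 * (B * m) ^ 2 = (6 * B ^ 2) * m ^ 2" by (simp add: power_mult_distrib)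
    also have "\<dots> = m * m ^ 2" by (simp only: m_def)
    finally show ?thesis by (simp add: power2_eq_square power3_eq_cube)
  qed
  moreover have "6 * ((m + 3) choose 3) = (m + 1) * (m + 2) * (m + 3)"
  proof -
    have "3 * ((m + 3) choose 3) = (m + 3) * ((m + 2) choose 2)"
      using Suc_times_binomial[of 2 "m + 2"] by (simp add: numeral_eq_Suc)
    moreover have "2 * ((m + 2) choose 2) = (m + 2) * (m + 1)"
      using Suc_times_binomial[of 1 "m + 1"] by (simp add: numeral_eq_Suc)
    moreover have "6 * c = (m + 3) * ((m + 2) * (m + 1))"
      if c: "3 * c = (m + 3) * b" and b: "2 * b = (m + 2) * (m + 1)" for b c :: nat
    proof -
      have "6 * c = 2 * (3 * c)" by simp
      also have "\<dots> = (m + 3) * (2 * b)" unfolding c by (rule mult.left_commute)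
      finally show ?thesis unfolding b .
    qed
    ultimately have "6 * ((m + 3) choose 3) = (m + 3) * ((m + 2) * (m + 1))" by blast
    then show ?thesis by (simp only: ac_simps)
  qed
  moreover have "m ^ 3 < (m + 1) * (m + 2) * (m + 3)"
    by (simp add: algebra_simps power3_eq_cube)
  ultimately show ?thesis by (intro exI[of _ m]) linarith
qed

text \<open>A chain of length 3 makes the Hilbert function at multiples of \<open>e\<close> grow at
  least like a cubic polynomial. Pulling back along \<open>u\<close>, injective by
  \<open>dense\<close> on forms modulo those vanishing on \<open>X\<close>, puts degree
  \<open>e * m\<close> into a space of dimension at most \<open>(A * (e * m) + 1)^2\<close>.\<close>

theorem no_chain_of_length_3:
  assumes "X \<subseteq> proj_space n" and u: "\<And>i. i \<le> n \<Longrightarrow> (\<lambda>p. u p i) \<in> polys2 A"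
    and dense: "\<And>F d. F \<in> forms UNIV n d \<Longrightarrow> (\<And>p. mpoly_eval F (u p) = 0) \<Longrightarrow> vanishes_on F X"
  shows "\<not> has_chain n X 3"
proof
  assume "has_chain n X 3"
  then obtain e where "independent_forms n X (e * m) ((m + 3) choose 3)" for m
    using has_chain_independent_forms[OF _ assms(1)] by blast
  moreover obtain m where m: "(A * (e * m) + 1) ^ 2 < (m + 3) choose 3"
    using choose_3_quadratic_growth by blast
  ultimately obtain F where F: "\<And>i. i < (m + 3 choose 3) \<Longrightarrow> F i \<in> forms UNIV n (e * m)"
    "\<And>c. vanishes_on (\<Sum>i<(m + 3 choose 3). mconst (c i) * F i) X \<Longrightarrow> \<forall>i<(m + 3 choose 3). c i = 0"
    unfolding independent_forms_def by blast
  have "(m + 3 choose 3) \<le> card (monomials2 (A * (e * m)))"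
  proof (rule fun_space_family_bound[OF finite_monomials2, of _ "\<lambda>i p. mpoly_eval (F i) (u p)"])
    show "(\<lambda>p. mpoly_eval (F i) (u p)) \<in> polys2 (A * (e * m))" if "i < (m + 3 choose 3)" for i
      by (rule form_comp_polys2[OF F(1)[OF that] u])
    fix c assume c: "\<And>p. (\<Sum>i<(m + 3 choose 3). c i * mpoly_eval (F i) (u p)) = 0"
    have "vanishes_on (\<Sum>i<(m + 3 choose 3). mconst (c i) * F i) X"
    proof (rule dense)
      show "(\<Sum>i<(m + 3 choose 3). mconst (c i) * F i) \<in> forms UNIV n (e * m)"
        by (rule linear_combination_forms) (use F(1) in simp)
    qed (simp only: mpoly_eval_sum mpoly_eval_mult mpoly_eval_mconst c)
    then show "\<forall>i<(m + 3 choose 3). c i = 0" by (rule F(2))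
  qed
  then show False using card_monomials2[of "A * (e * m)"] m by linarith
qed

section \<open>Polynomial functions of three variables\<close>

text \<open>One generating rule per variable, in place of general products, because division by the
  quintic proceeds by induction and only multiplication by \<open>y\<close> pushes a remainder out
  of range.\<close>

inductive poly3 :: "(complex \<Rightarrow> complex \<Rightarrow> complex \<Rightarrow> complex) \<Rightarrow> bool" where
  const: "poly3 (\<lambda>x y z. c)"
| add: "poly3 g \<Longrightarrow> poly3 h \<Longrightarrow> poly3 (\<lambda>x y z. g x y z + h x y z)"
| x: "poly3 g \<Longrightarrow> poly3 (\<lambda>x y z. x * g x y z)"
| y: "poly3 g \<Longrightarrow> poly3 (\<lambda>x y z. y * g x y z)"
| z: "poly3 g \<Longrightarrow> poly3 (\<lambda>x y z. z * g x y z)"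

lemma poly3_mult:
  assumes "poly3 g" "poly3 h"
  shows "poly3 (\<lambda>x y z. g x y z * h x y z)"
  using assms(1)
proof induction
  case (const c)
  show ?case using assms(2)
  proof induction
    case (add g h)
    then show ?case using poly3.add by (simp add: distrib_left)
  next
    case (x g)
    from poly3.x[OF x.IH] show ?case by (simp add: mult.left_commute)
  next
    case (y g)
    from poly3.y[OF y.IH] show ?case by (simp add: mult.left_commute)
  next
    case (z g)
    from poly3.z[OF z.IH] show ?case by (simp add: mult.left_commute)
  qed (rule poly3.const)
next
  case (add g g')
  from poly3.add[OF add.IH] show ?case by (simp add: distrib_right)
next
  case (x g)
  from poly3.x[OF x.IH] show ?case by (simp add: mult.assoc)
next
  case (y g)
  from poly3.y[OF y.IH] show ?case by (simp add: mult.assoc)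
next
  case (z g)
  from poly3.z[OF z.IH] show ?case by (simp add: mult.assoc)
qed

lemma poly3_vars [intro!]: "poly3 (\<lambda>x y z. x)" "poly3 (\<lambda>x y z. y)" "poly3 (\<lambda>x y z. z)"
  using poly3.x[OF poly3.const[of 1]] poly3.y[OF poly3.const[of 1]] poly3.z[OF poly3.const[of 1]] by simp_all

lemma poly3_scale: "poly3 g \<Longrightarrow> poly3 (\<lambda>x y z. c * g x y z)"
  using poly3_mult[OF poly3.const] .

lemma poly3_diff: "poly3 g \<Longrightarrow> poly3 h \<Longrightarrow> poly3 (\<lambda>x y z. g x y z - h x y z)"
  using poly3.add[OF _ poly3_scale[of h "-1"]] by simp

lemma poly3_power: "poly3 g \<Longrightarrow> poly3 (\<lambda>x y z. g x y z ^ k)"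
  by (induction k) (auto intro: poly3.const poly3_mult)

lemma poly3_sum: "(\<And>i. i \<in> I \<Longrightarrow> poly3 (g i)) \<Longrightarrow> poly3 (\<lambda>x y z. \<Sum>i\<in>I. g i x y z)"
  by (induction I rule: infinite_finite_induct) (auto intro: poly3.const poly3.add)

lemma poly3_prod: "(\<And>i. i \<in> I \<Longrightarrow> poly3 (g i)) \<Longrightarrow> poly3 (\<lambda>x y z. \<Prod>i\<in>I. g i x y z)"
  by (induction I rule: infinite_finite_induct) (auto intro: poly3.const poly3_mult)

lemmas poly3_intros = poly3.const poly3_vars poly3.add poly3_mult poly3_diff poly3_power

text \<open>Restriction to a line reduces to univariate polynomials. Lines in the direction of an
  axis serve to extend zeros from infinite sets, tangent lines to compute the derivative in
  \<open>dir_deriv_zero_on_curve_tangent\<close>.\<close>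

lemma poly3_line:
  assumes "poly3 g"
  shows "\<exists>p. \<forall>s. g (x + s * a) (y + s * b) (z + s * c) = poly p s"
  using assms
proof induction
  case (const d)
  show ?case by (intro exI[of _ "[:d:]"]) simp
next
  case (add g h)
  then obtain p q where "\<forall>s. g (x + s * a) (y + s * b) (z + s * c) = poly p s"
    "\<forall>s. h (x + s * a) (y + s * b) (z + s * c) = poly q s" by blast
  then show ?case by (intro exI[of _ "p + q"]) simp
next
  case (x g)
  then obtain p where p: "\<And>s. g (x + s * a) (y + s * b) (z + s * c) = poly p s" by blast
  have "(x + s * a) * poly p s = poly ([:x, a:] * p) s" for s by (simp add: algebra_simps)
  then show ?case unfolding p by blast
next
  case (y g)
  then obtain p where p: "\<And>s. g (x + s * a) (y + s * b) (z + s * c) = poly p s" by blast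
  have "(y + s * b) * poly p s = poly ([:y, b:] * p) s" for s by (simp add: algebra_simps)
  then show ?case unfolding p by blast
next
  case (z g)
  then obtain p where p: "\<And>s. g (x + s * a) (y + s * b) (z + s * c) = poly p s" by blast
  have "(z + s * c) * poly p s = poly ([:z, c:] * p) s" for s by (simp add: algebra_simps)
  then show ?case unfolding p by blast
qed

lemma poly3_line_zero:
  assumes "poly3 g" "infinite U" "\<And>s. s \<in> U \<Longrightarrow> g (x + s * a) (y + s * b) (z + s * c) = 0"
  shows "g (x + s * a) (y + s * b) (z + s * c) = 0"
proof -
  obtain p where p: "\<And>s. g (x + s * a) (y + s * b) (z + s * c) = poly p s"
    using poly3_line[OF assms(1)] by blast
  have "p = 0"
  proof (rule ccontr)
    assume "p \<noteq> 0"
    then have "finite {s. poly p s = 0}" by (rule poly_roots_finite)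
    moreover have "U \<subseteq> {s. poly p s = 0}" using assms(3) p by auto
    ultimately show False using assms(2) finite_subset by metis
  qed
  then show ?thesis by (simp add: p)
qed

lemma poly3_zero_x:
  assumes "poly3 g" "infinite U" "\<And>x. x \<in> U \<Longrightarrow> g x y z = 0"
  shows "g x y z = 0"
  using poly3_line_zero[OF assms(1,2), of 0 1 y 0 z 0 x] assms(3) by simp

lemma poly3_zero_z:
  assumes "poly3 g" "\<And>z. z \<noteq> 0 \<Longrightarrow> g x y z = 0"
  shows "g x y z = 0"
  using poly3_line_zero[OF assms(1), of "- {0}" x 0 y 0 0 1 z] assms(2)
  by (simp add: infinite_UNIV_char_0 Compl_eq_Diff_UNIV)

lemma poly3_split_z:
  assumes "poly3 g"
  shows "\<exists>q. poly3 q \<and> (\<forall>x y z. g x y z = g x y 0 + z * q x y z)"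
  using assms
proof induction
  case (const c)
  show ?case by (intro exI[of _ "\<lambda>x y z. 0"]) (auto intro: poly3.const)
next
  case (add g h)
  then obtain p q where p: "poly3 p" "\<And>x y z. g x y z = g x y 0 + z * p x y z"
    and q: "poly3 q" "\<And>x y z. h x y z = h x y 0 + z * q x y z" by blast
  have "g x y z + h x y z = g x y 0 + h x y 0 + z * (p x y z + q x y z)" for x y z
    using p(2)[of x y z] q(2)[of x y z] by (simp add: algebra_simps)
  then show ?case using poly3.add[OF p(1) q(1)] by blast
next
  case (x g)
  then obtain p where p: "poly3 p" "\<And>x y z. g x y z = g x y 0 + z * p x y z" by blast
  have "x * g x y z = x * g x y 0 + z * (x * p x y z)" for x y z
    using p(2)[of x y z] by (simp add: algebra_simps)
  then show ?case using poly3.x[OF p(1)] by blast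
next
  case (y g)
  then obtain p where p: "poly3 p" "\<And>x y z. g x y z = g x y 0 + z * p x y z" by blast
  have "y * g x y z = y * g x y 0 + z * (y * p x y z)" for x y z
    using p(2)[of x y z] by (simp add: algebra_simps)
  then show ?case using poly3.y[OF p(1)] by blast
next
  case (z g)
  then show ?case by (intro exI[of _ g]) auto
qed

section \<open>The plane quintics \<open>t y\<^sup>4 z = (x\<^sup>2 + z\<^sup>2) (x\<^sup>3 + x z\<^sup>2 - z\<^sup>3)\<close>\<close>

lemma quintic_expand: "quintic x z = x ^ 5 + 2 * x ^ 3 * z ^ 2 - x ^ 2 * z ^ 3 + x * z ^ 4 - z ^ 5"
  by (simp add: quintic_def algebra_simps eval_nat_numeral)

lemma quintic_scale: "quintic (c * x) (c * z) = c ^ 5 * quintic x z"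
  by (simp add: quintic_expand algebra_simps eval_nat_numeral)

lemma quintic_0 [simp]: "quintic x 0 = x ^ 5"
  by (simp add: quintic_expand)

lemma poly3_quintic: "poly3 (\<lambda>x y z. quintic x z)"
  unfolding quintic_def by (intro poly3_intros)

definition quintic_dx :: "'a::comm_ring_1 \<Rightarrow> 'a \<Rightarrow> 'a" where
  "quintic_dx x z = 5 * x ^ 4 + 6 * x ^ 2 * z ^ 2 - 2 * x * z ^ 3 + z ^ 4"

definition quintic_dz :: "'a::comm_ring_1 \<Rightarrow> 'a \<Rightarrow> 'a" where
  "quintic_dz x z = 4 * x ^ 3 * z - 3 * x ^ 2 * z ^ 2 + 4 * x * z ^ 3 - 5 * z ^ 4"

lemma quintic_euler: "x * quintic_dx x z + z * quintic_dz x z = 5 * quintic x z"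
  by (simp add: quintic_expand quintic_dx_def quintic_dz_def algebra_simps eval_nat_numeral)

lemma quintic_has_derivative:
  fixes x z a c :: complex
  shows "((\<lambda>s. quintic (x + s * a) (z + s * c)) has_field_derivative
    quintic_dx x z * a + quintic_dz x z * c) (at 0)"
  unfolding quintic_expand quintic_dx_def quintic_dz_def
  by (rule derivative_eq_intros refl)+ (simp add: algebra_simps eval_nat_numeral)

text \<open>With \<open>z\<close> scaled to 1, the derivative is divided by either factor of the
  polynomial. On \<open>u^2 + 1 = 0\<close> it leaves \<open>- 2 * u\<close>; on the cubic it leaves
  \<open>3 * u^2 + 1\<close>, up to the nonzero factor \<open>u^2 + 1\<close>, and a common root
  would have to be \<open>3 / 2\<close>.\<close>

lemma quintic_simple_root:
  fixes x z :: complex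
  assumes "quintic x z = 0" "z \<noteq> 0"
  shows "quintic_dx x z \<noteq> 0"
proof
  assume d: "quintic_dx x z = 0"
  define u where "u = x / z"
  have x: "x = u * z" using assms(2) by (simp add: u_def)
  have "quintic x z = z ^ 5 * ((u ^ 2 + 1) * (u ^ 3 + u - 1))"
    "quintic_dx x z = z ^ 4 * (5 * u ^ 4 + 6 * u ^ 2 - 2 * u + 1)"
    by (simp_all add: x quintic_def quintic_dx_def algebra_simps eval_nat_numeral)
  then have u: "(u ^ 2 + 1) * (u ^ 3 + u - 1) = 0" "5 * u ^ 4 + 6 * u ^ 2 - 2 * u + 1 = 0"
    using assms d by simp_all
  show False
  proof (cases "u ^ 2 + 1 = 0")
    case True
    have "5 * u ^ 4 + 6 * u ^ 2 - 2 * u + 1 = (5 * u ^ 2 + 1) * (u ^ 2 + 1) - 2 * u"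
      by (simp add: algebra_simps eval_nat_numeral)
    then have "u = 0" using True u(2) by simp
    then show False using True by simp
  next
    case False
    then have cubic: "u ^ 3 + u - 1 = 0" using u(1) by simp
    have "5 * u ^ 4 + 6 * u ^ 2 - 2 * u + 1 = 2 * u * (u ^ 3 + u - 1) + (u ^ 2 + 1) * (3 * u ^ 2 + 1)"
      by (simp add: algebra_simps eval_nat_numeral)
    then have sq: "3 * u ^ 2 + 1 = 0" using cubic u(2) False by simp
    have "3 * (u ^ 3 + u - 1) = u * (3 * u ^ 2 + 1) + 2 * u - 3"
      by (simp add: algebra_simps eval_nat_numeral)
    then have "2 * u = 3" using cubic sq by simp
    then have u: "u = 3 / 2" by (simp add: field_simps)
    show False using sq unfolding u by (simp add: power2_eq_square)
  qed
qed

lemma finite_quintic_roots: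
  fixes z :: complex
  shows "finite {x. quintic x z = 0}"
proof -
  define p where "p = [: - (z ^ 5), z ^ 4, - (z ^ 3), 2 * z ^ 2, 0, 1 :]"
  have "poly p x = quintic x z" for x
    by (simp add: p_def quintic_expand algebra_simps eval_nat_numeral)
  moreover have "p \<noteq> 0" by (simp add: p_def)
  ultimately show ?thesis using poly_roots_finite[of p] by simp
qed

lemma complex_fourth_root:
  obtains y :: complex where "y ^ 4 = a"
proof -
  have "csqrt (csqrt a) ^ (2 * 2) = a" by (simp only: power_mult power2_csqrt)
  then have "csqrt (csqrt a) ^ 4 = a" by simp
  then show ?thesis by (rule that)
qed

text \<open>The four roots are \<open>y\<close>, \<open>- y\<close>, \<open>\<i> * y\<close> and
  \<open>- \<i> * y\<close>. Sums over opposite roots isolate the even coefficients, differences the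
  odd ones.\<close>

lemma cubic_zero_at_fourth_roots:
  fixes y :: complex
  assumes "y \<noteq> 0" and root: "\<And>w. w ^ 4 = y ^ 4 \<Longrightarrow> a0 + a1 * w + a2 * w ^ 2 + a3 * w ^ 3 = 0"
  shows "a0 = 0 \<and> a1 = 0 \<and> a2 = 0 \<and> a3 = (0 :: complex)"
proof -
  have 1: "a0 + a1 * y + a2 * y ^ 2 + a3 * y ^ 3 = 0" by (rule root) simp
  have 2: "a0 - a1 * y + a2 * y ^ 2 - a3 * y ^ 3 = 0"
    using root[of "- y"] by (simp add: eval_nat_numeral)
  have i4: "(\<i> * y) ^ 4 = y ^ 4" "(- \<i> * y) ^ 4 = y ^ 4"
    by (simp_all add: power_mult_distrib)
  have 3: "a0 + \<i> * a1 * y - a2 * y ^ 2 - \<i> * a3 * y ^ 3 = 0"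
    using root[OF i4(1)] by (simp add: power_mult_distrib eval_nat_numeral algebra_simps)
  have 4: "a0 - \<i> * a1 * y - a2 * y ^ 2 + \<i> * a3 * y ^ 3 = 0"
    using root[OF i4(2)] by (simp add: power_mult_distrib eval_nat_numeral algebra_simps)
  have half: "w = 0" if "c * w = z" "z = 0" "c \<noteq> 0" for c w z :: complex using that by auto
  have even: "a0 + a2 * y ^ 2 = 0" "a0 - a2 * y ^ 2 = 0"
  proof -
    have "2 * (a0 + a2 * y ^ 2) = (a0 + a1 * y + a2 * y ^ 2 + a3 * y ^ 3) + (a0 - a1 * y + a2 * y ^ 2 - a3 * y ^ 3)"
      by simp
    then show "a0 + a2 * y ^ 2 = 0" unfolding 1 2 by (rule half) simp_all
    have "2 * (a0 - a2 * y ^ 2) = (a0 + \<i> * a1 * y - a2 * y ^ 2 - \<i> * a3 * y ^ 3) +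
        (a0 - \<i> * a1 * y - a2 * y ^ 2 + \<i> * a3 * y ^ 3)"
      by simp
    then show "a0 - a2 * y ^ 2 = 0" unfolding 3 4 by (rule half) simp_all
  qed
  have odd: "a1 * y + a3 * y ^ 3 = 0" "a1 * y - a3 * y ^ 3 = 0"
  proof -
    have "2 * (a1 * y + a3 * y ^ 3) = (a0 + a1 * y + a2 * y ^ 2 + a3 * y ^ 3) - (a0 - a1 * y + a2 * y ^ 2 - a3 * y ^ 3)"
      by simp
    then show "a1 * y + a3 * y ^ 3 = 0" unfolding 1 2 by (rule half) simp_all
    have "2 * \<i> * (a1 * y - a3 * y ^ 3) = (a0 + \<i> * a1 * y - a2 * y ^ 2 - \<i> * a3 * y ^ 3) -
        (a0 - \<i> * a1 * y - a2 * y ^ 2 + \<i> * a3 * y ^ 3)"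
      by (simp add: algebra_simps)
    then show "a1 * y - a3 * y ^ 3 = 0" unfolding 3 4 by (rule half) simp_all
  qed
  have "2 * a0 = 0" "2 * (a1 * y) = 0"
    using arg_cong2[of _ _ _ _ "(+)", OF even] arg_cong2[of _ _ _ _ "(+)", OF odd] by simp_all
  then show ?thesis using even(1) odd(1) \<open>y \<noteq> 0\<close> by simp
qed

text \<open>Reduction modulo the quintic, as a polynomial in \<open>y\<close> with leading coefficient \<open>t z\<close>.\<close>

definition reduction ::
  "complex \<Rightarrow> (complex \<Rightarrow> complex \<Rightarrow> complex \<Rightarrow> complex) \<Rightarrow> nat \<Rightarrow> (nat \<Rightarrow> complex \<Rightarrow> complex \<Rightarrow> complex) \<Rightarrow>
    (complex \<Rightarrow> complex \<Rightarrow> complex \<Rightarrow> complex) \<Rightarrow> bool" where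
  "reduction t g N r h \<longleftrightarrow> (\<forall>j. poly3 (\<lambda>x y z. r j x z)) \<and> poly3 h \<and>
    (\<forall>x y z. z ^ N * g x y z = (\<Sum>j<4. r j x z * y ^ j) + (t * y ^ 4 * z - quintic x z) * h x y z)"

lemma reductionD:
  assumes "reduction t g N r h"
  shows "poly3 (\<lambda>x y z. r j x z)" "poly3 h"
    "z ^ N * g x y z = (\<Sum>j<4. r j x z * y ^ j) + (t * y ^ 4 * z - quintic x z) * h x y z"
  using assms unfolding reduction_def by simp_all

lemma sum_lessThan_4: "(\<Sum>j<4::nat. f j) = f 0 + f 1 + f 2 + (f 3 :: complex)"
  by (simp add: eval_nat_numeral)

text \<open>Pseudo-division: the leading coefficient \<open>t * z\<close> is not invertible, so
  \<open>g\<close> is multiplied by a power of \<open>z\<close>, whose exponent grows by one with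
  each factor \<open>y\<close>.\<close>

lemma poly3_reduce:
  assumes "poly3 g" "t \<noteq> 0"
  shows "\<exists>N r h. reduction t g N r h"
  using assms(1)
proof induction
  case (const c)
  have "reduction t (\<lambda>x y z. c) 0 (\<lambda>j x z. if j = 0 then c else 0) (\<lambda>x y z. 0)"
    unfolding reduction_def by (auto intro: poly3.const simp: sum_lessThan_4)
  then show ?case by blast
next
  case (add g g')
  then obtain N r h N' s h' where r: "reduction t g N r h" and s: "reduction t g' N' s h'" by blast
  have "reduction t (\<lambda>x y z. g x y z + g' x y z) (N + N') (\<lambda>j x z. z ^ N' * r j x z + z ^ N * s j x z)
      (\<lambda>x y z. z ^ N' * h x y z + z ^ N * h' x y z)"
    unfolding reduction_def
  proof (intro conjI allI)
    fix x y z
    have "z ^ (N + N') * (g x y z + g' x y z) = z ^ N' * (z ^ N * g x y z) + z ^ N * (z ^ N' * g' x y z)"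
      by (simp add: power_add algebra_simps)
    then show "z ^ (N + N') * (g x y z + g' x y z) = (\<Sum>j<4. (z ^ N' * r j x z + z ^ N * s j x z) * y ^ j) +
        (t * y ^ 4 * z - quintic x z) * (z ^ N' * h x y z + z ^ N * h' x y z)"
      unfolding reductionD(3)[OF r] reductionD(3)[OF s]
      by (simp add: distrib_left distrib_right sum.distrib sum_distrib_left mult.assoc mult.left_commute)
  qed (intro poly3_intros reductionD(1,2)[OF r] reductionD(1,2)[OF s])+
  then show ?case by blast
next
  case (x g)
  then obtain N r h where r: "reduction t g N r h" by blast
  have "reduction t (\<lambda>x y z. x * g x y z) N (\<lambda>j x z. x * r j x z) (\<lambda>x y z. x * h x y z)"
    unfolding reduction_def
  proof (intro conjI allI)
    fix x y z
    have "z ^ N * (x * g x y z) = x * (z ^ N * g x y z)" by simp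
    then show "z ^ N * (x * g x y z) = (\<Sum>j<4. x * r j x z * y ^ j) + (t * y ^ 4 * z - quintic x z) * (x * h x y z)"
      unfolding reductionD(3)[OF r] by (simp add: distrib_left sum_distrib_left mult.assoc mult.left_commute)
  qed (intro poly3_intros reductionD(1,2)[OF r])+
  then show ?case by blast
next
  case (z g)
  then obtain N r h where r: "reduction t g N r h" by blast
  have "reduction t (\<lambda>x y z. z * g x y z) N (\<lambda>j x z. z * r j x z) (\<lambda>x y z. z * h x y z)"
    unfolding reduction_def
  proof (intro conjI allI)
    fix x y z
    have "z ^ N * (z * g x y z) = z * (z ^ N * g x y z)" by simp
    then show "z ^ N * (z * g x y z) = (\<Sum>j<4. z * r j x z * y ^ j) + (t * y ^ 4 * z - quintic x z) * (z * h x y z)"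
      unfolding reductionD(3)[OF r] by (simp add: distrib_left sum_distrib_left mult.assoc mult.left_commute)
  qed (intro poly3_intros reductionD(1,2)[OF r])+
  then show ?case by blast
next
  case (y g)
  then obtain N r h where r: "reduction t g N r h" by blast
  \<comment> \<open>Multiplying by \<open>z * y\<close> shifts the remainder. The overflow
    \<open>z * r 3 x z * y^4\<close> is replaced by \<open>1 / t * quintic x z * r 3 x z\<close> in
    degree 0, and the difference goes into \<open>?h\<close>.\<close>
  let ?r = "\<lambda>j x z. if j = 0 then 1 / t * (quintic x z * r 3 x z) else z * r (j - 1) x z"
  let ?h = "\<lambda>x y z. z * (y * h x y z) + 1 / t * r 3 x z"
  have "reduction t (\<lambda>x y z. y * g x y z) (N + 1) ?r ?h"
    unfolding reduction_def
  proof (intro conjI allI)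
    fix j
    show "poly3 (\<lambda>x y z. ?r j x z)"
    proof (cases "j = 0")
      case True
      have "poly3 (\<lambda>x y z. 1 / t * (quintic x z * r 3 x z))"
        by (intro poly3_intros poly3_quintic reductionD(1)[OF r])
      then show ?thesis using True by simp
    next
      case False
      have "poly3 (\<lambda>x y z. z * r (j - 1) x z)"
        by (intro poly3_intros reductionD(1)[OF r])
      then show ?thesis using False by simp
    qed
  next
    show "poly3 ?h" by (intro poly3_intros reductionD(1,2)[OF r])
  next
    fix x y z
    have "z ^ (N + 1) * (y * g x y z) = z * y * (z ^ N * g x y z)" by simp
    also have "\<dots> = z * r 0 x z * y + z * r 1 x z * y ^ 2 + z * r 2 x z * y ^ 3 + y ^ 4 * z * r 3 x z +
        (t * y ^ 4 * z - quintic x z) * (z * (y * h x y z))"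
      unfolding reductionD(3)[OF r] sum_lessThan_4 by (simp add: algebra_simps eval_nat_numeral)
    also have "y ^ 4 * z * r 3 x z = 1 / t * (quintic x z * r 3 x z) + (t * y ^ 4 * z - quintic x z) * (1 / t * r 3 x z)"
      using \<open>t \<noteq> 0\<close> by (simp add: field_simps)
    finally show "z ^ (N + 1) * (y * g x y z) = (\<Sum>j<4. ?r j x z * y ^ j) + (t * y ^ 4 * z - quintic x z) * ?h x y z"
      unfolding sum_lessThan_4 by (simp add: distrib_left)
  qed
  then show ?case by blast
qed

text \<open>On \<open>z = 0\<close> the equation of the quintic is \<open>- x^5\<close>, so it is
  prime to \<open>z\<close>: the other factor \<open>h\<close> vanishes on \<open>z = 0\<close> and
  is divisible by \<open>z\<close>.\<close>

lemma poly3_cancel_z: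
  assumes "poly3 g" "poly3 h" "\<And>x y z. z * g x y z = (t * y ^ 4 * z - quintic x z) * h x y z"
  shows "\<exists>h'. poly3 h' \<and> (\<forall>x y z. g x y z = (t * y ^ 4 * z - quintic x z) * h' x y z)"
proof -
  obtain q where q: "poly3 q" "\<And>x y z. h x y z = h x y 0 + z * q x y z"
    using poly3_split_z[OF assms(2)] by blast
  have "h x y 0 = 0" for x y
  proof (rule poly3_zero_x[OF assms(2), of "- {0}"])
    show "infinite (- {0 :: complex})" by (simp add: infinite_UNIV_char_0 Compl_eq_Diff_UNIV)
    show "h x y 0 = 0" if "x \<in> - {0}" for x using assms(3)[of 0 x y] that by simp
  qed
  then have h: "h x y z = z * q x y z" for x y z using q(2)[of x y z] by simp
  have "g x y z - (t * y ^ 4 * z - quintic x z) * q x y z = 0" for x y z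
  proof (rule poly3_zero_z[of "\<lambda>x y z. g x y z - (t * y ^ 4 * z - quintic x z) * q x y z"])
    show "poly3 (\<lambda>x y z. g x y z - (t * y ^ 4 * z - quintic x z) * q x y z)"
      by (intro poly3_intros poly3_quintic assms q)
    show "g x y z - (t * y ^ 4 * z - quintic x z) * q x y z = 0" if "z \<noteq> 0" for z
      using assms(3)[of z x y] that unfolding h by simp
  qed
  then show ?thesis using q(1) by (intro exI[of _ q]) simp
qed

lemma poly3_cancel_z_power:
  assumes "poly3 g" "poly3 h" "\<And>x y z. z ^ N * g x y z = (t * y ^ 4 * z - quintic x z) * h x y z"
  shows "\<exists>h'. poly3 h' \<and> (\<forall>x y z. g x y z = (t * y ^ 4 * z - quintic x z) * h' x y z)"
  using assms(2,3)
proof (induction N arbitrary: h)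
  case 0
  then show ?case by auto
next
  case (Suc N)
  have "\<exists>h'. poly3 h' \<and> (\<forall>x y z. z ^ N * g x y z = (t * y ^ 4 * z - quintic x z) * h' x y z)"
    by (rule poly3_cancel_z[of _ h]) (use Suc.prems assms(1) in \<open>auto intro!: poly3_intros simp: mult.assoc\<close>)
  then obtain h' where "poly3 h'" "\<And>x y z. z ^ N * g x y z = (t * y ^ 4 * z - quintic x z) * h' x y z"
    by blast
  then show ?case by (rule Suc.IH)
qed

lemma reduced_zero:
  assumes "t \<noteq> 0" "z \<noteq> 0" "quintic x z \<noteq> 0"
    and "\<And>y. t * y ^ 4 * z = quintic x z \<Longrightarrow> a0 + a1 * y + a2 * y ^ 2 + a3 * y ^ 3 = 0"
  shows "a0 = 0 \<and> a1 = 0 \<and> a2 = 0 \<and> a3 = (0 :: complex)"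
proof -
  obtain y where y: "y ^ 4 = quintic x z / (t * z)" by (rule complex_fourth_root)
  then have "y \<noteq> 0" using assms by auto
  moreover have "a0 + a1 * w + a2 * w ^ 2 + a3 * w ^ 3 = 0" if "w ^ 4 = y ^ 4" for w
    using assms y that by (intro assms(4)) simp
  ultimately show ?thesis by (rule cubic_zero_at_fourth_roots)
qed

text \<open>A remainder of degree less than 4 in \<open>y\<close> has four distinct zeros over each
  generic (\<open>x\<close>, \<open>z\<close>), so its coefficients are zero first there and then
  identically; what is left is to cancel \<open>z^N\<close>.\<close>

lemma poly3_vanishing_multiple:
  assumes g: "poly3 g" and t: "t \<noteq> 0"
    and van: "\<And>x y z. z \<noteq> 0 \<Longrightarrow> quintic x z \<noteq> 0 \<Longrightarrow> t * y ^ 4 * z = quintic x z \<Longrightarrow> g x y z = 0"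
  shows "\<exists>h. poly3 h \<and> (\<forall>x y z. g x y z = (t * y ^ 4 * z - quintic x z) * h x y z)"
proof -
  obtain N r h where r: "reduction t g N r h" using poly3_reduce[OF g t] by (elim exE)
  have generic: "r j x z = 0" if "j < 4" and nz: "z \<noteq> 0" "quintic x z \<noteq> 0" for j x z
  proof -
    have "r 0 x z = 0 \<and> r 1 x z = 0 \<and> r 2 x z = 0 \<and> r 3 x z = 0"
    proof (rule reduced_zero[OF t nz])
      fix y assume y: "t * y ^ 4 * z = quintic x z"
      show "r 0 x z + r 1 x z * y + r 2 x z * y ^ 2 + r 3 x z * y ^ 3 = 0"
        using reductionD(3)[OF r, of z x y] van[OF nz y] y by (simp add: sum_lessThan_4)
    qed
    moreover have "j = 0 \<or> j = 1 \<or> j = 2 \<or> j = 3" using \<open>j < 4\<close> by auto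
    ultimately show ?thesis by blast
  qed
  have inf: "infinite {x. quintic x z \<noteq> 0}" for z :: complex
  proof -
    have "{x. quintic x z \<noteq> 0} = UNIV - {x. quintic x z = 0}" by auto
    then show ?thesis
      using Diff_infinite_finite[OF finite_quintic_roots infinite_UNIV_char_0] by simp
  qed
  have "r j x z = 0" if "j < 4" for j x z
  proof (rule poly3_zero_z[OF reductionD(1)[OF r, of j]])
    fix z' :: complex assume "z' \<noteq> 0"
    show "r j x z' = 0"
      by (rule poly3_zero_x[OF reductionD(1)[OF r, of j] inf[of z']]) (use generic that \<open>z' \<noteq> 0\<close> in auto)
  qed
  then have "z ^ N * g x y z = (t * y ^ 4 * z - quintic x z) * h x y z" for x y z
    using reductionD(3)[OF r, of z x y] by simp
  then show ?thesis by (rule poly3_cancel_z_power[OF g reductionD(2)[OF r]])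
qed

text \<open>The version for the irreducibility proof: one infinite set of abscissas is enough,
  provided that all points of the curve above it are zeros. In the chart \<open>z = 1\<close> the
  factor \<open>z^N\<close> of the division is 1.\<close>

lemma poly3_vanishing_affine:
  assumes g: "poly3 g" and t: "t \<noteq> 0" and U: "infinite U"
    and van: "\<And>x y. x \<in> U \<Longrightarrow> quintic x 1 \<noteq> 0 \<and> (t * y ^ 4 = quintic x 1 \<longrightarrow> g x y 1 = 0)"
    and xy: "t * y ^ 4 = quintic x 1"
  shows "g x y 1 = 0"
proof -
  obtain N r h where r: "reduction t g N r h" using poly3_reduce[OF g t] by (elim exE)
  have "r j x 1 = 0" if "j < 4" for j
  proof (rule poly3_zero_x[OF reductionD(1)[OF r, of j] U])
    fix x assume x: "x \<in> U"
    have "r 0 x 1 = 0 \<and> r 1 x 1 = 0 \<and> r 2 x 1 = 0 \<and> r 3 x 1 = 0"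
    proof (rule reduced_zero[OF t one_neq_zero, of x])
      show "quintic x 1 \<noteq> 0" using van[OF x] by blast
      fix y assume y: "t * y ^ 4 * 1 = quintic x 1"
      show "r 0 x 1 + r 1 x 1 * y + r 2 x 1 * y ^ 2 + r 3 x 1 * y ^ 3 = 0"
        using reductionD(3)[OF r, of 1 x y] van[OF x, of y] y by (simp add: sum_lessThan_4)
    qed
    moreover have "j = 0 \<or> j = 1 \<or> j = 2 \<or> j = 3" using \<open>j < 4\<close> by auto
    ultimately show "r j x 1 = 0" by blast
  qed
  then show ?thesis using reductionD(3)[OF r, of 1 x y] xy by simp
qed

section \<open>Coordinates in three-space and the embedded curves\<close>

definition pt :: "complex \<Rightarrow> complex \<Rightarrow> complex \<Rightarrow> complex \<Rightarrow> vec" where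
  "pt x y z w = (\<lambda>i. if i = 0 then x else if i = 1 then y else if i = 2 then z else if i = 3 then w else 0)"

lemma pt_simps [simp]:
  "pt x y z w 0 = x" "pt x y z w 1 = y" "pt x y z w (Suc 0) = y" "pt x y z w 2 = z" "pt x y z w 3 = w"
  by (simp_all add: pt_def)

lemma pt_coords [simp]: "pt x y z w \<in> coords 3"
  by (auto simp: coords_def pt_def)

lemma coords_3_eq:
  assumes "v \<in> coords 3"
  shows "v = pt (v 0) (v 1) (v 2) (v 3)"
proof
  fix i :: nat
  consider "i = 0" | "i = 1" | "i = 2" | "i = 3" | "i > 3" by linarith
  then show "v i = pt (v 0) (v 1) (v 2) (v 3) i"
    by cases (use assms in \<open>auto simp: coords_def pt_def\<close>)
qed

lemma pt_scale: "(\<lambda>i. c * pt x y z w i) = pt (c * x) (c * y) (c * z) (c * w)"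
  by (rule ext) (auto simp: pt_def)

lemma coords_3_zeroI:
  assumes "v \<in> coords 3" "v 0 = 0" "v 1 = 0" "v 2 = 0" "v 3 = 0"
  shows "v i = 0"
proof -
  have "v i = pt (v 0) (v 1) (v 2) (v 3) i" using fun_cong[OF coords_3_eq[OF assms(1)]] .
  also have "\<dots> = pt 0 0 0 0 i" unfolding assms(2-) ..
  finally show ?thesis by (simp add: pt_def)
qed

lemma coords_3_line:
  assumes "x \<in> coords 3" "v \<in> coords 3"
  shows "(\<lambda>i. x i + s * v i) = pt (x 0 + s * v 0) (x 1 + s * v 1) (x 2 + s * v 2) (x 3 + s * v 3)"
  by (subst coords_3_eq) (use assms in \<open>auto simp: coords_def\<close>)

text \<open>The linear form \<open>y + z\<close> vanishes at no base point of the pencil of plane quintics, so placing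
  the quintic with parameter \<open>t\<close> in the plane \<open>w = t (y + z)\<close> makes the curves disjoint.\<close>

definition curve_cone :: "complex \<Rightarrow> vec set" where
  "curve_cone t = {v \<in> coords 3. (\<exists>i. v i \<noteq> 0) \<and> v 3 = t * (v 1 + v 2) \<and>
     t * v 1 ^ 4 * v 2 = quintic (v 0) (v 2)}"

definition curve :: "complex \<Rightarrow> point set" where
  "curve t = proj_point ` curve_cone t"

lemma curve_coneD:
  assumes "x \<in> curve_cone t"
  shows "x \<in> coords 3" "\<exists>i. x i \<noteq> 0" "x 3 = t * (x 1 + x 2)" "t * x 1 ^ 4 * x 2 = quintic (x 0) (x 2)"
    "x = pt (x 0) (x 1) (x 2) (t * (x 1 + x 2))"
proof -
  show 1: "x \<in> coords 3" "\<exists>i. x i \<noteq> 0" "x 3 = t * (x 1 + x 2)" "t * x 1 ^ 4 * x 2 = quintic (x 0) (x 2)"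
    using assms by (auto simp: curve_cone_def)
  show "x = pt (x 0) (x 1) (x 2) (t * (x 1 + x 2))"
    using coords_3_eq[OF 1(1)] unfolding 1(3) .
qed

lemma curve_cone_scale:
  assumes "x \<in> curve_cone t" "c \<noteq> 0"
  shows "(\<lambda>i. c * x i) \<in> curve_cone t"
proof -
  note x = curve_coneD[OF assms(1)]
  have "t * (c * x 1) ^ 4 * (c * x 2) = c ^ 5 * (t * x 1 ^ 4 * x 2)"
    by (simp add: power_mult_distrib eval_nat_numeral)
  then have "t * (c * x 1) ^ 4 * (c * x 2) = quintic (c * x 0) (c * x 2)"
    unfolding x(4) quintic_scale .
  then show ?thesis
    using x(1-3) assms(2) by (auto simp: curve_cone_def coords_def distrib_left)
qed

lemma curveE:
  assumes "P \<in> curve t"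
  obtains x where "x \<in> curve_cone t" "P = proj_point x"
  using assms unfolding curve_def by (elim imageE)

lemma proj_spaceI:
  assumes "x \<in> coords n" "\<exists>i. x i \<noteq> 0"
  shows "proj_point x \<in> proj_space n"
  unfolding proj_space_def by (rule CollectI) (intro exI[of _ x] conjI refl assms)

lemma curve_subset: "curve t \<subseteq> proj_space 3"
proof
  fix P assume "P \<in> curve t"
  then obtain x where x: "x \<in> curve_cone t" "P = proj_point x" by (rule curveE)
  show "P \<in> proj_space 3" unfolding x(2) by (rule proj_spaceI[OF curve_coneD(1,2)[OF x(1)]])
qed

lemma curve_rep:
  assumes "P \<in> curve t" "x \<in> P"
  shows "x \<in> curve_cone t"
proof -
  obtain y where y: "y \<in> curve_cone t" "P = proj_point y" using assms(1) by (rule curveE)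
  obtain c where c: "c \<noteq> 0" "x = (\<lambda>i. c * y i)" using assms(2) unfolding y(2) by (rule proj_pointE)
  show ?thesis unfolding c(2) by (rule curve_cone_scale[OF y(1) c(1)])
qed

lemma proj_point_curve: "x \<in> curve_cone t \<Longrightarrow> proj_point x \<in> curve t"
  unfolding curve_def by (rule imageI)

lemma Union_curve: "\<Union>(curve t) = curve_cone t"
proof (intro equalityI subsetI)
  fix x assume "x \<in> \<Union>(curve t)"
  then show "x \<in> curve_cone t" using curve_rep by (elim UnionE)
next
  fix x assume "x \<in> curve_cone t"
  then show "x \<in> \<Union>(curve t)" using UnionI[OF proj_point_curve proj_point_self] by simp
qed

lemma curve_cone_nonzero:
  assumes "x \<in> curve_cone t"
  shows "x 1 \<noteq> 0 \<or> x 2 \<noteq> 0"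
proof (rule ccontr)
  assume "\<not> ?thesis"
  then have 0: "x 1 = 0" "x 2 = 0" by auto
  note x = curve_coneD[OF assms]
  have "x 0 = 0" using x(4) 0 by simp
  moreover have "x 3 = 0" using x(3) 0 by simp
  ultimately show False using coords_3_zeroI[OF x(1)] 0 x(2) by blast
qed

lemma curve_cone_disjoint:
  assumes "x \<in> curve_cone t" "x \<in> curve_cone t'"
  shows "t = t'"
proof (cases "x 1 + x 2 = 0")
  case False
  then show ?thesis using curve_coneD(3)[OF assms(1)] curve_coneD(3)[OF assms(2)] by simp
next
  case True
  then have "x 1 = - x 2" by (simp add: eq_neg_iff_add_eq_0)
  then have "x 1 \<noteq> 0" "x 2 \<noteq> 0" using curve_cone_nonzero[OF assms(1)] by auto
  moreover have "t * x 1 ^ 4 * x 2 = t' * x 1 ^ 4 * x 2"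
    using curve_coneD(4)[OF assms(1)] curve_coneD(4)[OF assms(2)] by simp
  ultimately show ?thesis by simp
qed

section \<open>The forms that define the curves\<close>

lemma subring_setD:
  assumes "subring_set k"
  shows "0 \<in> k" "1 \<in> k" "a \<in> k \<Longrightarrow> - a \<in> k"
  using assms by (auto simp: subring_set_def)

definition quintic_form :: mpoly where
  "quintic_form = (mvar 0 ^ 2 + mvar 2 ^ 2) * (mvar 0 ^ 3 + mvar 0 * mvar 2 ^ 2 + mconst (- 1) * mvar 2 ^ 3)"

definition curve_form :: "complex \<Rightarrow> mpoly" where
  "curve_form t = mconst t * (mvar 1 ^ 4 * mvar 2) + mconst (- 1) * quintic_form"

definition plane_form :: "complex \<Rightarrow> mpoly" where
  "plane_form t = mvar 3 + mconst (- t) * (mvar 1 + mvar 2)"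

lemma eval_quintic_form [simp]: "mpoly_eval quintic_form x = quintic (x 0) (x 2)"
  by (simp add: quintic_form_def quintic_def)

lemma eval_curve_form [simp]:
  "mpoly_eval (curve_form t) x = t * x 1 ^ 4 * x 2 - quintic (x 0) (x 2)"
  by (simp add: curve_form_def)

lemma eval_plane_form [simp]: "mpoly_eval (plane_form t) x = x 3 - t * (x 1 + x 2)"
  by (simp add: plane_form_def)

lemma mvar_power_forms:
  assumes "subring_set k" "i \<le> n"
  shows "mvar i ^ j \<in> forms k n j"
  using power_forms[OF mvar_forms[OF subring_setD(2)[OF assms(1)] assms(2)] assms(1), of j] by simp

lemma mvar_forms':
  assumes "subring_set k" "i \<le> n"
  shows "mvar i \<in> forms k n 1"
  using mvar_power_forms[OF assms, of 1] by simp

lemma scale_forms: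
  assumes "subring_set k" "c \<in> k" "F \<in> forms k n d"
  shows "mconst c * F \<in> forms k n d"
  using mult_forms[OF mconst_forms[OF assms(2)] assms(3,1)] by simp

lemma quintic_form_forms:
  assumes "subring_set k"
  shows "quintic_form \<in> forms k 3 5"
proof -
  have sq: "mvar 0 ^ 2 + mvar 2 ^ 2 \<in> forms k 3 2"
    by (intro add_forms mvar_power_forms assms) auto
  have "mvar 0 * mvar 2 ^ 2 \<in> forms k 3 (1 + 2)"
    by (intro mult_forms mvar_power_forms mvar_forms' assms) auto
  moreover have "1 + 2 = (3 :: nat)" by simp
  ultimately have "mvar 0 * mvar 2 ^ 2 \<in> forms k 3 3" by (simp only:)
  then have "mvar 0 ^ 3 + mvar 0 * mvar 2 ^ 2 + mconst (- 1) * mvar 2 ^ 3 \<in> forms k 3 3"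
    by (intro add_forms mvar_power_forms scale_forms assms) (use subring_setD[OF assms] in auto)
  from mult_forms[OF sq this assms] show ?thesis by (simp add: quintic_form_def)
qed

lemma y4z_forms:
  assumes "subring_set k"
  shows "mvar 1 ^ 4 * mvar 2 \<in> forms k 3 5"
proof -
  have "mvar 1 ^ 4 * mvar 2 \<in> forms k 3 (4 + 1)"
    by (intro mult_forms mvar_power_forms mvar_forms' assms) auto
  then show ?thesis by simp
qed

lemma y_plus_z_forms:
  assumes "subring_set k"
  shows "mvar 1 + mvar 2 \<in> forms k 3 1"
  by (intro add_forms mvar_forms' assms) auto

lemma curve_form_forms:
  assumes "subring_set k" "t \<in> k"
  shows "curve_form t \<in> forms k 3 5"
  unfolding curve_form_def
  by (intro add_forms scale_forms y4z_forms quintic_form_forms assms) (use subring_setD[OF assms(1)] in auto)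

lemma plane_form_forms:
  assumes "subring_set k" "t \<in> k"
  shows "plane_form t \<in> forms k 3 1"
  unfolding plane_form_def
  by (intro add_forms scale_forms y_plus_z_forms mvar_forms' assms) (use subring_setD[OF assms(1)] assms in auto)

lemma vanishes_on_curve_equations:
  "vanishes_on (plane_form t) (curve t)" "vanishes_on (curve_form t) (curve t)"
  unfolding vanishes_on_def
  using curve_coneD(3,4)[OF curve_rep] by simp_all

lemma curve_eq_zero_locus:
  "curve t = {P \<in> proj_space 3. \<forall>F\<in>{plane_form t, curve_form t}. vanishes_on F {P}}"
proof (intro set_eqI iffI)
  fix P assume P: "P \<in> curve t"
  then show "P \<in> {P \<in> proj_space 3. \<forall>F\<in>{plane_form t, curve_form t}. vanishes_on F {P}}"
    using curve_subset vanishes_on_curve_equations[of t] by (auto simp: vanishes_on_def)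
next
  fix P assume "P \<in> {P \<in> proj_space 3. \<forall>F\<in>{plane_form t, curve_form t}. vanishes_on F {P}}"
  then have P: "P \<in> proj_space 3" "vanishes_on (plane_form t) {P}" "vanishes_on (curve_form t) {P}" by auto
  obtain x where x: "x \<in> coords 3" "\<exists>i. x i \<noteq> 0" "P = proj_point x" using P(1) by (elim proj_spaceE)
  then have "x \<in> P" by simp
  then have "x \<in> curve_cone t" using P(2,3) x by (simp add: curve_cone_def vanishes_on_def)
  then show "P \<in> curve t" using x by (simp add: curve_def)
qed

lemma zariski_closed_curve: "zariski_closed UNIV 3 (curve t)"
  unfolding curve_eq_zero_locus
  by (rule zariski_closed_forms) (use plane_form_forms[of UNIV t] curve_form_forms[of UNIV t] in auto)

lemma poly3_form: "poly3 (\<lambda>x y z. mpoly_eval F (pt x y z (t * (y + z))))"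
proof -
  have var: "poly3 (\<lambda>x y z. pt x y z (t * (y + z)) i)" for i
    unfolding pt_def by (cases "i = 0"; cases "i = 1"; cases "i = 2"; cases "i = 3") (auto intro!: poly3_intros)
  show ?thesis
    unfolding mpoly_eval_def by (intro poly3_sum poly3_scale poly3_prod poly3_power var)
qed

lemma form_affine_zero:
  assumes "F \<in> forms k 3 d" "z \<noteq> 0" "mpoly_eval F (pt (x / z) (y / z) 1 (t * (y / z + 1))) = 0"
  shows "mpoly_eval F (pt x y z (t * (y + z))) = 0"
proof -
  have "pt x y z (t * (y + z)) = (\<lambda>i. z * pt (x / z) (y / z) 1 (t * (y / z + 1)) i)"
  proof -
    have plane: "t * (y + z) = z * (t * (y / z + 1))" using assms(2) by (simp add: field_simps)
    show ?thesis unfolding pt_scale plane using assms(2) by simp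
  qed
  then show ?thesis using forms_homogeneous[OF assms(1)] assms(3) by simp
qed

lemma curve_affine:
  assumes "t * y ^ 4 * z = quintic x z" "z \<noteq> 0"
  shows "t * (y / z) ^ 4 = quintic (x / z) (1 :: complex)"
proof -
  have "quintic x z = z ^ 5 * quintic (x / z) 1"
    using quintic_scale[of z "x / z" 1] assms(2) by simp
  moreover have "t * y ^ 4 * z = z ^ 5 * (t * (y / z) ^ 4)"
    using assms(2) by (simp add: power_divide eval_nat_numeral)
  ultimately show ?thesis using assms by simp
qed

lemma form_vanishing_curve_multiple:
  assumes F: "F \<in> forms k 3 d" and t: "t \<noteq> 0"
    and van: "\<And>x y. quintic x 1 \<noteq> 0 \<Longrightarrow> t * y ^ 4 = quintic x 1 \<Longrightarrow>
      mpoly_eval F (pt x y 1 (t * (y + 1))) = 0"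
  shows "\<exists>h. poly3 h \<and>
    (\<forall>x y z. mpoly_eval F (pt x y z (t * (y + z))) = (t * y ^ 4 * z - quintic x z) * h x y z)"
proof (rule poly3_vanishing_multiple[OF poly3_form t])
  fix x y z :: complex
  assume z: "z \<noteq> 0" and q: "quintic x z \<noteq> 0" and eq: "t * y ^ 4 * z = quintic x z"
  have "quintic (x / z) 1 \<noteq> 0"
    using curve_affine[OF eq z] q eq t z by auto
  then show "mpoly_eval F (pt x y z (t * (y + z))) = 0"
    using form_affine_zero[OF F z] van curve_affine[OF eq z] by blast
qed

text \<open>The points with \<open>y = 0\<close> and the point at infinity come for free: on the
  plane of the curve, \<open>F\<close> is a multiple of the equation.\<close>

lemma vanishes_on_curveI:
  assumes F: "F \<in> forms k 3 d" and t: "t \<noteq> 0"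
    and van: "\<And>x y. quintic x 1 \<noteq> 0 \<Longrightarrow> t * y ^ 4 = quintic x 1 \<Longrightarrow>
      mpoly_eval F (pt x y 1 (t * (y + 1))) = 0"
  shows "vanishes_on F (curve t)"
  unfolding vanishes_on_def
proof (intro ballI)
  fix P x assume "P \<in> curve t" "x \<in> P"
  then have "x \<in> curve_cone t" by (rule curve_rep)
  note x = curve_coneD[OF this]
  obtain h where "\<forall>x y z. mpoly_eval F (pt x y z (t * (y + z))) = (t * y ^ 4 * z - quintic x z) * h x y z"
    using form_vanishing_curve_multiple[OF F t van] by blast
  then have "mpoly_eval F (pt (x 0) (x 1) (x 2) (t * (x 1 + x 2))) =
      (t * x 1 ^ 4 * x 2 - quintic (x 0) (x 2)) * h (x 0) (x 1) (x 2)" by blast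
  then show "mpoly_eval F x = 0" using x(4) unfolding x(5)[symmetric] by simp
qed

lemma affine_point_curve:
  "t * y ^ 4 = quintic x 1 \<Longrightarrow> proj_point (pt x y 1 (t * (y + 1))) \<in> curve t"
  by (rule proj_point_curve) (auto simp: curve_cone_def intro!: exI[of _ 2])

section \<open>Irreducibility of the curves\<close>

text \<open>The \<open>x\<close>-coordinate near the totally ramified point \<open>x = \<i>\<close>, \<open>y = 0\<close> as a function of the local
  parameter \<open>y\<close>.\<close>

lemma quintic_local_parameter:
  assumes t: "t \<noteq> 0"
  obtains \<delta> \<xi> where "\<delta> > 0" "\<xi> holomorphic_on ball 0 \<delta>"
    "\<And>s. s \<in> ball 0 \<delta> \<Longrightarrow> quintic (\<xi> s) 1 = t * s ^ 4"
    "\<And>s s'. s ^ 4 = s' ^ 4 \<Longrightarrow> \<xi> s = \<xi> s'"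
proof -
  define f where "f x = quintic x (1 :: complex)" for x
  have hol: "f holomorphic_on UNIV"
    unfolding f_def quintic_def by (intro holomorphic_intros)
  have root: "f \<i> = 0" by (simp add: f_def quintic_def)
  have "(f has_field_derivative quintic_dx \<i> 1) (at \<i>)"
    using quintic_has_derivative[of \<i> 1 1 0] DERIV_shift[of f _ 0 \<i>]
    by (simp add: f_def add.commute)
  then have "deriv f \<i> \<noteq> 0"
    using quintic_simple_root[of \<i> 1] root DERIV_imp_deriv by (fastforce simp: f_def)
  then obtain r where r: "r > 0" "open (f ` ball \<i> r)" "inj_on f (ball \<i> r)"
    using has_complex_derivative_locally_invertible[OF hol] by auto
  obtain g where g: "g holomorphic_on (f ` ball \<i> r)" "\<And>z. z \<in> ball \<i> r \<Longrightarrow> g (f z) = z"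
    using holomorphic_has_inverse[OF holomorphic_on_subset[OF hol subset_UNIV] open_ball r(3)] by metis
  have "0 \<in> f ` ball \<i> r" using root r(1) by (metis centre_in_ball imageI)
  then obtain \<epsilon> where \<epsilon>: "\<epsilon> > 0" "ball 0 \<epsilon> \<subseteq> f ` ball \<i> r"
    using r(2) openE by blast
  \<comment> \<open>For \<open>norm s < 1\<close> the fourth power only shrinks \<open>s\<close>, so
    \<open>norm t * norm s < \<epsilon>\<close> keeps \<open>t * s^4\<close> in the disc where the
    inverse \<open>g\<close> of \<open>f\<close> is available.\<close>
  define \<delta> where "\<delta> = min 1 (\<epsilon> / norm t)"
  have small: "t * s ^ 4 \<in> f ` ball \<i> r" if "s \<in> ball 0 \<delta>" for s
  proof -
    have s: "norm s < 1" "norm t * norm s < \<epsilon>" using that t by (auto simp: \<delta>_def field_simps)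
    have "norm s ^ 4 \<le> norm s ^ 1" using s by (intro power_decreasing) auto
    then have "norm t * norm s ^ 4 < \<epsilon>" using s(2) by (smt (verit) mult_left_mono norm_ge_zero power_one_right)
    then show ?thesis using \<epsilon>(2) by (auto simp: norm_mult norm_power)
  qed
  show ?thesis
  proof (rule that[of \<delta> "\<lambda>s. g (t * s ^ 4)"])
    show "\<delta> > 0" using \<epsilon>(1) t by (simp add: \<delta>_def)
    show "(\<lambda>s. g (t * s ^ 4)) holomorphic_on ball 0 \<delta>"
    proof -
      have "(g \<circ> (\<lambda>s. t * s ^ 4)) holomorphic_on ball 0 \<delta>"
      proof (rule holomorphic_on_compose_gen[OF _ g(1)])
        show "(\<lambda>s. t * s ^ 4) holomorphic_on ball 0 \<delta>" by (intro holomorphic_intros)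
        show "(\<lambda>s. t * s ^ 4) ` ball 0 \<delta> \<subseteq> f ` ball \<i> r" using small by blast
      qed
      then show ?thesis by (simp add: comp_def)
    qed
    show "quintic (g (t * s ^ 4)) 1 = t * s ^ 4" if "s \<in> ball 0 \<delta>" for s
      using small[OF that] g(2) by (auto simp: f_def)
  qed simp
qed

lemma poly3_holomorphic:
  assumes "poly3 g" "\<xi> holomorphic_on S"
  shows "(\<lambda>s. g (\<xi> s) s 1) holomorphic_on S"
  using assms(1) by induction (auto intro!: holomorphic_intros assms(2))

lemma holomorphic_mult_zero:
  assumes "f holomorphic_on S" "g holomorphic_on S" "open S" "connected S"
    "\<And>s. s \<in> S \<Longrightarrow> f s * g s = 0"
  shows "(\<forall>s\<in>S. f s = 0) \<or> (\<forall>s\<in>S. g s = 0)"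
proof (rule disjCI)
  assume "\<not> (\<forall>s\<in>S. g s = 0)"
  then obtain a where a: "a \<in> S" "g a \<noteq> 0" by auto
  have cont: "continuous_on S g" by (rule holomorphic_on_imp_continuous_on[OF assms(2)])
  define U where "U = S \<inter> g -` (- {0})"
  have U: "open U" unfolding U_def
    by (rule continuous_open_preimage[OF cont assms(3)]) auto
  have aU: "a \<in> U" "U \<subseteq> S" using a by (auto simp: U_def)
  have "f s = 0" if "s \<in> U" for s using assms(5)[of s] that by (auto simp: U_def)
  then show "\<forall>s\<in>S. f s = 0"
    using analytic_continuation_open[of U S f "\<lambda>_. 0"] U assms aU by auto
qed

text \<open>Along the branch with coordinates \<open>\<xi> s\<close>, \<open>s\<close>,
  \<open>1\<close>, parametrized by a disc, the identity theorem applies to the two factors. The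
  disc is stable under multiplication by fourth roots of unity and \<open>\<xi>\<close> depends on
  \<open>s^4\<close> alone, so the branch contains every point of the curve above the set
  \<open>U\<close>.\<close>

lemma curve_mult_zero:
  assumes g: "poly3 g" "poly3 h" and t: "t \<noteq> 0"
    and gh: "\<And>x y. t * y ^ 4 = quintic x 1 \<Longrightarrow> g x y 1 * h x y 1 = 0"
  shows "(\<forall>x y. t * y ^ 4 = quintic x 1 \<longrightarrow> g x y 1 = 0) \<or> (\<forall>x y. t * y ^ 4 = quintic x 1 \<longrightarrow> h x y 1 = 0)"
proof -
  obtain \<delta> \<xi> where \<delta>: "\<delta> > 0" and \<xi>: "\<xi> holomorphic_on ball 0 \<delta>"
    "\<And>s. s \<in> ball 0 \<delta> \<Longrightarrow> quintic (\<xi> s) 1 = t * s ^ 4" "\<And>s s'. s ^ 4 = s' ^ 4 \<Longrightarrow> \<xi> s = \<xi> s'"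
    using quintic_local_parameter[OF t] by blast
  define U where "U = \<xi> ` (ball 0 \<delta> - {0})"
  \<comment> \<open>On \<open>U\<close> the quintic already takes the values \<open>t * r^4\<close>
    for all real \<open>r\<close> between 0 and \<delta>.\<close>
  have U: "infinite U"
  proof
    assume "finite U"
    then have "finite ((\<lambda>x. quintic x 1) ` U)" by simp
    moreover have "(\<lambda>r. t * complex_of_real r ^ 4) ` {0<..<\<delta>} \<subseteq> (\<lambda>x. quintic x 1) ` U"
    proof (rule image_subsetI)
      fix r assume r: "r \<in> {0<..<\<delta>}"
      then have "complex_of_real r \<in> ball 0 \<delta> - {0}" by auto
      moreover from this have "t * complex_of_real r ^ 4 = quintic (\<xi> (complex_of_real r)) 1" using \<xi>(2) by simp
      ultimately show "t * complex_of_real r ^ 4 \<in> (\<lambda>x. quintic x 1) ` U" unfolding U_def by blast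
    qed
    ultimately have "finite ((\<lambda>r. t * complex_of_real r ^ 4) ` {0<..<\<delta>})" by (rule rev_finite_subset)
    moreover have "inj_on (\<lambda>r. t * complex_of_real r ^ 4) {0<..<\<delta>}"
    proof (rule inj_onI)
      fix r r' assume r: "r \<in> {0<..<\<delta>}" "r' \<in> {0<..<\<delta>}" "t * complex_of_real r ^ 4 = t * complex_of_real r' ^ 4"
      then have "complex_of_real (r ^ 4) = complex_of_real (r' ^ 4)" using t by simp
      then have "r ^ 4 = r' ^ 4" by (simp only: of_real_eq_iff)
      then show "r = r'" using r by (intro power_eq_imp_eq_base[of r 4 r']) auto
    qed
    ultimately have "finite {0<..<\<delta>}" by (rule finite_imageD)
    then show False using \<delta> infinite_Ioo by blast
  qed
  have extend: "\<forall>x y. t * y ^ 4 = quintic x 1 \<longrightarrow> p x y 1 = 0"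
    if p: "poly3 p" and zero: "\<forall>s\<in>ball 0 \<delta>. p (\<xi> s) s 1 = 0" for p
  proof (intro allI impI)
    fix x y assume xy: "t * y ^ 4 = quintic x 1"
    show "p x y 1 = 0"
    proof (rule poly3_vanishing_affine[OF p t U _ xy])
      fix x y assume "x \<in> U"
      then obtain s where s: "s \<in> ball 0 \<delta>" "s \<noteq> 0" "x = \<xi> s" unfolding U_def by blast
      have q: "quintic x 1 = t * s ^ 4" using \<xi>(2) s by simp
      have "p x y 1 = 0" if "t * y ^ 4 = quintic x 1"
      proof -
        have ys: "y ^ 4 = s ^ 4" using that q t by simp
        then have "norm y ^ 4 = norm s ^ 4" by (metis norm_power)
        then have "norm y = norm s" by (intro power_eq_imp_eq_base[of "norm y" 4]) auto
        then have "y \<in> ball 0 \<delta>" using s(1) by simp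
        from bspec[OF zero this] show ?thesis using \<xi>(3)[OF ys] s(3) by simp
      qed
      then show "quintic x 1 \<noteq> 0 \<and> (t * y ^ 4 = quintic x 1 \<longrightarrow> p x y 1 = 0)"
        using q s(2) t by simp
    qed
  qed
  have "(\<forall>s\<in>ball 0 \<delta>. g (\<xi> s) s 1 = 0) \<or> (\<forall>s\<in>ball 0 \<delta>. h (\<xi> s) s 1 = 0)"
  proof (rule holomorphic_mult_zero)
    show "g (\<xi> s) s 1 * h (\<xi> s) s 1 = 0" if "s \<in> ball 0 \<delta>" for s
      using gh[of s "\<xi> s"] \<xi>(2)[OF that] by simp
    show "(\<lambda>s. g (\<xi> s) s 1) holomorphic_on ball 0 \<delta>" by (rule poly3_holomorphic[OF g(1) \<xi>(1)])
    show "(\<lambda>s. h (\<xi> s) s 1) holomorphic_on ball 0 \<delta>" by (rule poly3_holomorphic[OF g(2) \<xi>(1)])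
  qed simp_all
  then show ?thesis
  proof
    assume "\<forall>s\<in>ball 0 \<delta>. g (\<xi> s) s 1 = 0"
    from extend[OF g(1) this] show ?thesis ..
  next
    assume "\<forall>s\<in>ball 0 \<delta>. h (\<xi> s) s 1 = 0"
    from extend[OF g(2) this] show ?thesis ..
  qed
qed

lemma zariski_irreducible_curve:
  assumes t: "t \<noteq> 0"
  shows "zariski_irreducible 3 (curve t)"
proof (rule zariski_irreducibleI)
  have "pt 0 1 0 t \<in> curve_cone t" by (auto simp: curve_cone_def intro!: exI[of _ 1])
  then show "curve t \<noteq> {}" by (auto simp: curve_def)
next
  fix F G d e
  assume F: "F \<in> forms UNIV 3 d" and G: "G \<in> forms UNIV 3 e" and FG: "vanishes_on (F * G) (curve t)"
  have "mpoly_eval F (pt x y 1 (t * (y + 1))) * mpoly_eval G (pt x y 1 (t * (y + 1))) = 0"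
    if "t * y ^ 4 = quintic x 1" for x y
    using FG affine_point_curve[OF that] proj_point_self unfolding vanishes_on_def mpoly_eval_mult by blast
  from curve_mult_zero[OF poly3_form poly3_form t this]
  show "vanishes_on F (curve t) \<or> vanishes_on G (curve t)"
    using vanishes_on_curveI[OF F t] vanishes_on_curveI[OF G t] by blast
qed (rule curve_subset)

section \<open>Tangent spaces of the curves\<close>

lemma dir_deriv_eqI:
  "((\<lambda>s. h (\<lambda>i. x i + s * v i)) has_field_derivative D) (at 0) \<Longrightarrow> dir_deriv h x v = D"
  unfolding dir_deriv_def by (rule DERIV_imp_deriv)

lemma dir_deriv_plane_form: "dir_deriv (mpoly_eval (plane_form t)) x v = v 3 - t * (v 1 + v 2)"
  by (rule dir_deriv_eqI) (auto intro!: derivative_eq_intros)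

lemma curve_equation_has_derivative:
  fixes x y z a b c t :: complex
  shows "((\<lambda>s. t * (y + s * b) ^ 4 * (z + s * c) - quintic (x + s * a) (z + s * c)) has_field_derivative
    t * (4 * y ^ 3 * z * b + y ^ 4 * c) - (quintic_dx x z * a + quintic_dz x z * c)) (at 0)"
  by (rule DERIV_diff[OF _ quintic_has_derivative]) 
    (auto intro!: derivative_eq_intros simp: algebra_simps)

lemma dir_deriv_curve_form:
  "dir_deriv (mpoly_eval (curve_form t)) x v =
    t * (4 * x 1 ^ 3 * x 2 * v 1 + x 1 ^ 4 * v 2) - (quintic_dx (x 0) (x 2) * v 0 + quintic_dz (x 0) (x 2) * v 2)"
  by (rule dir_deriv_eqI) (simp add: curve_equation_has_derivative)

definition curve_tangent :: "complex \<Rightarrow> vec \<Rightarrow> vec set" where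
  "curve_tangent t x = {v \<in> coords 3. v 3 = t * (v 1 + v 2) \<and>
    t * (4 * x 1 ^ 3 * x 2 * v 1 + x 1 ^ 4 * v 2) = quintic_dx (x 0) (x 2) * v 0 + quintic_dz (x 0) (x 2) * v 2}"

text \<open>The direction \<open>v\<close> keeps the line inside the plane, where \<open>F\<close>
  is the equation times a polynomial. At \<open>s = 0\<close> the equation vanishes because
  \<open>x\<close> is on the curve and its derivative because \<open>v\<close> is tangent, so the
  product rule gives 0.\<close>

lemma dir_deriv_zero_on_curve_tangent:
  assumes t: "t \<noteq> 0" and x: "x \<in> curve_cone t" and v: "v \<in> curve_tangent t x"
    and F: "F \<in> forms k 3 d" "vanishes_on F (curve t)"
  shows "dir_deriv (mpoly_eval F) x v = 0"
proof (rule dir_deriv_eqI)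
  note xD = curve_coneD[OF x]
  have vD: "v \<in> coords 3" "v 3 = t * (v 1 + v 2)"
    "t * (4 * x 1 ^ 3 * x 2 * v 1 + x 1 ^ 4 * v 2) = quintic_dx (x 0) (x 2) * v 0 + quintic_dz (x 0) (x 2) * v 2"
    using v by (auto simp: curve_tangent_def)
  have "mpoly_eval F (pt x y 1 (t * (y + 1))) = 0" if "t * y ^ 4 = quintic x 1" for x y
    using F(2) affine_point_curve[OF that] proj_point_self unfolding vanishes_on_def by blast
  then obtain h where h: "poly3 h"
    "\<forall>x y z. mpoly_eval F (pt x y z (t * (y + z))) = (t * y ^ 4 * z - quintic x z) * h x y z"
    using form_vanishing_curve_multiple[OF F(1) t] by blast
  obtain p where p: "\<forall>s. h (x 0 + s * v 0) (x 1 + s * v 1) (x 2 + s * v 2) = poly p s"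
    using poly3_line[OF h(1)] by blast
  have line: "mpoly_eval F (\<lambda>i. x i + s * v i) =
      (t * (x 1 + s * v 1) ^ 4 * (x 2 + s * v 2) - quintic (x 0 + s * v 0) (x 2 + s * v 2)) * poly p s" for s
  proof -
    have "x 3 + s * v 3 = t * ((x 1 + s * v 1) + (x 2 + s * v 2))"
      unfolding xD(3) vD(2) by (simp add: algebra_simps)
    then show ?thesis unfolding coords_3_line[OF xD(1) vD(1)] using h(2) p by simp
  qed
  show "((\<lambda>s. mpoly_eval F (\<lambda>i. x i + s * v i)) has_field_derivative 0) (at 0)"
    unfolding line
    by (rule DERIV_cong[OF DERIV_mult[OF curve_equation_has_derivative poly_DERIV]])
      (use vD(3) xD(4) in simp)
qed

lemma cone_tangent_curve:
  assumes "t \<noteq> 0" "x \<in> curve_cone t"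
  shows "cone_tangent 3 (curve t) x = curve_tangent t x"
proof (intro set_eqI iffI)
  fix v assume v: "v \<in> cone_tangent 3 (curve t) x"
  have "dir_deriv (mpoly_eval (plane_form t)) x v = 0" "dir_deriv (mpoly_eval (curve_form t)) x v = 0"
    using v plane_form_forms[of UNIV t] curve_form_forms[of UNIV t] vanishes_on_curve_equations[of t]
    by (auto simp: cone_tangent_def)
  then show "v \<in> curve_tangent t x"
    using v unfolding dir_deriv_plane_form dir_deriv_curve_form by (simp add: cone_tangent_def curve_tangent_def)
next
  fix v assume v: "v \<in> curve_tangent t x"
  then show "v \<in> cone_tangent 3 (curve t) x"
    using dir_deriv_zero_on_curve_tangent[OF assms v]
    by (auto simp: cone_tangent_def curve_tangent_def)
qed

text \<open>The coordinates \<open>p\<close> and \<open>q\<close>, at which the two generators form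
  a unit matrix, yield their independence.\<close>

lemma edim_eq_2:
  assumes V: "V = {(\<lambda>i. a * u i + b * w i) | a b. True}"
    and uw: "u p = 1" "u q = 0" "w p = 0" "w q = (1 :: complex)"
  shows "edim V = enat 2"
proof -
  have ne: "u \<noteq> w" using uw by auto
  have indep: "fun_space.independent {u, w}"
  proof (rule fun_space.independent_if_scalars_zero)
    fix f v assume sum: "(\<Sum>x\<in>{u, w}. (\<lambda>y. f x * x y)) = 0" and v: "v \<in> {u, w}"
    have "f u * u i + f w * w i = 0" for i using fun_cong[OF sum, of i] ne by simp
    from this[of p] this[of q] show "f v = 0" using v uw by auto
  qed simp
  have span: "V \<subseteq> fun_space.span {u, w}"
  proof
    fix v assume "v \<in> V"
    then obtain a b where v: "v = (\<lambda>i. a * u i + b * w i)" using V by auto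
    have "(\<lambda>i. a * u i) + (\<lambda>i. b * w i) \<in> fun_space.span {u, w}"
      by (intro fun_space.span_add fun_space.span_scale fun_space.span_base) auto
    then show "v \<in> fun_space.span {u, w}" unfolding v by (simp add: plus_fun_def)
  qed
  have uV: "{u, w} \<subseteq> V"
  proof -
    have "u = (\<lambda>i. 1 * u i + 0 * w i)" "w = (\<lambda>i. 0 * u i + 1 * w i)" by auto
    then show ?thesis using V by blast
  qed
  show ?thesis
    unfolding edim_def
  proof (rule antisym)
    show "(SUP B\<in>{B. finite B \<and> B \<subseteq> V \<and> fun_space.independent B}. enat (card B)) \<le> enat 2"
    proof (rule SUP_least)
      fix B assume "B \<in> {B. finite B \<and> B \<subseteq> V \<and> fun_space.independent B}"
      then have "card B \<le> card {u, w}"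
        using fun_space.independent_span_bound[of "{u, w}" B] span by auto
      then show "enat (card B) \<le> enat 2" using ne by simp
    qed
    have "enat (card {u, w}) \<le> (SUP B\<in>{B. finite B \<and> B \<subseteq> V \<and> fun_space.independent B}. enat (card B))"
      by (rule SUP_upper) (use uV indep in auto)
    then show "enat 2 \<le> (SUP B\<in>{B. finite B \<and> B \<subseteq> V \<and> fun_space.independent B}. enat (card B))"
      using ne by (simp add: numeral_2_eq_2)
  qed
qed

text \<open>Inside the plane the tangent space is the kernel of the gradient. Whichever of its three
  entries is nonzero, the equation is solved for that coordinate and the other two remain
  free.\<close>

lemma edim_curve_tangent:
  assumes t: "t \<noteq> 0" and x: "x \<in> curve_cone t"
  shows "edim (curve_tangent t x) = enat 2"
proof -
  define \<alpha> \<beta> \<gamma> where "\<alpha> = quintic_dx (x 0) (x 2)" and "\<beta> = 4 * t * x 1 ^ 3 * x 2"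
    and "\<gamma> = t * x 1 ^ 4 - quintic_dz (x 0) (x 2)"
  have tangent: "curve_tangent t x = {v \<in> coords 3. v 3 = t * (v 1 + v 2) \<and> \<beta> * v 1 + \<gamma> * v 2 = \<alpha> * v 0}"
    unfolding curve_tangent_def \<alpha>_def \<beta>_def \<gamma>_def by (simp add: algebra_simps)
  \<comment> \<open>The Jacobian criterion. Where \<open>z = 0\<close>, \<open>y\<close> is nonzero
    and \<gamma> is \<open>t * y^4\<close>; where \<open>z\<close> is nonzero, either
    \<open>y\<close> is nonzero and so is \<beta>, or \<open>y = 0\<close> and \<alpha> is nonzero
    because the roots of the quintic are simple.\<close>
  have cases: "\<alpha> \<noteq> 0 \<or> \<beta> \<noteq> 0 \<or> \<gamma> \<noteq> 0"
  proof (cases "x 2 = 0")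
    case True
    then have "x 1 \<noteq> 0" using curve_cone_nonzero[OF x] by simp
    then show ?thesis using True t by (simp add: \<gamma>_def quintic_dz_def)
  next
    case False
    then show ?thesis
      using quintic_simple_root[of "x 0" "x 2"] curve_coneD(4)[OF x] t
      by (cases "x 1 = 0") (auto simp: \<alpha>_def \<beta>_def)
  qed
  have pt_eqI: "v = (\<lambda>i. a * u i + b * w i)"
    if "v \<in> coords 3" "u \<in> coords 3" "w \<in> coords 3" "v 0 = a * u 0 + b * w 0" "v 1 = a * u 1 + b * w 1"
      "v 2 = a * u 2 + b * w 2" "v 3 = t * (v 1 + v 2)" "u 3 = t * (u 1 + u 2)" "w 3 = t * (w 1 + w 2)" for a b and u v w :: vec
  proof -
    have "(\<lambda>i. a * u i + b * w i) \<in> coords 3" using that by (auto simp: coords_def)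
    then have "(\<lambda>i. a * u i + b * w i) = pt (a * u 0 + b * w 0) (a * u 1 + b * w 1) (a * u 2 + b * w 2) (a * u 3 + b * w 3)"
      by (rule coords_3_eq)
    moreover have "v 3 = a * u 3 + b * w 3" unfolding that(4-) by (simp add: algebra_simps)
    ultimately show ?thesis using coords_3_eq[OF that(1)] that(4-6) by simp
  qed
  have comb: "(\<lambda>i. a * pt x0 x1 x2 x3 i + b * pt y0 y1 y2 y3 i) \<in> coords 3" for a b x0 x1 x2 x3 y0 y1 y2 y3
    by (auto simp: coords_def pt_def)
  consider "\<alpha> \<noteq> 0" | "\<beta> \<noteq> 0" | "\<gamma> \<noteq> 0" using cases by blast
  then show ?thesis
  proof cases
    case 1
    have "curve_tangent t x =
        {(\<lambda>i. a * pt (\<beta> / \<alpha>) 1 0 t i + b * pt (\<gamma> / \<alpha>) 0 1 t i) | a b. True}" (is "_ = ?V")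
    proof (intro set_eqI iffI)
      fix v assume "v \<in> curve_tangent t x"
      then have v: "v \<in> coords 3" "v 3 = t * (v 1 + v 2)" "\<beta> * v 1 + \<gamma> * v 2 = \<alpha> * v 0" by (auto simp: tangent)
      have v0: "v 0 = (\<beta> * v 1 + \<gamma> * v 2) / \<alpha>" using v(3) 1 by (simp add: field_simps)
      have "v = (\<lambda>i. v 1 * pt (\<beta> / \<alpha>) 1 0 t i + v 2 * pt (\<gamma> / \<alpha>) 0 1 t i)"
        by (rule pt_eqI[OF v(1) _ _ _ _ _ v(2)]) (use v(1) v0 1 in \<open>simp_all add: field_simps\<close>)
      then show "v \<in> ?V" by blast
    next
      fix v assume "v \<in> ?V"
      then show "v \<in> curve_tangent t x" using 1 comb by (auto simp: tangent field_simps)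
    qed
    then show ?thesis by (rule edim_eq_2[where p = 1 and q = 2]) simp_all
  next
    case 2
    have "curve_tangent t x =
        {(\<lambda>i. a * pt 1 (\<alpha> / \<beta>) 0 (t * (\<alpha> / \<beta>)) i + b * pt 0 (- \<gamma> / \<beta>) 1 (t * (1 - \<gamma> / \<beta>)) i) | a b. True}" (is "_ = ?V")
    proof (intro set_eqI iffI)
      fix v assume "v \<in> curve_tangent t x"
      then have v: "v \<in> coords 3" "v 3 = t * (v 1 + v 2)" "\<beta> * v 1 + \<gamma> * v 2 = \<alpha> * v 0" by (auto simp: tangent)
      have v1: "v 1 = (\<alpha> * v 0 - \<gamma> * v 2) / \<beta>" using v(3) 2 by (simp add: field_simps)
      have "v = (\<lambda>i. v 0 * pt 1 (\<alpha> / \<beta>) 0 (t * (\<alpha> / \<beta>)) i + v 2 * pt 0 (- \<gamma> / \<beta>) 1 (t * (1 - \<gamma> / \<beta>)) i)"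
        by (rule pt_eqI[OF v(1) _ _ _ _ _ v(2)]) (use v(1) v1 2 in \<open>simp_all add: field_simps\<close>)
      then show "v \<in> ?V" by blast
    next
      fix v assume "v \<in> ?V"
      then show "v \<in> curve_tangent t x" using 2 comb by (auto simp: tangent field_simps)
    qed
    then show ?thesis by (rule edim_eq_2[where p = 0 and q = 2]) simp_all
  next
    case 3
    have "curve_tangent t x =
        {(\<lambda>i. a * pt 1 0 (\<alpha> / \<gamma>) (t * (\<alpha> / \<gamma>)) i + b * pt 0 1 (- \<beta> / \<gamma>) (t * (1 - \<beta> / \<gamma>)) i) | a b. True}" (is "_ = ?V")
    proof (intro set_eqI iffI)
      fix v assume "v \<in> curve_tangent t x"
      then have v: "v \<in> coords 3" "v 3 = t * (v 1 + v 2)" "\<beta> * v 1 + \<gamma> * v 2 = \<alpha> * v 0" by (auto simp: tangent)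
      have v2: "v 2 = (\<alpha> * v 0 - \<beta> * v 1) / \<gamma>" using v(3) 3 by (simp add: field_simps)
      have "v = (\<lambda>i. v 0 * pt 1 0 (\<alpha> / \<gamma>) (t * (\<alpha> / \<gamma>)) i + v 1 * pt 0 1 (- \<beta> / \<gamma>) (t * (1 - \<beta> / \<gamma>)) i)"
        by (rule pt_eqI[OF v(1) _ _ _ _ _ v(2)]) (use v(1) v2 3 in \<open>simp_all add: field_simps\<close>)
      then show "v \<in> ?V" by blast
    next
      fix v assume "v \<in> ?V"
      then show "v \<in> curve_tangent t x" using 3 comb by (auto simp: tangent field_simps)
    qed
    then show ?thesis by (rule edim_eq_2[where p = 0 and q = 1]) simp_all
  qed
qed

section \<open>The surface\<close>

text \<open>The parameter 0 is left out because there the equation degenerates to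
  \<open>quintic x z = 0\<close>, a union of five lines.\<close>

definition surface :: "point set" where
  "surface = (\<Union>t\<in>-{0}. curve t)"

lemma surfaceE:
  assumes "P \<in> surface"
  obtains t where "t \<noteq> 0" "P \<in> curve t"
  using assms unfolding surface_def by blast

lemma curve_subset_surface: "t \<noteq> 0 \<Longrightarrow> curve t \<subseteq> surface"
  unfolding surface_def by blast

lemma surface_subset: "surface \<subseteq> proj_space 3"
  unfolding surface_def using curve_subset by blast

lemma curve_disjoint:
  assumes "P \<in> curve t" "P \<in> curve t'"
  shows "t = t'"
proof -
  obtain x where "x \<in> curve_cone t" "P = proj_point x" using assms(1) by (rule curveE)
  then show ?thesis using curve_cone_disjoint curve_rep[OF assms(2)] by simp
qed

lemma vanishes_on_surfaceI:
  assumes "\<And>t. t \<noteq> 0 \<Longrightarrow> vanishes_on F (curve t)"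
  shows "vanishes_on F surface"
  using assms unfolding vanishes_on_def surface_def by blast

text \<open>Elimination of \<open>t\<close> from the two equations of \<open>curve t\<close>:
  \<open>w * y^4 * z = (y + z) * f\<close>.\<close>

definition surface_form :: mpoly where
  "surface_form = mvar 3 * (mvar 1 ^ 4 * mvar 2) + mconst (- 1) * ((mvar 1 + mvar 2) * quintic_form)"

lemma eval_surface_form [simp]:
  "mpoly_eval surface_form x = x 3 * (x 1 ^ 4 * x 2) - (x 1 + x 2) * quintic (x 0) (x 2)"
  by (simp add: surface_form_def)

lemma surface_form_forms:
  assumes "subring_set k"
  shows "surface_form \<in> forms k 3 (1 + 5)"
  unfolding surface_form_def
  by (intro add_forms scale_forms mult_forms y4z_forms y_plus_z_forms mvar_forms' quintic_form_forms assms)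
    (use subring_setD[OF assms] in auto)

lemma surface_form_zero:
  assumes "x \<in> curve_cone t"
  shows "mpoly_eval surface_form x = 0"
  using curve_coneD(3,4)[OF assms] by (simp flip: curve_coneD(4)[OF assms])

text \<open>The parameter is \<open>w / (y + z)\<close>, or \<open>f / (y^4 * z)\<close> where
  \<open>y + z = 0\<close>. The hypothesis \<open>yz\<close> makes one of the denominators nonzero,
  and \<open>wq\<close> keeps \<open>t\<close> away from 0.\<close>

lemma ex_curve_cone:
  assumes x: "x \<in> coords 3" "\<exists>i. x i \<noteq> 0" and zero: "mpoly_eval surface_form x = 0"
    and yz: "x 1 \<noteq> 0 \<or> x 2 \<noteq> 0" and wq: "x 3 \<noteq> 0 \<or> quintic (x 0) (x 2) \<noteq> 0"
  shows "\<exists>t. t \<noteq> 0 \<and> x \<in> curve_cone t"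
proof (cases "x 1 + x 2 = 0")
  case False
  define t where "t = x 3 / (x 1 + x 2)"
  have w: "x 3 = t * (x 1 + x 2)" using False by (simp add: t_def)
  have "(x 1 + x 2) * (t * x 1 ^ 4 * x 2 - quintic (x 0) (x 2)) = 0"
    using zero unfolding eval_surface_form w by (simp add: algebra_simps)
  then have q: "t * x 1 ^ 4 * x 2 = quintic (x 0) (x 2)" using False by simp
  have "t \<noteq> 0" using w q wq by auto
  then show ?thesis using x w q by (auto simp: curve_cone_def)
next
  case True
  then have 12: "x 2 = - x 1" by (simp add: add_eq_0_iff)
  then have y: "x 1 \<noteq> 0" using yz by auto
  then have nz: "x 1 ^ 4 * x 2 \<noteq> 0" using 12 by simp
  have w: "x 3 = 0" using zero True nz unfolding eval_surface_form by simp
  define t where "t = quintic (x 0) (x 2) / (x 1 ^ 4 * x 2)"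
  have "t * x 1 ^ 4 * x 2 = quintic (x 0) (x 2)" using nz by (simp add: t_def)
  moreover have "x 3 = t * (x 1 + x 2)" using w True by simp
  moreover have "t \<noteq> 0" using wq w nz by (simp add: t_def)
  ultimately show ?thesis using x by (auto simp: curve_cone_def)
qed

text \<open>Products of \<open>w\<close>, \<open>f\<close> with \<open>y\<close>, \<open>z\<close>:
  the common zeros are the union of \<open>w = f = 0\<close>, the place of the omitted fibre over 0,
  and \<open>y = z = 0\<close>, where both denominators of \<open>t\<close> vanish.\<close>

definition boundary_forms :: "mpoly set" where
  "boundary_forms = {mvar 3 * mvar 1, mvar 3 * mvar 2, quintic_form * mvar 1, quintic_form * mvar 2}"

lemma boundary_forms_forms: "subring_set k \<Longrightarrow> boundary_forms \<subseteq> (\<Union>d. forms k 3 d)"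
proof -
  assume k: "subring_set k"
  have "mvar 3 * mvar 1 \<in> forms k 3 (1 + 1)" "mvar 3 * mvar 2 \<in> forms k 3 (1 + 1)"
    "quintic_form * mvar 1 \<in> forms k 3 (5 + 1)" "quintic_form * mvar 2 \<in> forms k 3 (5 + 1)"
    by (intro mult_forms mvar_forms' quintic_form_forms k; simp)+
  then show ?thesis unfolding boundary_forms_def by blast
qed

lemma surface_eq:
  "surface = {P \<in> proj_space 3. \<forall>F\<in>{surface_form}. vanishes_on F {P}} -
    {P \<in> proj_space 3. \<forall>F\<in>boundary_forms. vanishes_on F {P}}" (is "_ = ?Z - ?W")
proof (intro equalityI subsetI)
  fix P assume P: "P \<in> surface"
  then obtain t where t: "t \<noteq> 0" "P \<in> curve t" by (rule surfaceE)
  obtain x where x: "x \<in> curve_cone t" "P = proj_point x" using t(2) by (rule curveE)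
  have "vanishes_on surface_form {P}"
    using surface_form_zero[OF curve_rep[OF t(2)]] unfolding vanishes_on_def by simp
  moreover have "P \<in> proj_space 3" using P surface_subset by auto
  moreover have "P \<notin> ?W"
  proof
    assume "P \<in> ?W"
    then have 0: "mpoly_eval F x = 0" if "F \<in> boundary_forms" for F
      using that x(2) unfolding vanishes_on_def by auto
    have "x 3 * x 1 = 0" "x 3 * x 2 = 0" "quintic (x 0) (x 2) * x 1 = 0" "quintic (x 0) (x 2) * x 2 = 0"
      using 0[of "mvar 3 * mvar 1"] 0[of "mvar 3 * mvar 2"] 0[of "quintic_form * mvar 1"]
        0[of "quintic_form * mvar 2"] by (simp_all add: boundary_forms_def)
    then have "x 3 = 0" "quintic (x 0) (x 2) = 0" using curve_cone_nonzero[OF x(1)] by auto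
    then have "x 1 + x 2 = 0" "x 1 ^ 4 * x 2 = 0"
      using curve_coneD(3,4)[OF x(1)] t(1) by simp_all
    then show False using curve_cone_nonzero[OF x(1)] by auto
  qed
  ultimately show "P \<in> ?Z - ?W" by simp
next
  fix P assume "P \<in> ?Z - ?W"
  then have P: "P \<in> proj_space 3" "vanishes_on surface_form {P}" "\<exists>F\<in>boundary_forms. \<not> vanishes_on F {P}" by auto
  obtain x where x: "x \<in> coords 3" "\<exists>i. x i \<noteq> 0" "P = proj_point x" using P(1) by (rule proj_spaceE)
  obtain F where F: "F \<in> boundary_forms" "\<not> vanishes_on F {P}" using P(3) by blast
  obtain d where "F \<in> forms UNIV 3 d" using F(1) boundary_forms_forms[of UNIV] by auto
  then have "mpoly_eval F x \<noteq> 0" using F(2) vanishes_on_proj_point x(3) by simp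
  then have "x 1 \<noteq> 0 \<or> x 2 \<noteq> 0" "x 3 \<noteq> 0 \<or> quintic (x 0) (x 2) \<noteq> 0"
    using F(1) by (auto simp: boundary_forms_def)
  moreover have "mpoly_eval surface_form x = 0"
    using P(2) vanishes_on_proj_point[OF surface_form_forms[of UNIV]] x(3) by simp
  ultimately obtain t where "t \<noteq> 0" "x \<in> curve_cone t" using ex_curve_cone[OF x(1,2)] by blast
  then show "P \<in> surface" using curve_subset_surface proj_point_curve x(3) by blast
qed

lemma quasi_projective_surface: "subring_set k \<Longrightarrow> quasi_projective k 3 surface"
  unfolding quasi_projective_def surface_eq
  using zariski_closed_forms[of "{surface_form}" k 3] zariski_closed_forms[OF boundary_forms_forms, of k]
    surface_form_forms[of k] by blast

section \<open>Rational parametrization of the surface\<close>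

text \<open>The affine point \<open>(x, y, 1, t * (y + 1))\<close> with
  \<open>t = quintic x 1 / y^4\<close>, multiplied by \<open>y^4\<close> to become polynomial. It
  reaches all points of the surface with \<open>y\<close> and \<open>z\<close> nonzero.\<close>

definition param :: "complex \<times> complex \<Rightarrow> vec" where
  "param p = pt (fst p * snd p ^ 4) (snd p ^ 5) (snd p ^ 4) ((snd p + 1) * quintic (fst p) 1)"

lemma param_scale:
  assumes "t * y ^ 4 = quintic x 1"
  shows "param (x, y) = (\<lambda>i. y ^ 4 * pt x y 1 (t * (y + 1)) i)"
  unfolding param_def pt_scale fst_conv snd_conv assms[symmetric]
  by (simp add: algebra_simps eval_nat_numeral)

lemma param_curve_cone:
  assumes "y \<noteq> 0"
  shows "param (x, y) \<in> curve_cone (quintic x 1 / y ^ 4)"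
proof -
  have t: "quintic x 1 / y ^ 4 * y ^ 4 = quintic x 1" using assms by simp
  have "pt x y 1 (quintic x 1 / y ^ 4 * (y + 1)) \<in> curve_cone (quintic x 1 / y ^ 4)"
    using t by (auto simp: curve_cone_def intro!: exI[of _ 2])
  then show ?thesis unfolding param_scale[OF t] by (rule curve_cone_scale) (use assms in simp)
qed

lemma param_polys2: "(\<lambda>p. param p i) \<in> polys2 6"
proof -
  have q: "(\<lambda>p. quintic (fst p) 1) \<in> polys2 5"
  proof -
    have "(\<lambda>p. fst p ^ 5 * snd p ^ 0 + 2 * (fst p ^ 3 * snd p ^ 0) + (- 1) * (fst p ^ 2 * snd p ^ 0) +
        fst p ^ 1 * snd p ^ 0 + (- 1) * (fst p ^ 0 * snd p ^ 0)) \<in> polys2 5"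
      by (intro add_polys2 scale_polys2 monomial_polys2) simp_all
    then show ?thesis by (simp add: quintic_expand)
  qed
  have y1: "(\<lambda>p. snd p + 1) \<in> polys2 1"
  proof -
    have "(\<lambda>p. fst p ^ 0 * snd p ^ 1 + fst p ^ 0 * snd p ^ 0) \<in> polys2 1"
      by (intro add_polys2 monomial_polys2) simp_all
    then show ?thesis by simp
  qed
  have w: "(\<lambda>p. (snd p + 1) * quintic (fst p) 1) \<in> polys2 6"
    using mult_polys2[OF y1 q] by simp
  have "(\<lambda>p. fst p ^ 1 * snd p ^ 4) \<in> polys2 6" "(\<lambda>p. fst p ^ 0 * snd p ^ 5) \<in> polys2 6"
    "(\<lambda>p. fst p ^ 0 * snd p ^ 4) \<in> polys2 6"
    by (intro monomial_polys2; simp)+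
  then show ?thesis
    using w zero_polys2[of 6] unfolding param_def pt_def
    by (cases "i = 0"; cases "i = 1"; cases "i = 2"; cases "i = 3") simp_all
qed

lemma form_param_polys2: "F \<in> forms k 3 d \<Longrightarrow> (\<lambda>p. mpoly_eval F (param p)) \<in> polys2 (6 * d)"
  by (rule form_comp_polys2) (auto intro: param_polys2)

lemma vanishes_on_surface_param:
  assumes F: "F \<in> forms k 3 d" and zero: "\<And>x y. mpoly_eval F (param (x, y)) = 0"
  shows "vanishes_on F surface"
proof (rule vanishes_on_surfaceI)
  fix t :: complex assume t: "t \<noteq> 0"
  show "vanishes_on F (curve t)"
  proof (rule vanishes_on_curveI[OF F t])
    fix x y assume xy: "quintic x 1 \<noteq> 0" "t * y ^ 4 = quintic x 1"
    have "(y ^ 4) ^ d * mpoly_eval F (pt x y 1 (t * (y + 1))) = 0"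
      using zero[of x y] unfolding param_scale[OF xy(2)] forms_homogeneous[OF F] .
    then show "mpoly_eval F (pt x y 1 (t * (y + 1))) = 0" using xy by auto
  qed
qed

lemma vanishes_on_surface_dense:
  assumes F: "F \<in> forms k 3 d" and UV: "infinite U" "infinite V"
    and zero: "\<And>x y. x \<in> U \<Longrightarrow> y \<in> V \<Longrightarrow> mpoly_eval F (param (x, y)) = 0"
  shows "vanishes_on F surface"
  by (rule vanishes_on_surface_param[OF F polys2_zero[OF form_param_polys2[OF F] UV zero]])

lemma infinite_quintic_nonzero: "infinite {x :: complex. quintic x 1 \<noteq> 0}"
proof -
  have "{x :: complex. quintic x 1 \<noteq> 0} = UNIV - {x. quintic x 1 = 0}" by auto
  then show ?thesis using Diff_infinite_finite[OF finite_quintic_roots infinite_UNIV_char_0] by simp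
qed

lemma infinite_nonzero: "infinite (- {0 :: complex})"
  by (simp add: infinite_UNIV_char_0 Compl_eq_Diff_UNIV)

lemma param_surface:
  assumes "y \<noteq> 0" "quintic x 1 \<noteq> 0"
  shows "proj_point (param (x, y)) \<in> surface"
proof -
  have "quintic x 1 / y ^ 4 \<noteq> 0" using assms by simp
  from curve_subset_surface[OF this] proj_point_curve[OF param_curve_cone[OF assms(1), of x]]
  show ?thesis by blast
qed

text \<open>The pullback along \<open>param\<close> lands in polynomials in two variables, an
  integral domain. The parameters with \<open>y\<close> and the quintic nonzero give points of the
  surface and still fill an infinite grid.\<close>

lemma zariski_irreducible_surface: "zariski_irreducible 3 surface"
proof (rule zariski_irreducibleI[OF _ surface_subset])
  show "surface \<noteq> {}"
    using curve_subset_surface[of 1] zariski_irreducible_curve[of 1] by (auto simp: zariski_irreducible_def)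
next
  fix F G d e
  assume F: "F \<in> forms UNIV 3 d" and G: "G \<in> forms UNIV 3 e" and FG: "vanishes_on (F * G) surface"
  have "mpoly_eval F (param (x, y)) * mpoly_eval G (param (x, y)) = 0"
    if "x \<in> {x. quintic x 1 \<noteq> 0}" "y \<in> - {0}" for x y
    using FG param_surface[of y x] that proj_point_self[of "param (x, y)"]
    unfolding vanishes_on_def mpoly_eval_mult by blast
  from polys2_mult_zero[OF form_param_polys2[OF F] form_param_polys2[OF G]
      infinite_quintic_nonzero infinite_nonzero this]
  show "vanishes_on F surface \<or> vanishes_on G surface"
    using vanishes_on_surface_param[OF F] vanishes_on_surface_param[OF G] by auto
qed

lemma no_chain_surface: "\<not> has_chain 3 surface 3"
proof (rule no_chain_of_length_3[OF surface_subset param_polys2])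
  fix F d assume "F \<in> forms UNIV 3 d" and "\<And>p. mpoly_eval F (param p) = 0"
  then show "vanishes_on F surface" by (rule vanishes_on_surface_param)
qed

section \<open>Dimensions\<close>

lemma infinity_curve_cone: "pt 0 1 0 t \<in> curve_cone t"
  by (auto simp: curve_cone_def intro!: exI[of _ 1])

lemma curve_point_at_infinity:
  assumes "P \<in> curve t" "x \<in> P" "x 2 = 0"
  shows "P = proj_point (pt 0 1 0 t)"
proof -
  have xc: "x \<in> curve_cone t" using assms(1,2) by (rule curve_rep)
  note x = curve_coneD[OF xc]
  have "x 0 = 0" using x(4) assms(3) by simp
  then have "x = (\<lambda>i. x 1 * pt 0 1 0 t i)"
    using x(5) assms(3) unfolding pt_scale by (simp add: mult.commute)
  moreover have "x 1 \<noteq> 0" using curve_cone_nonzero[OF xc] assms(3) by simp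
  ultimately have "proj_point x = proj_point (pt 0 1 0 t)" using proj_point_scale by metis
  moreover have "P = proj_point x"
    using proj_space_rep(1)[of P 3 x] assms(1,2) curve_subset by blast
  ultimately show ?thesis by simp
qed

lemma curve_not_singleton: "\<exists>P\<in>curve t. P \<noteq> proj_point (pt 0 1 0 t)"
proof -
  \<comment> \<open>Since \<open>\<i>^2 + 1 = 0\<close>, both sides of the quintic equation are 0 at
    this point, for every \<open>t\<close>.\<close>
  have "pt \<i> 0 1 t \<in> curve_cone t"
    by (auto simp: curve_cone_def quintic_def intro!: exI[of _ 2])
  moreover have "proj_point (pt \<i> 0 1 t) \<noteq> proj_point (pt 0 1 0 t)"
  proof
    assume "proj_point (pt \<i> 0 1 t) = proj_point (pt 0 1 0 t)"
    then have "pt \<i> 0 1 t \<in> proj_point (pt 0 1 0 t)" using proj_point_self by metis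
    then obtain c where "pt \<i> 0 1 t = (\<lambda>i. c * pt 0 1 0 t i)" by (rule proj_pointE)
    from fun_cong[OF this, of 2] show False by simp
  qed
  ultimately show ?thesis using proj_point_curve by blast
qed

lemma singleton_curve_eq:
  "{proj_point (pt 0 1 0 t)} = curve t \<inter> {P \<in> proj_space 3. vanishes_on (mvar 2) {P}}"
proof (intro equalityI subsetI)
  fix P assume "P \<in> {proj_point (pt 0 1 0 t)}"
  then have P: "P = proj_point (pt 0 1 0 t)" by simp
  have "vanishes_on (mvar 2) {P}"
    unfolding P vanishes_on_proj_point[OF mvar_forms'[OF subring_set_UNIV, of 2 3, simplified]] by simp
  then show "P \<in> curve t \<inter> {P \<in> proj_space 3. vanishes_on (mvar 2) {P}}"
    using proj_point_curve[OF infinity_curve_cone] curve_subset P by blast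
next
  fix P assume P: "P \<in> curve t \<inter> {P \<in> proj_space 3. vanishes_on (mvar 2) {P}}"
  then obtain x where "P = proj_point x" by (auto elim: curveE)
  then have "x \<in> P" by simp
  moreover from this have "x 2 = 0" using P unfolding vanishes_on_def by simp
  ultimately show "P \<in> {proj_point (pt 0 1 0 t)}" using curve_point_at_infinity P by blast
qed

lemma closed_z: "zariski_closed UNIV 3 {P \<in> proj_space 3. vanishes_on (mvar 2) {P}}"
  by (rule zariski_closed_vanishing[OF mvar_forms'[OF subring_set_UNIV]]) simp

lemma curve_neq_surface: "curve t \<noteq> surface"
proof
  assume eq: "curve t = surface"
  define t' where "t' = (if t = 1 then 2 else 1 :: complex)"
  have "t' \<noteq> 0" "t' \<noteq> t" by (auto simp: t'_def)
  moreover have "proj_point (pt 0 1 0 t') \<in> curve t'" by (rule proj_point_curve[OF infinity_curve_cone])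
  ultimately show False using eq curve_subset_surface curve_disjoint by blast
qed

lemma curve_eq_Int: "t \<noteq> 0 \<Longrightarrow> curve t = surface \<inter> curve t"
  using curve_subset_surface by blast

lemma has_chain_curve:
  assumes t: "t \<noteq> 0"
  shows "has_chain 3 (curve t) 1"
  unfolding has_chain_def
proof (intro exI[of _ "\<lambda>i. if i = 0 then {proj_point (pt 0 1 0 t)} else curve t"] conjI allI impI)
  fix i :: nat
  have "proj_point (pt 0 1 0 t) \<in> proj_space 3"
    using proj_point_curve[OF infinity_curve_cone] curve_subset by blast
  then show "zariski_irreducible 3 (if i = 0 then {proj_point (pt 0 1 0 t)} else curve t)"
    using zariski_irreducible_curve[OF t] zariski_irreducible_singleton by simp
  show "\<exists>Z. zariski_closed UNIV 3 Z \<and> (if i = 0 then {proj_point (pt 0 1 0 t)} else curve t) = curve t \<inter> Z"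
  proof (cases "i = 0")
    case True
    then show ?thesis using closed_z singleton_curve_eq by auto
  next
    case False
    then show ?thesis using zariski_closed_curve by auto
  qed
next
  fix i :: nat assume "i < 1"
  then show "(if i = 0 then {proj_point (pt 0 1 0 t)} else curve t) \<subset>
      (if Suc i = 0 then {proj_point (pt 0 1 0 t)} else curve t)"
    using proj_point_curve[OF infinity_curve_cone] curve_not_singleton[of t] by auto
qed

lemma has_dim_curve:
  assumes t: "t \<noteq> 0"
  shows "has_dim 3 (curve t) 1"
proof -
  have "\<not> has_chain 3 (curve t) 2"
  proof
    assume "has_chain 3 (curve t) 2"
    then have "has_chain 3 surface (Suc 2)"
      by (rule has_chain_closed_subset[OF _ curve_eq_Int[OF t] zariski_closed_curve curve_neq_surface
            zariski_irreducible_surface surface_subset])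
    then show False using no_chain_surface by (simp add: numeral_3_eq_3 numeral_2_eq_2)
  qed
  then show ?thesis using has_chain_curve[OF t] by (simp add: has_dim_def numeral_2_eq_2)
qed

lemma has_dim_surface: "has_dim 3 surface 2"
proof -
  have "has_chain 3 surface (Suc 1)"
    by (rule has_chain_closed_subset[OF has_chain_curve curve_eq_Int zariski_closed_curve curve_neq_surface
          zariski_irreducible_surface surface_subset, of 1]) simp_all
  then show ?thesis using no_chain_surface by (simp add: has_dim_def numeral_3_eq_3 numeral_2_eq_2)
qed

lemma projective_curve_curve: "t \<noteq> 0 \<Longrightarrow> projective_curve 3 (curve t)"
  by (simp add: projective_curve_def zariski_closed_curve zariski_irreducible_curve has_dim_curve del: One_nat_def)

lemma smooth_curve: "t \<noteq> 0 \<Longrightarrow> smooth_of_dim 3 (curve t) 1"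
  unfolding smooth_of_dim_def
  by (auto simp: has_dim_curve cone_tangent_curve curve_rep edim_curve_tangent numeral_2_eq_2 simp del: One_nat_def)

lemma surface_over_surface: "subring_set k \<Longrightarrow> surface_over k 3 surface"
  by (simp add: surface_over_def quasi_projective_surface zariski_irreducible_surface has_dim_surface)

section \<open>The pencil\<close>

text \<open>The description by \<open>THE\<close> is legitimate on the surface, since distinct
  curves are disjoint.\<close>

definition pencil :: "point \<Rightarrow> point" where
  "pencil P = proj_point (pt 1 (THE t. P \<in> curve t) 0 0)"

lemma pencil_curve: "P \<in> curve t \<Longrightarrow> pencil P = proj_point (pt 1 t 0 0)"
proof -
  assume P: "P \<in> curve t"
  then have "(THE t. P \<in> curve t) = t" using curve_disjoint by (intro the_equality)
  then show ?thesis by (simp add: pencil_def)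
qed

lemma pencil_value_inj:
  assumes "proj_point (pt 1 t 0 0) = proj_point (pt 1 t' 0 0)"
  shows "t = t'"
proof -
  have "pt 1 t 0 0 \<in> proj_point (pt 1 t' 0 0)" using assms proj_point_self by metis
  then obtain c where c: "pt 1 t 0 0 = (\<lambda>i. c * pt 1 t' 0 0 i)" by (rule proj_pointE)
  from fun_cong[OF c, of 0] fun_cong[OF c, of 1] show ?thesis by simp
qed

lemma fibre_pencil:
  assumes "t \<noteq> 0"
  shows "fibre surface pencil (proj_point (pt 1 t 0 0)) = curve t"
proof (intro equalityI subsetI)
  fix P assume "P \<in> fibre surface pencil (proj_point (pt 1 t 0 0))"
  then have P: "P \<in> surface" "pencil P = proj_point (pt 1 t 0 0)" by (auto simp: fibre_def)
  obtain t' where t': "t' \<noteq> 0" "P \<in> curve t'" using P(1) by (rule surfaceE)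
  then have "t' = t" using pencil_curve P(2) pencil_value_inj by metis
  then show "P \<in> curve t" using t' by simp
next
  fix P assume "P \<in> curve t"
  then show "P \<in> fibre surface pencil (proj_point (pt 1 t 0 0))"
    using pencil_curve curve_subset_surface[OF assms] by (auto simp: fibre_def)
qed

lemma nonempty_fibre_pencil:
  assumes "fibre surface pencil T \<noteq> {}"
  obtains t where "t \<noteq> 0" "T = proj_point (pt 1 t 0 0)" "fibre surface pencil T = curve t"
proof -
  obtain P where P: "P \<in> surface" "pencil P = T" using assms by (auto simp: fibre_def)
  obtain t where t: "t \<noteq> 0" "P \<in> curve t" using P(1) by (rule surfaceE)
  then have "T = proj_point (pt 1 t 0 0)" using pencil_curve P(2) by simp
  then show ?thesis using that t(1) fibre_pencil by simp
qed

text \<open>As \<open>A 1\<close> is \<open>t\<close> times \<open>A 0\<close> on every curve, the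
  common zeros of the pair on the surface are the zeros of \<open>A 0\<close>, and elsewhere the
  ratio is the parameter.\<close>

lemma local_rep_pencil:
  assumes A: "\<And>j. j \<le> 1 \<Longrightarrow> A j \<in> forms k 3 d" and x: "mpoly_eval (A 0) x \<noteq> 0"
    and ratio: "\<And>t y. y \<in> curve_cone t \<Longrightarrow> mpoly_eval (A 1) y = t * mpoly_eval (A 0) y"
  shows "local_rep k 3 surface 1 pencil x A"
  unfolding local_rep_def
proof (intro conjI)
  show "\<exists>d. \<forall>j\<le>1. A j \<in> forms k 3 d" using A by blast
  show "\<exists>j\<le>1. mpoly_eval (A j) x \<noteq> 0" using x by (intro exI[of _ 0]) simp
  show "\<forall>Q\<in>surface. \<forall>y\<in>Q. (\<exists>j\<le>1. mpoly_eval (A j) y \<noteq> 0) \<longrightarrow> pencil Q = proj_point (image_coords 1 A y)"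
  proof (intro ballI impI)
    fix Q y assume Q: "Q \<in> surface" "y \<in> Q" "\<exists>j\<le>1. mpoly_eval (A j) y \<noteq> 0"
    obtain t where t: "t \<noteq> 0" "Q \<in> curve t" using Q(1) by (rule surfaceE)
    have r: "mpoly_eval (A 1) y = t * mpoly_eval (A 0) y" by (rule ratio[OF curve_rep[OF t(2) Q(2)]])
    have nz: "mpoly_eval (A 0) y \<noteq> 0"
    proof
      assume 0: "mpoly_eval (A 0) y = 0"
      obtain j where j: "j \<le> 1" "mpoly_eval (A j) y \<noteq> 0" using Q(3) by blast
      then have "j = 0 \<or> j = 1" by auto
      then show False using j(2) 0 r by auto
    qed
    have "image_coords 1 A y = (\<lambda>i. mpoly_eval (A 0) y * pt 1 t 0 0 i)"
    proof
      fix i :: nat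
      consider "i = 0" | "i = 1" | "i > 1" by linarith
      then show "image_coords 1 A y i = mpoly_eval (A 0) y * pt 1 t 0 0 i"
        using r by cases (auto simp: image_coords_def pt_def)
    qed
    then show "pencil Q = proj_point (image_coords 1 A y)"
      using proj_point_scale[OF nz] pencil_curve[OF t(2)] by simp
  qed
qed

text \<open>The quotient \<open>w / (y + z)\<close> for \<open>t\<close>; \<open>rep2\<close> is
  \<open>f / (y^4 * z)\<close>. Both denominators have zeros on the surface, but on the surface
  \<open>y + z = 0\<close> excludes \<open>y = 0\<close> and \<open>z = 0\<close>.\<close>

definition rep1 :: "nat \<Rightarrow> mpoly" where
  "rep1 j = (if j = 0 then mvar 1 + mvar 2 else mvar 3)"

definition rep2 :: "nat \<Rightarrow> mpoly" where
  "rep2 j = (if j = 0 then mvar 1 ^ 4 * mvar 2 else quintic_form)"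

lemma local_rep1:
  assumes "subring_set k" "x 1 + x 2 \<noteq> 0"
  shows "local_rep k 3 surface 1 pencil x rep1"
proof (rule local_rep_pencil)
  show "rep1 j \<in> forms k 3 1" for j
    using y_plus_z_forms[OF assms(1)] mvar_forms'[OF assms(1), of 3 3] by (simp add: rep1_def)
  show "mpoly_eval (rep1 1) y = t * mpoly_eval (rep1 0) y" if "y \<in> curve_cone t" for t y
    using curve_coneD(3)[OF that] by (simp add: rep1_def)
qed (use assms in \<open>simp add: rep1_def\<close>)

lemma local_rep2:
  assumes "subring_set k" "x 1 \<noteq> 0" "x 2 \<noteq> 0"
  shows "local_rep k 3 surface 1 pencil x rep2"
proof (rule local_rep_pencil)
  show "rep2 j \<in> forms k 3 5" for j
    using y4z_forms[OF assms(1)] quintic_form_forms[OF assms(1)] by (simp add: rep2_def)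
  show "mpoly_eval (rep2 1) y = t * mpoly_eval (rep2 0) y" if "y \<in> curve_cone t" for t y
    using curve_coneD(4)[OF that] by (simp add: rep2_def flip: mult.assoc)
qed (use assms in \<open>simp add: rep2_def\<close>)

lemma curve_cone_antidiagonal:
  assumes "x \<in> curve_cone t" "x 1 + x 2 = 0"
  shows "x 1 \<noteq> 0" "x 2 \<noteq> 0"
  using curve_cone_nonzero[OF assms(1)] assms(2) by (auto simp: add_eq_0_iff)

lemma morphism_over_pencil:
  assumes "subring_set k"
  shows "morphism_over k 3 surface 1 pencil"
  unfolding morphism_over_def
proof (intro ballI)
  fix P x assume P: "P \<in> surface" "x \<in> P"
  obtain t where t: "t \<noteq> 0" "P \<in> curve t" using P(1) by (rule surfaceE)
  have x: "x \<in> curve_cone t" using t(2) P(2) by (rule curve_rep)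
  show "\<exists>A. local_rep k 3 surface 1 pencil x A"
  proof (cases "x 1 + x 2 = 0")
    case False
    then show ?thesis by (intro exI[of _ rep1] local_rep1 assms)
  next
    case True
    then show ?thesis by (intro exI[of _ rep2] local_rep2 assms curve_cone_antidiagonal[OF x])
  qed
qed

lemma pencil_over_pencil:
  assumes "subring_set k"
  shows "pencil_over k 3 surface pencil"
proof -
  have "proj_point (pt 0 1 0 1) \<in> curve 1" "proj_point (pt 0 1 0 2) \<in> curve 2"
    by (rule proj_point_curve[OF infinity_curve_cone])+
  moreover from this have "pencil (proj_point (pt 0 1 0 1)) \<noteq> pencil (proj_point (pt 0 1 0 2))"
    using pencil_curve pencil_value_inj[of 1 2] by auto
  ultimately show ?thesis
    unfolding pencil_over_def
    using morphism_over_pencil[OF assms] subsetD[OF curve_subset_surface[OF one_neq_zero]]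
      subsetD[OF curve_subset_surface[OF zero_neq_numeral[symmetric]]] by blast
qed

section \<open>Tangent spaces of the scheme-theoretic fibres\<close>

lemma dir_deriv_form:
  "((\<lambda>s. mpoly_eval F (\<lambda>i. x i + s * v i)) has_field_derivative dir_deriv (mpoly_eval F) x v) (at 0)"
proof -
  have "(\<lambda>s. mpoly_eval F (\<lambda>i. x i + s * v i)) holomorphic_on UNIV"
    unfolding mpoly_eval_def by (intro holomorphic_intros)
  then show ?thesis unfolding dir_deriv_def by (rule holomorphic_derivI) auto
qed

lemma dir_deriv_surface_form:
  "dir_deriv (mpoly_eval surface_form) x v =
    v 3 * (x 1 ^ 4 * x 2) + x 3 * (4 * x 1 ^ 3 * x 2 * v 1 + x 1 ^ 4 * v 2) -
    ((v 1 + v 2) * quintic (x 0) (x 2) + (x 1 + x 2) * (quintic_dx (x 0) (x 2) * v 0 + quintic_dz (x 0) (x 2) * v 2))"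
  by (rule dir_deriv_eqI, unfold eval_surface_form, rule DERIV_diff, 
      (auto intro!: derivative_eq_intros simp: algebra_simps)[1],
      rule DERIV_cong[OF DERIV_mult[OF _ quintic_has_derivative]], (rule derivative_eq_intros refl)+, simp)

lemma dir_deriv_rep1:
  "dir_deriv (mpoly_eval (rep1 0)) x v = v 1 + v 2" "dir_deriv (mpoly_eval (rep1 1)) x v = v 3"
  unfolding rep1_def by (rule dir_deriv_eqI; auto intro!: derivative_eq_intros)+

lemma dir_deriv_rep2:
  "dir_deriv (mpoly_eval (rep2 0)) x v = 4 * x 1 ^ 3 * x 2 * v 1 + x 1 ^ 4 * v 2"
  "dir_deriv (mpoly_eval (rep2 1)) x v = quintic_dx (x 0) (x 2) * v 0 + quintic_dz (x 0) (x 2) * v 2"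
proof -
  show "dir_deriv (mpoly_eval (rep2 0)) x v = 4 * x 1 ^ 3 * x 2 * v 1 + x 1 ^ 4 * v 2"
    unfolding rep2_def by (rule dir_deriv_eqI) (auto intro!: derivative_eq_intros)
  show "dir_deriv (mpoly_eval (rep2 1)) x v = quintic_dx (x 0) (x 2) * v 0 + quintic_dz (x 0) (x 2) * v 2"
    unfolding rep2_def by (rule dir_deriv_eqI) (simp add: quintic_has_derivative)
qed

text \<open>From left to right, the equation of the surface yields one linear relation between the
  two equations of \<open>curve_tangent\<close>, and the representation valid at \<open>x\<close>
  supplies one of them. Conversely, any representation \<open>A\<close> gives the form
  \<open>?a1 * A 0 - ?a0 * A 1\<close>, which vanishes on the curve and so has derivative 0 along
  its tangent vectors.\<close>

lemma fibre_cone_tangent_pencil: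
  assumes t: "t \<noteq> 0" and x: "x \<in> curve_cone t"
  shows "fibre_cone_tangent 3 surface pencil x = cone_tangent 3 (curve t) x"
proof (intro equalityI subsetI)
  fix v assume "v \<in> fibre_cone_tangent 3 surface pencil x"
  then have v: "v \<in> cone_tangent 3 surface x" and rep: "\<And>A. local_rep UNIV 3 surface 1 pencil x A \<Longrightarrow>
      mpoly_eval (A 1) x * dir_deriv (mpoly_eval (A 0)) x v = mpoly_eval (A 0) x * dir_deriv (mpoly_eval (A 1)) x v"
    by (auto simp: fibre_cone_tangent_def)
  have "vanishes_on surface_form surface"
    by (intro vanishes_on_surfaceI) (use surface_form_zero[OF curve_rep] in \<open>simp add: vanishes_on_def\<close>)
  then have dH: "dir_deriv (mpoly_eval surface_form) x v = 0" and vc: "v \<in> coords 3"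
    using v surface_form_forms[of UNIV] by (auto simp: cone_tangent_def)
  note xD = curve_coneD(3,4)[OF x]
  define g where "g = x 1 ^ 4 * x 2"
  define dg where "dg = 4 * x 1 ^ 3 * x 2 * v 1 + x 1 ^ 4 * v 2"
  define dq where "dq = quintic_dx (x 0) (x 2) * v 0 + quintic_dz (x 0) (x 2) * v 2"
  have q: "quintic (x 0) (x 2) = t * g" unfolding g_def using xD(2) by (simp flip: mult.assoc)
  have "v 3 * g + x 3 * dg - ((v 1 + v 2) * quintic (x 0) (x 2) + (x 1 + x 2) * dq) = 0"
    using dH unfolding dir_deriv_surface_form g_def dg_def dq_def .
  \<comment> \<open>The coefficients \<open>g\<close> and \<open>x 1 + x 2\<close> are the
    denominators of the two expressions for \<open>t\<close>; where one vanishes the other is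
    nonzero. Whichever equation a representation supplies, this relation gives the other.\<close>
  then have H: "g * (v 3 - t * (v 1 + v 2)) + (x 1 + x 2) * (t * dg - dq) = 0"
    unfolding xD(1) q by (simp add: algebra_simps)
  have "v 3 = t * (v 1 + v 2) \<and> t * dg = dq"
  proof (cases "x 1 + x 2 = 0")
    case False
    have "x 3 * (v 1 + v 2) = (x 1 + x 2) * v 3"
      using rep[OF local_rep1[OF subring_set_UNIV False]] unfolding dir_deriv_rep1 by (simp add: rep1_def)
    then have "(x 1 + x 2) * (v 3 - t * (v 1 + v 2)) = 0" unfolding xD(1) by (simp add: algebra_simps)
    then have "v 3 - t * (v 1 + v 2) = 0" using False by simp
    then show ?thesis using H False by simp
  next
    case True
    note nz = curve_cone_antidiagonal[OF x True]
    then have g: "g \<noteq> 0" by (simp add: g_def)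
    have "quintic (x 0) (x 2) * dg = g * dq"
      using rep[OF local_rep2[OF subring_set_UNIV nz]] unfolding dir_deriv_rep2 dg_def dq_def g_def
      by (simp add: rep2_def)
    then have "g * (t * dg - dq) = 0" unfolding q by (simp add: algebra_simps)
    then have "t * dg = dq" using g by simp
    then show ?thesis using H g by simp
  qed
  then show "v \<in> cone_tangent 3 (curve t) x"
    unfolding cone_tangent_curve[OF t x] curve_tangent_def dg_def dq_def using vc by simp
next
  fix v assume v: "v \<in> cone_tangent 3 (curve t) x"
  then have "v \<in> curve_tangent t x" by (simp add: cone_tangent_curve[OF t x])
  note dir0 = dir_deriv_zero_on_curve_tangent[OF t x this]
  have "vanishes_on F (curve t)" if "vanishes_on F surface" for F
    using that curve_subset_surface[OF t] unfolding vanishes_on_def by blast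
  then have "v \<in> cone_tangent 3 surface x" using v by (auto simp: cone_tangent_def)
  moreover have "mpoly_eval (A 1) x * dir_deriv (mpoly_eval (A 0)) x v =
      mpoly_eval (A 0) x * dir_deriv (mpoly_eval (A 1)) x v" if A: "local_rep UNIV 3 surface 1 pencil x A" for A
  proof -
    let ?a0 = "mpoly_eval (A 0) x" and ?a1 = "mpoly_eval (A 1) x"
    obtain d where d: "A 0 \<in> forms UNIV 3 d" "A 1 \<in> forms UNIV 3 d"
      using A unfolding local_rep_def by auto
    have nz: "\<exists>j\<le>1. mpoly_eval (A j) x \<noteq> 0" and
      loc: "\<And>Q y. Q \<in> surface \<Longrightarrow> y \<in> Q \<Longrightarrow> \<exists>j\<le>1. mpoly_eval (A j) y \<noteq> 0 \<Longrightarrow>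
        pencil Q = proj_point (image_coords 1 A y)"
      using A unfolding local_rep_def by blast+
    define B where "B = mconst ?a1 * A 0 + mconst (- ?a0) * A 1"
    have B: "B \<in> forms UNIV 3 d" unfolding B_def by (intro add_forms scale_forms d) auto
    have px: "proj_point x \<in> curve t" by (rule proj_point_curve[OF x])
    have "vanishes_on B (curve t)"
      unfolding vanishes_on_def
    proof (intro ballI)
      fix Q y assume Q: "Q \<in> curve t" "y \<in> Q"
      show "mpoly_eval B y = 0"
      proof (cases "\<exists>j\<le>1. mpoly_eval (A j) y \<noteq> 0")
        case False
        then have "mpoly_eval (A 0) y = 0" "mpoly_eval (A 1) y = 0" by auto
        then show ?thesis by (simp add: B_def)
      next
        case True
        have "proj_point (image_coords 1 A y) = proj_point (image_coords 1 A x)"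
          using loc[OF _ Q(2) True] loc[OF _ proj_point_self nz] Q(1) px curve_subset_surface[OF t]
            pencil_curve[OF Q(1)] pencil_curve[OF px] by auto
        then have "image_coords 1 A y \<in> proj_point (image_coords 1 A x)" using proj_point_self by metis
        then obtain c where c: "image_coords 1 A y = (\<lambda>i. c * image_coords 1 A x i)" by (rule proj_pointE)
        have "mpoly_eval (A 0) y = c * ?a0" "mpoly_eval (A 1) y = c * ?a1"
          using fun_cong[OF c, of 0] fun_cong[OF c, of 1] by (simp_all add: image_coords_def)
        then show ?thesis by (simp add: B_def)
      qed
    qed
    then have "dir_deriv (mpoly_eval B) x v = 0" by (rule dir0[OF B])
    moreover have "dir_deriv (mpoly_eval B) x v =
        ?a1 * dir_deriv (mpoly_eval (A 0)) x v - ?a0 * dir_deriv (mpoly_eval (A 1)) x v"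
    proof (rule dir_deriv_eqI)
      have "((\<lambda>s. ?a1 * mpoly_eval (A 0) (\<lambda>i. x i + s * v i) - ?a0 * mpoly_eval (A 1) (\<lambda>i. x i + s * v i))
          has_field_derivative ?a1 * dir_deriv (mpoly_eval (A 0)) x v - ?a0 * dir_deriv (mpoly_eval (A 1)) x v) (at 0)"
        by (intro DERIV_diff DERIV_cmult dir_deriv_form)
      then show "((\<lambda>s. mpoly_eval B (\<lambda>i. x i + s * v i)) has_field_derivative
          ?a1 * dir_deriv (mpoly_eval (A 0)) x v - ?a0 * dir_deriv (mpoly_eval (A 1)) x v) (at 0)"
        by (simp add: B_def)
    qed
    ultimately show ?thesis by simp
  qed
  ultimately show "v \<in> fibre_cone_tangent 3 surface pencil x" by (simp add: fibre_cone_tangent_def)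
qed

lemma smooth_curve_fibre_pencil:
  assumes "fibre surface pencil T \<noteq> {}"
  shows "smooth_curve_fibre 3 surface pencil T"
proof -
  obtain t where t: "t \<noteq> 0" "fibre surface pencil T = curve t"
    using assms by (rule nonempty_fibre_pencil)
  show ?thesis
    unfolding smooth_curve_fibre_def t(2)
    using projective_curve_curve[OF t(1)] smooth_curve[OF t(1)] fibre_cone_tangent_pencil[OF t(1) curve_rep]
    by blast
qed

section \<open>Two independent regular differentials\<close>

definition quintic_dx_form :: mpoly where
  "quintic_dx_form = mconst 5 * mvar 0 ^ 4 + mconst 6 * (mvar 0 ^ 2 * mvar 2 ^ 2) +
    mconst (- 2) * (mvar 0 * mvar 2 ^ 3) + mvar 2 ^ 4"

lemma eval_quintic_dx_form [simp]: "mpoly_eval quintic_dx_form x = quintic_dx (x 0) (x 2)"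
  by (simp add: quintic_dx_form_def quintic_dx_def algebra_simps)

lemma quintic_dx_form_forms: "quintic_dx_form \<in> forms UNIV 3 4"
proof -
  have "mvar 0 ^ 2 * mvar 2 ^ 2 \<in> forms UNIV 3 (2 + 2)" "mvar 0 * mvar 2 ^ 3 \<in> forms UNIV 3 (1 + 3)"
    by (intro mult_forms mvar_power_forms mvar_forms' subring_set_UNIV; simp)+
  moreover have "2 + 2 = (4 :: nat)" "1 + 3 = (4 :: nat)" by simp_all
  ultimately have "mvar 0 ^ 2 * mvar 2 ^ 2 \<in> forms UNIV 3 4" "mvar 0 * mvar 2 ^ 3 \<in> forms UNIV 3 4"
    by (simp_all only:)
  then show ?thesis
    unfolding quintic_dx_form_def by (intro add_forms scale_forms mvar_power_forms) simp_all
qed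

lemma dir_deriv_quotient:
  assumes "x j \<noteq> 0"
  shows "dir_deriv (\<lambda>y. mpoly_eval (mvar i) y / mpoly_eval (mvar j) y) x v =
    (v i * x j - x i * v j) / x j ^ 2"
  by (rule dir_deriv_eqI) (use assms in \<open>auto intro!: derivative_eq_intros simp: power2_eq_square\<close>)

text \<open>Contracting the tangent equation with Euler's relation: the two expressions
  \<open>(z dx - x dz) / y\<^sup>3\<close> and \<open>4 t z (z dy - y dz) / f\<^sub>x\<close> of the standard differential agree.\<close>

lemma curve_tangent_identity:
  assumes x: "x \<in> curve_cone t" and v: "v \<in> curve_tangent t x"
  shows "quintic_dx (x 0) (x 2) * (x 2 * v 0 - x 0 * v 2) = 4 * t * x 1 ^ 3 * x 2 * (x 2 * v 1 - x 1 * v 2)"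
proof -
  define fx fz where "fx = quintic_dx (x 0) (x 2)" and "fz = quintic_dz (x 0) (x 2)"
  have v: "t * (4 * x 1 ^ 3 * x 2 * v 1 + x 1 ^ 4 * v 2) = fx * v 0 + fz * v 2"
    using v by (simp add: curve_tangent_def fx_def fz_def)
  have euler: "x 0 * fx + x 2 * fz = 5 * (t * x 1 ^ 4 * x 2)"
    unfolding curve_coneD(4)[OF x] fx_def fz_def by (rule quintic_euler)
  have "fx * (x 2 * v 0 - x 0 * v 2) = x 2 * (fx * v 0 + fz * v 2) - (x 0 * fx + x 2 * fz) * v 2"
    by (simp add: algebra_simps)
  also have "\<dots> = 4 * t * x 1 ^ 3 * x 2 * (x 2 * v 1 - x 1 * v 2)"
    unfolding v[symmetric] euler by (simp add: algebra_simps eval_nat_numeral)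
  finally show ?thesis by (simp add: fx_def)
qed

text \<open>The chart where \<open>y\<close> is nonzero uses the functions \<open>x / y\<close> and
  \<open>z / y\<close>: there \<open>H * (z * d(x / y) - x * d(z / y)) / y^(e + 1)\<close> is the
  first expression. The remaining points have \<open>y = 0\<close>, hence \<open>z\<close> nonzero
  and, the roots of the quintic being simple, \<open>quintic_dx\<close> nonzero, so the single
  function \<open>y / z\<close> suffices.\<close>

lemma regular_differentialsI:
  assumes t: "t \<noteq> 0"
    and outside: "\<And>x v. \<not> (x \<in> curve_cone t \<and> v \<in> curve_tangent t x) \<Longrightarrow> \<omega> (x, v) = 0"
    and H: "H \<in> forms UNIV 3 e" and K: "K \<in> forms UNIV 3 4"
    and chart1: "\<And>x v. x \<in> curve_cone t \<Longrightarrow> v \<in> curve_tangent t x \<Longrightarrow> x 1 \<noteq> 0 \<Longrightarrow>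
      \<omega> (x, v) = mpoly_eval H x * (x 2 * v 0 - x 0 * v 2) / x 1 ^ (e + 2)"
    and chart2: "\<And>x v. x \<in> curve_cone t \<Longrightarrow> v \<in> curve_tangent t x \<Longrightarrow> x 2 \<noteq> 0 \<Longrightarrow>
      quintic_dx (x 0) (x 2) \<noteq> 0 \<Longrightarrow>
      \<omega> (x, v) = mpoly_eval K x / quintic_dx (x 0) (x 2) * ((x 2 * v 1 - x 1 * v 2) / x 2 ^ 2)"
  shows "\<omega> \<in> regular_differentials 3 (curve t)"
  unfolding regular_differentials_def
proof (intro CollectI conjI allI ballI impI)
  fix x v assume "\<not> (x \<in> \<Union>(curve t) \<and> v \<in> cone_tangent 3 (curve t) x)"
  then have "\<not> (x \<in> curve_cone t \<and> v \<in> curve_tangent t x)"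
    unfolding Union_curve using cone_tangent_curve[OF t] by auto
  then show "\<omega> (x, v) = 0" by (rule outside)
next
  fix P assume P: "P \<in> curve t"
  obtain x where x: "x \<in> curve_cone t" "P = proj_point x" using P by (rule curveE)
  show "\<exists>(r::nat) a b A B D E.
    (\<forall>j<r. A j \<in> forms UNIV 3 (a j) \<and> B j \<in> forms UNIV 3 (a j) \<and>
           D j \<in> forms UNIV 3 (b j) \<and> E j \<in> forms UNIV 3 (b j)) \<and>
    (\<forall>j<r. \<forall>x\<in>P. mpoly_eval (B j) x \<noteq> 0 \<and> mpoly_eval (E j) x \<noteq> 0) \<and>
    (\<forall>x\<in>\<Union>(curve t). (\<forall>j<r. mpoly_eval (B j) x \<noteq> 0 \<and> mpoly_eval (E j) x \<noteq> 0) \<longrightarrow>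
       (\<forall>v\<in>cone_tangent 3 (curve t) x. \<omega> (x, v) =
          (\<Sum>j<r. mpoly_eval (A j) x / mpoly_eval (B j) x *
             dir_deriv (\<lambda>y. mpoly_eval (D j) y / mpoly_eval (E j) y) x v)))"
    (is "\<exists>r a b A B D E. ?deg r a b A B D E \<and> ?nz r B E \<and> ?eq r A B D E")
  proof (cases "x 1 = 0")
    case False
    define A where "A j = (if j = 0 then H * mvar 2 else mconst (- 1) * (H * mvar 0))" for j :: nat
    define D where "D j = (if j = 0 then mvar 0 else mvar 2)" for j :: nat
    have "?deg 2 (\<lambda>j. e + 1) (\<lambda>j. 1) A (\<lambda>j. mvar 1 ^ (e + 1)) D (\<lambda>j. mvar 1)"
      unfolding A_def D_def
      by (auto intro!: mult_forms[OF H] scale_forms mvar_power_forms mvar_forms' simp del: One_nat_def power_Suc)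
    moreover have "?nz 2 (\<lambda>j. mvar 1 ^ (e + 1)) (\<lambda>j. mvar 1)"
      using False unfolding x(2) by (auto elim!: proj_pointE)
    moreover have "?eq 2 A (\<lambda>j. mvar 1 ^ (e + 1)) D (\<lambda>j. mvar 1)"
    proof (intro ballI impI)
      fix x v assume x: "x \<in> \<Union>(curve t)" and nz: "\<forall>j<2::nat. mpoly_eval (mvar 1 ^ (e + 1)) x \<noteq> 0 \<and> mpoly_eval (mvar 1) x \<noteq> 0"
        and v: "v \<in> cone_tangent 3 (curve t) x"
      have x: "x \<in> curve_cone t" using x unfolding Union_curve .
      have v: "v \<in> curve_tangent t x" using v unfolding cone_tangent_curve[OF t x] .
      have y: "x 1 \<noteq> 0" using nz[rule_format, of 0] by simp
      define h where "h = mpoly_eval H x"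
      have "(\<Sum>j<2::nat. mpoly_eval (A j) x / mpoly_eval (mvar 1 ^ (e + 1)) x *
             dir_deriv (\<lambda>y. mpoly_eval (D j) y / mpoly_eval (mvar 1) y) x v) =
          h * x 2 / x 1 ^ (e + 1) * ((v 0 * x 1 - x 0 * v 1) / x 1 ^ 2) +
          (- (h * x 0)) / x 1 ^ (e + 1) * ((v 2 * x 1 - x 2 * v 1) / x 1 ^ 2)"
        using dir_deriv_quotient[of x 1 0 v, OF y] dir_deriv_quotient[of x 1 2 v, OF y]
        by (simp add: numeral_2_eq_2 A_def D_def h_def mult.assoc mult.commute mult.left_commute)
      also have "\<dots> = (h * x 2 * (v 0 * x 1 - x 0 * v 1) - h * x 0 * (v 2 * x 1 - x 2 * v 1)) /
          (x 1 ^ (e + 1) * x 1 ^ 2)"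
        by (simp only: times_divide_times_eq add_divide_distrib[symmetric]) simp
      also have "\<dots> = (x 1 * (h * (x 2 * v 0 - x 0 * v 2))) / (x 1 * x 1 ^ (e + 2))"
        by (intro arg_cong2[where f = "(/)"]) (simp_all add: algebra_simps eval_nat_numeral)
      also have "\<dots> = h * (x 2 * v 0 - x 0 * v 2) / x 1 ^ (e + 2)"
        by (rule nonzero_mult_divide_mult_cancel_left[OF y])
      finally show "\<omega> (x, v) = (\<Sum>j<2::nat. mpoly_eval (A j) x / mpoly_eval (mvar 1 ^ (e + 1)) x *
             dir_deriv (\<lambda>y. mpoly_eval (D j) y / mpoly_eval (mvar 1) y) x v)"
        unfolding chart1[OF x v y] h_def by (rule sym)
    qed
    ultimately show ?thesis by (intro exI conjI)
  next
    case True
    then have z: "x 2 \<noteq> 0" using curve_cone_nonzero[OF x(1)] by simp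
    have "quintic (x 0) (x 2) = 0" using curve_coneD(4)[OF x(1)] True by simp
    then have fx: "quintic_dx (x 0) (x 2) \<noteq> 0" using quintic_simple_root z by blast
    have "?deg 1 (\<lambda>j. 4) (\<lambda>j. 1) (\<lambda>j. K) (\<lambda>j. quintic_dx_form) (\<lambda>j. mvar 1) (\<lambda>j. mvar 2)"
      by (auto intro!: K quintic_dx_form_forms mvar_forms' simp del: One_nat_def)
    moreover have "?nz 1 (\<lambda>j. quintic_dx_form) (\<lambda>j. mvar 2)"
    proof (intro allI impI ballI)
      fix y assume "y \<in> P"
      then obtain c where c: "c \<noteq> 0" "y = (\<lambda>i. c * x i)" unfolding x(2) by (rule proj_pointE)
      show "mpoly_eval quintic_dx_form y \<noteq> 0 \<and> mpoly_eval (mvar 2) y \<noteq> 0"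
        unfolding c(2) forms_homogeneous[OF quintic_dx_form_forms] using fx z c(1) by simp
    qed
    moreover have "?eq 1 (\<lambda>j. K) (\<lambda>j. quintic_dx_form) (\<lambda>j. mvar 1) (\<lambda>j. mvar 2)"
    proof (intro ballI impI)
      fix x v assume x: "x \<in> \<Union>(curve t)" and nz: "\<forall>j<1::nat. mpoly_eval quintic_dx_form x \<noteq> 0 \<and> mpoly_eval (mvar 2) x \<noteq> 0"
        and v: "v \<in> cone_tangent 3 (curve t) x"
      have x: "x \<in> curve_cone t" using x unfolding Union_curve .
      have v: "v \<in> curve_tangent t x" using v unfolding cone_tangent_curve[OF t x] .
      have nz: "quintic_dx (x 0) (x 2) \<noteq> 0" "x 2 \<noteq> 0" using nz[rule_format, of 0] by simp_all
      show "\<omega> (x, v) = (\<Sum>j<1::nat. mpoly_eval K x / mpoly_eval quintic_dx_form x *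
             dir_deriv (\<lambda>y. mpoly_eval (mvar 1) y / mpoly_eval (mvar 2) y) x v)"
        using dir_deriv_quotient[of x 2 1 v, OF nz(2)] chart2[OF x v nz(2,1)] by (simp add: mult.commute)
    qed
    ultimately show ?thesis by (intro exI conjI)
  qed
qed

text \<open>The standard differentials of the plane quintic are quadratic forms times
  \<open>(z dx - x dz) / (4 t y^3 z)\<close>. The forms \<open>z^2\<close> here and
  \<open>y z\<close> in \<open>diff2\<close>, up to the constant \<open>4 t\<close>, cancel the
  \<open>z\<close> in the denominator, so the expression remains valid at the point at infinity. At
  \<open>y = 0\<close> the formula of the other chart takes over.\<close>

definition diff1 :: "complex \<Rightarrow> vec \<times> vec \<Rightarrow> complex" where
  "diff1 t = (\<lambda>(x, v). if x \<in> curve_cone t \<and> v \<in> curve_tangent t x then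
     (if x 1 \<noteq> 0 then x 2 * (x 2 * v 0 - x 0 * v 2) / x 1 ^ 3
      else 4 * t * x 2 ^ 2 * (x 2 * v 1 - x 1 * v 2) / quintic_dx (x 0) (x 2)) else 0)"

text \<open>For \<open>y = 0\<close> the quotient is \<open>0\<close> by the convention for division, which is the correct value.\<close>

definition diff2 :: "complex \<Rightarrow> vec \<times> vec \<Rightarrow> complex" where
  "diff2 t = (\<lambda>(x, v). if x \<in> curve_cone t \<and> v \<in> curve_tangent t x then
     (x 2 * v 0 - x 0 * v 2) / x 1 ^ 2 else 0)"

lemma curve_tangent_identity_div:
  assumes x: "x \<in> curve_cone t" and v: "v \<in> curve_tangent t x"
    and nz: "x 1 \<noteq> 0" "quintic_dx (x 0) (x 2) \<noteq> 0"
  shows "(x 2 * v 0 - x 0 * v 2) / x 1 ^ 3 = 4 * t * x 2 * (x 2 * v 1 - x 1 * v 2) / quintic_dx (x 0) (x 2)"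
  using curve_tangent_identity[OF x v] nz by (simp add: frac_eq_eq algebra_simps)

lemma diff1_regular:
  assumes t: "t \<noteq> 0"
  shows "diff1 t \<in> regular_differentials 3 (curve t)"
proof (rule regular_differentialsI[OF t])
  show "mvar 2 \<in> forms UNIV 3 1" "mconst (4 * t) * mvar 2 ^ 4 \<in> forms UNIV 3 4"
    by (intro scale_forms mvar_power_forms mvar_forms'; simp)+
  fix x v
  show "diff1 t (x, v) = 0" if "\<not> (x \<in> curve_cone t \<and> v \<in> curve_tangent t x)"
    using that by (auto simp: diff1_def)
  assume x: "x \<in> curve_cone t" and v: "v \<in> curve_tangent t x"
  show "diff1 t (x, v) = mpoly_eval (mvar 2) x * (x 2 * v 0 - x 0 * v 2) / x 1 ^ (1 + 2)" if "x 1 \<noteq> 0"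
    using x v that by (simp add: diff1_def power3_eq_cube)
  assume z: "x 2 \<noteq> 0" and fx: "quintic_dx (x 0) (x 2) \<noteq> 0"
  have "diff1 t (x, v) = x 2 * (4 * t * x 2 * (x 2 * v 1 - x 1 * v 2) / quintic_dx (x 0) (x 2))"
  proof (cases "x 1 = 0")
    case True
    then show ?thesis using x v by (simp add: diff1_def power2_eq_square)
  next
    case False
    then have "diff1 t (x, v) = x 2 * ((x 2 * v 0 - x 0 * v 2) / x 1 ^ 3)" using x v by (simp add: diff1_def)
    then show ?thesis unfolding curve_tangent_identity_div[OF x v False fx] .
  qed
  also have "\<dots> = mpoly_eval (mconst (4 * t) * mvar 2 ^ 4) x / quintic_dx (x 0) (x 2) *
      ((x 2 * v 1 - x 1 * v 2) / x 2 ^ 2)"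
    using z fx by (simp add: divide_simps) (simp add: eval_nat_numeral)
  finally show "diff1 t (x, v) = mpoly_eval (mconst (4 * t) * mvar 2 ^ 4) x / quintic_dx (x 0) (x 2) *
      ((x 2 * v 1 - x 1 * v 2) / x 2 ^ 2)" .
qed

lemma diff2_regular:
  assumes t: "t \<noteq> 0"
  shows "diff2 t \<in> regular_differentials 3 (curve t)"
proof (rule regular_differentialsI[OF t])
  show "1 \<in> forms UNIV 3 0" by (rule one_forms) simp
  have "mvar 2 ^ 3 * mvar 1 \<in> forms UNIV 3 (3 + 1)"
    by (intro mult_forms mvar_power_forms mvar_forms') simp_all
  then show "mconst (4 * t) * (mvar 2 ^ 3 * mvar 1) \<in> forms UNIV 3 4"
    by (intro scale_forms) simp_all
  fix x v
  show "diff2 t (x, v) = 0" if "\<not> (x \<in> curve_cone t \<and> v \<in> curve_tangent t x)"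
    using that by (auto simp: diff2_def)
  assume x: "x \<in> curve_cone t" and v: "v \<in> curve_tangent t x"
  show "diff2 t (x, v) = mpoly_eval 1 x * (x 2 * v 0 - x 0 * v 2) / x 1 ^ (0 + 2)" if "x 1 \<noteq> 0"
    using x v that by (simp add: diff2_def power2_eq_square)
  assume z: "x 2 \<noteq> 0" and fx: "quintic_dx (x 0) (x 2) \<noteq> 0"
  have "diff2 t (x, v) = x 1 * (4 * t * x 2 * (x 2 * v 1 - x 1 * v 2) / quintic_dx (x 0) (x 2))"
  proof (cases "x 1 = 0")
    case True
    then show ?thesis using x v by (simp add: diff2_def)
  next
    case False
    then have "diff2 t (x, v) = x 1 * ((x 2 * v 0 - x 0 * v 2) / x 1 ^ 3)"
      using x v by (simp add: diff2_def eval_nat_numeral)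
    then show ?thesis unfolding curve_tangent_identity_div[OF x v False fx] .
  qed
  also have "\<dots> = mpoly_eval (mconst (4 * t) * (mvar 2 ^ 3 * mvar 1)) x / quintic_dx (x 0) (x 2) *
      ((x 2 * v 1 - x 1 * v 2) / x 2 ^ 2)"
    using z fx by (simp add: divide_simps) (simp add: eval_nat_numeral)
  finally show "diff2 t (x, v) = mpoly_eval (mconst (4 * t) * (mvar 2 ^ 3 * mvar 1)) x / quintic_dx (x 0) (x 2) *
      ((x 2 * v 1 - x 1 * v 2) / x 2 ^ 2)" .
qed

text \<open>At \<open>x = 0\<close>, \<open>z = 1\<close> the quintic is -1 and its derivative in
  \<open>x\<close> is 1, so the tangent vector with \<open>dx = 1\<close> and \<open>dz = 0\<close>
  has \<open>dy = 1 / (4 t y^3)\<close>.\<close>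

lemma diff_values:
  assumes t: "t \<noteq> 0" and y: "t * y ^ 4 = - 1"
  obtains p where "diff1 t p = 1 / y ^ 3" "diff2 t p = 1 / y ^ 2"
proof -
  have y0: "y \<noteq> 0" using y by auto
  define x where "x = pt 0 y 1 (t * (y + 1))"
  define v where "v = pt 1 (1 / (4 * t * y ^ 3)) 0 (t * (1 / (4 * t * y ^ 3)))"
  have "x \<in> curve_cone t" using y by (auto simp: x_def curve_cone_def quintic_def intro!: exI[of _ 2])
  moreover have "v \<in> curve_tangent t x"
    using t y0 by (simp add: x_def v_def curve_tangent_def quintic_dx_def)
  ultimately show ?thesis
    using y0 by (intro that[of "(x, v)"]) (simp_all add: diff1_def diff2_def x_def v_def)
qed

text \<open>Exchanging \<open>y\<close> with \<open>- y\<close> changes the sign of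
  \<open>diff1\<close> and not of \<open>diff2\<close> at the chosen vectors, which separates the
  two.\<close>

lemma genus_curve:
  assumes t: "t \<noteq> 0"
  shows "1 < genus 3 (curve t)"
proof -
  obtain y where "y ^ 4 = - 1 / t" by (rule complex_fourth_root)
  then have y: "t * y ^ 4 = - 1" "t * (- y) ^ 4 = - 1" and y0: "y \<noteq> 0" using t by auto
  obtain p where p: "diff1 t p = 1 / y ^ 3" "diff2 t p = 1 / y ^ 2" using diff_values[OF t y(1)] .
  obtain q where q: "diff1 t q = 1 / (- y) ^ 3" "diff2 t q = 1 / (- y) ^ 2" using diff_values[OF t y(2)] .
  have zero: "a = 0 \<and> b = 0" if "\<And>u. a * diff1 t u + b * diff2 t u = 0" for a b
  proof -
    have "a / y ^ 3 + b / y ^ 2 = 0" "- (a / y ^ 3) + b / y ^ 2 = 0"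
      using that[of p] that[of q] p q by simp_all
    then have "2 * (b / y ^ 2) = 0" "2 * (a / y ^ 3) = 0"
      by (metis add.inverse_inverse add_eq_0_iff mult_2 neg_equal_0_iff_equal add_0 add.right_inverse,
          metis add.inverse_inverse add_eq_0_iff mult_2 neg_equal_0_iff_equal add_0 add.right_inverse)
    then show ?thesis using y0 by simp
  qed
  have ne: "diff1 t \<noteq> diff2 t"
  proof
    assume "diff1 t = diff2 t"
    then show False using zero[of 1 "- 1"] by simp
  qed
  have "fun_space.independent {diff1 t, diff2 t}"
  proof (rule fun_space.independent_if_scalars_zero)
    fix f w assume sum: "(\<Sum>x\<in>{diff1 t, diff2 t}. (\<lambda>y. f x * x y)) = 0" and w: "w \<in> {diff1 t, diff2 t}"
    have "f (diff1 t) * diff1 t u + f (diff2 t) * diff2 t u = 0" for u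
      using fun_cong[OF sum, of u] ne by simp
    from zero[OF this] show "f w = 0" using w by auto
  qed simp
  then have "enat (card {diff1 t, diff2 t}) \<le> genus 3 (curve t)"
    unfolding genus_def edim_def
    by (intro SUP_upper) (use diff1_regular[OF t] diff2_regular[OF t] in auto)
  moreover have "1 < enat (card {diff1 t, diff2 t})" using ne by (simp add: one_enat_def)
  ultimately show ?thesis by (rule less_le_trans[rotated])
qed

section \<open>Rational points\<close>

lemma no_rational_affine_point:
  fixes x y :: complex
  assumes "x \<in> \<rat>" "y \<in> \<rat>" "y ^ 4 = quintic x 1"
  shows False
proof -
  obtain p q where pq: "x = of_rat p" "y = of_rat q" using assms(1,2) by (auto elim!: Rats_cases)
  have "(of_rat (q ^ 4) :: complex) = of_rat (quintic p 1)"
    using assms(3) unfolding pq by (simp add: quintic_def of_rat_power of_rat_mult of_rat_add of_rat_diff)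
  then have "q ^ 4 = quintic p 1" by (simp only: of_rat_eq_iff)
  then show False by (rule no_rational_solution)
qed

lemma pt_Rats: "x \<in> \<rat> \<Longrightarrow> y \<in> \<rat> \<Longrightarrow> z \<in> \<rat> \<Longrightarrow> w \<in> \<rat> \<Longrightarrow> pt x y z w i \<in> \<rat>"
  by (simp add: pt_def)

lemma rational_points_curve:
  assumes c: "c \<in> \<rat>" "c \<noteq> 0"
  shows "rational_points (curve (c ^ 4)) = {proj_point (pt 0 1 0 (c ^ 4))}"
proof (intro equalityI subsetI)
  fix P assume "P \<in> rational_points (curve (c ^ 4))"
  then obtain x where P: "P \<in> curve (c ^ 4)" and x: "x \<in> P" "\<And>i. x i \<in> \<rat>"
    by (auto simp: rational_points_def)
  have xc: "x \<in> curve_cone (c ^ 4)" using P x(1) by (rule curve_rep)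
  have "x 2 = 0"
  proof (rule ccontr)
    assume z: "x 2 \<noteq> 0"
    \<comment> \<open>The parameter \<open>c^4\<close> is absorbed into \<open>y\<close>: this is
      the isomorphism with \<open>curve 1\<close> on affine points.\<close>
    have "(c * (x 1 / x 2)) ^ 4 = quintic (x 0 / x 2) 1"
      using curve_affine[OF curve_coneD(4)[OF xc] z] by (simp only: power_mult_distrib)
    moreover have "x 0 / x 2 \<in> \<rat>" "c * (x 1 / x 2) \<in> \<rat>" using c x(2) by auto
    ultimately show False using no_rational_affine_point by blast
  qed
  then show "P \<in> {proj_point (pt 0 1 0 (c ^ 4))}" using curve_point_at_infinity[OF P x(1)] by simp
next
  fix P assume "P \<in> {proj_point (pt 0 1 0 (c ^ 4))}"
  then have P: "P = proj_point (pt 0 1 0 (c ^ 4))" by simp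
  have "\<forall>i. pt 0 1 0 (c ^ 4) i \<in> \<rat>" using c by (intro allI pt_Rats) auto
  then show "P \<in> rational_points (curve (c ^ 4))"
    unfolding P rational_points_def using proj_point_curve[OF infinity_curve_cone] proj_point_self by blast
qed

lemma pencil_value_rational:
  assumes "t \<in> \<rat>"
  shows "proj_point (pt 1 t 0 0) \<in> rational_points (proj_space 1)"
proof -
  have "\<forall>i. pt 1 t 0 0 i \<in> \<rat>" using assms by (intro allI pt_Rats) auto
  moreover have "pt 1 t 0 0 \<in> coords 1" by (auto simp: coords_def pt_def)
  then have "proj_point (pt 1 t 0 0) \<in> proj_space 1"
    by (rule proj_spaceI) (auto intro!: exI[of _ 0])
  ultimately show ?thesis unfolding rational_points_def using proj_point_self by blast
qed

lemma infinite_single_point_fibres: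
  "infinite {fibre surface pencil T | T.
    T \<in> rational_points (proj_space 1) \<and> card (rational_points (fibre surface pencil T)) = 1}" (is "infinite ?S")
proof -
  \<comment> \<open>Positive integers: nonzero, and determined by their fourth powers.\<close>
  define c where "c k = complex_of_nat (Suc k)" for k
  have c: "c k \<in> \<rat>" "c k \<noteq> 0" for k
  proof -
    show "c k \<in> \<rat>" unfolding c_def by (rule Rats_of_nat)
    show "c k \<noteq> 0" unfolding c_def by (simp only: of_nat_eq_0_iff nat.distinct not_False_eq_True)
  qed
  have fib: "fibre surface pencil (proj_point (pt 1 (c k ^ 4) 0 0)) = curve (c k ^ 4)" for k
    using c by (intro fibre_pencil) simp
  have "range (\<lambda>k. curve (c k ^ 4)) \<subseteq> ?S"
  proof (rule image_subsetI)
    fix k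
    have "card (rational_points (fibre surface pencil (proj_point (pt 1 (c k ^ 4) 0 0)))) = 1"
      unfolding fib rational_points_curve[OF c] by simp
    moreover have "proj_point (pt 1 (c k ^ 4) 0 0) \<in> rational_points (proj_space 1)"
      using c by (intro pencil_value_rational Rats_power)
    ultimately show "curve (c k ^ 4) \<in> ?S" using fib[of k] by blast
  qed
  moreover have "inj (\<lambda>k. curve (c k ^ 4))"
  proof (rule injI)
    fix k l assume "curve (c k ^ 4) = curve (c l ^ 4)"
    then have "c k ^ 4 = c l ^ 4"
      using curve_disjoint proj_point_curve[OF infinity_curve_cone] by metis
    then have "complex_of_nat (Suc k ^ 4) = complex_of_nat (Suc l ^ 4)" by (simp only: c_def of_nat_power)
    then have "Suc k ^ 4 = Suc l ^ 4" by (simp only: of_nat_eq_iff)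
    then have "Suc k = Suc l" by (rule power_eq_imp_eq_base) simp_all
    then show "k = l" by simp
  qed
  ultimately show ?thesis using range_inj_infinite infinite_super by blast
qed

text \<open>Density is tested on the grid of positive integers: at these arguments
  \<open>param\<close> is rational, and a form whose pullback vanishes on an infinite grid vanishes
  on the surface.\<close>

lemma surface_rational_points_dense: "surface \<subseteq> zariski_closure 3 (rational_points surface)"
  unfolding zariski_closure_def
proof (rule Inter_greatest)
  fix Z assume "Z \<in> {Z. zariski_closed UNIV 3 Z \<and> rational_points surface \<subseteq> Z}"
  then have Z: "zariski_closed UNIV 3 Z" and sub: "rational_points surface \<subseteq> Z" by auto
  obtain S where S: "S \<subseteq> (\<Union>d. forms UNIV 3 d)" "Z = {P \<in> proj_space 3. \<forall>F\<in>S. vanishes_on F {P}}"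
    using Z by (auto simp: zariski_closed_def)
  define U where "U = range (\<lambda>k. complex_of_nat (Suc k))"
  have U: "infinite U" unfolding U_def
    by (rule range_inj_infinite) (auto intro!: injI simp del: of_nat_Suc)
  have U_Rats: "x \<in> \<rat>" "x \<noteq> 0" if "x \<in> U" for x
    using that unfolding U_def by (auto simp del: of_nat_Suc)
  have "vanishes_on F surface" if "F \<in> S" for F
  proof -
    obtain d where F: "F \<in> forms UNIV 3 d" using S(1) \<open>F \<in> S\<close> by blast
    show ?thesis
    proof (rule vanishes_on_surface_dense[OF F U U])
      fix x y assume x: "x \<in> U" and y: "y \<in> U"
      have xy: "x \<in> \<rat>" "y \<in> \<rat>" "y \<noteq> 0" using U_Rats x y by auto
      \<comment> \<open>A rational root would be a rational solution of
        \<open>y^4 = quintic x 1\<close> with \<open>y = 0\<close>.\<close>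
      have q: "quintic x 1 \<noteq> 0" using no_rational_affine_point[OF xy(1), of 0] by auto
      have "quintic x 1 \<in> \<rat>" unfolding quintic_def using xy by simp
      then have "\<forall>i. param (x, y) i \<in> \<rat>"
        unfolding param_def using xy by (intro allI pt_Rats) simp_all
      then have "proj_point (param (x, y)) \<in> rational_points surface"
        using param_surface[OF xy(3) q] proj_point_self unfolding rational_points_def by blast
      then have "vanishes_on F {proj_point (param (x, y))}" using sub S(2) \<open>F \<in> S\<close> by blast
      then show "mpoly_eval F (param (x, y)) = 0" unfolding vanishes_on_proj_point[OF F] .
    qed
  qed
  then show "surface \<subseteq> Z" unfolding S(2) using surface_subset by (auto simp: vanishes_on_def)
qed

theorem proposition1p5:
  "\<exists>n X f.
     surface_over \<rat> n X \<and>
     pencil_over \<rat> n X f \<and>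
     (\<forall>t\<in>proj_space 1. fibre X f t \<noteq> {} \<longrightarrow>
        smooth_curve_fibre n X f t \<and> 1 < genus n (fibre X f t)) \<and>
     infinite {fibre X f t | t.
        t \<in> rational_points (proj_space 1) \<and> card (rational_points (fibre X f t)) = 1} \<and>
     X \<subseteq> zariski_closure n (rational_points X)"
proof (rule exI[of _ 3], rule exI[of _ surface], rule exI[of _ pencil], intro conjI ballI impI)
  show "surface_over \<rat> 3 surface" by (rule surface_over_surface) simp
  show "pencil_over \<rat> 3 surface pencil" by (rule pencil_over_pencil) simp
  fix T assume ne: "fibre surface pencil T \<noteq> {}"
  show "smooth_curve_fibre 3 surface pencil T" by (rule smooth_curve_fibre_pencil[OF ne])
  obtain t where "t \<noteq> 0" "fibre surface pencil T = curve t" using ne by (rule nonempty_fibre_pencil)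
  then show "1 < genus 3 (fibre surface pencil T)" by (simp add: genus_curve)
qed (rule infinite_single_point_fibres surface_rational_points_dense)+

end
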